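(* The sequence $(F^k)_{k\in\mathbb{N}^*}$ of approximations (solutions to $$v_i\cdot\nabla F_i^k=Q_i^{+k}-F_i^k\nu_i^k\ \text{ in }\Omega,\qquad F_i^k=f_{bi}^k\ \text{ on }\partial\Omega_i^+,\qquad 1\le i\le p,$$ constructed as in the context) is weakly compact in $L^1$, i.e. relatively weakly compact in $(L^1(\Omega))^p$.
   Context: Setting. $\Omega\subset\mathbb{R}^2$ is a strictly convex bounded open set with $C^2$ boundary, $n(Z)$ is the inward normal at $Z\in\partial\Omega$, $\sigma$ is arc length on $\partial\Omega$, $\mathbb{N}^*=\mathbb{N}\setminus\{0\}$, $a\wedge b=\min(a,b)$, and $L^1_+(\Omega)$ is the set of non-negative integrable functions on $\Omega$. A discrete velocity model is given by pairwise distinct non-zero velocities $v_1,\dots,v_p\in\mathbb{R}^2$ and coefficients $\Gamma_{ij}^{lm}=\Gamma_{ji}^{lm}=\Gamma_{lm}^{ij}\ge 0$ such that $\Gamma_{ij}^{lm}\ne 0$ implies $v_i+v_j=v_l+v_m$ and $|v_i|^2+|v_j|^2=|v_l|^2+|v_m|^2$. A couple $(v_i,v_j)$ is interacting if $\Gamma_{ij}^{lm}>0$ for some $(l,m)$. The model is assumed normal: every $\Psi$ with $\Psi(v_i)+\Psi(v_j)=\Psi(v_l)+\Psi(v_m)$ for all $(i,j;l,m)$ with $\Gamma_{ij}^{lm}>0$ is of the form $\Psi(v)=a+b\cdot v+c|v|^2$ with $a,c\in\mathbb{R}$, $b\in\mathbb{R}^2$. It is assumed that no pair of interacting velocities $(v_i,v_j)$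 is colinear (linearly dependent), and that for each $i$ some $\Gamma_{ij}^{lm}$ is non-zero. Set $\partial\Omega_i^+=\{Z\in\partial\Omega: v_i\cdot n(Z)>0\}$. The boundary data $f_{bi}\ge 0$ on $\partial\Omega_i^+$ satisfy $\int_{\partial\Omega_i^+}v_i\cdot n(z) f_{bi}(1+\ln f_{bi})(z)d\sigma(z)<+\infty$, $1\le i\le p$. Approximations. Let $\mu_\alpha$ be a smooth mollifier in $\mathbb{R}^2$ supported in the ball of radius $\alpha$ centered at the origin (a function on $\Omega$ to be convolved with $\mu_\alpha$ is continued outside $\Omega$ in the normal direction by its boundary value), let $\tilde\mu_k$ be a smooth mollifier on $\partial\Omega$ in a ball of radius $\frac1k$, and $f_{bi}^k=(f_{bi}\wedge\frac k2)*\tilde\mu_k$. For $\alpha>0$, $k\in\mathbb{N}^*$, $F^{\alpha,k}\in(L^1_+(\Omega))^p$ is a solution to $$\alpha F_i^{\alpha,k}+v_i\cdot\nabla F_i^{\alpha,k}=\sum_{j,l,m=1}^p\Gamma_{ij}^{lm}\Big(\frac{F_l^{\alpha,k}}{1+\frac{F_l^{\alpha,k}}{k}}\frac{F_m^{\alpha,k}*\mu_\alpha}{1+\frac{F_m^{\alpha,k}*\mu_\alpha}{k}}-\frac{F_i^{\alpha,k}}{1+\frac{F_i^{\alpha,k}}{k}}\frac{F_j^{\alpha,k}*\mu_\alpha}{1+\frac{F_j^{\alpha,k}*\mu_\alpha}{k}}\Big),\qquad F_i^{\alpha,k}=f_{bi}^k\text{ on }\partial\Omega_i^+,$$ and $F^k=(F_i^k)_{1\le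 i\le p}$ is the strong $(L^1(\Omega))^p$ limit, as $q\to+\infty$, of $F^{\beta(q),k}$ for some sequence $\beta(q)\to0$ (such solutions and sequences are known to exist). $F^k$ is a non-negative solution to the system in the claim, where $$Q_i^{+k}=\sum_{j,l,m=1}^p\Gamma_{ij}^{lm}\frac{F_l^k}{1+\frac{F_l^k}{k}}\frac{F_m^k}{1+\frac{F_m^k}{k}},\qquad \nu_i^k=\sum_{j,l,m=1}^p\Gamma_{ij}^{lm}\frac{F_j^k}{(1+\frac{F_i^k}{k})(1+\frac{F_j^k}{k})}.$$ *)

theory Defs
  imports "HOL-Analysis.Analysis"
begin

section \<open>Domain, boundary, arc length\<close>

definition strictly_convex :: "'a::euclidean_space set \<Rightarrow> bool" where
  "strictly_convex S \<longleftrightarrow>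
     (\<forall>x\<in>closure S. \<forall>y\<in>closure S. x \<noteq> y \<longrightarrow> open_segment x y \<subseteq> interior S)"

text \<open>The boundary is a regular closed simple curve of class $C^2$, given by an
  arc length parametrization \<open>\<gamma>\<close> of period \<open>L\<close> (the length of the boundary). For a bounded
  convex planar domain, such a \<open>\<gamma>\<close> exists exactly if the boundary is of class $C^2$.\<close>

definition C2_boundary_param :: "(real^2) set \<Rightarrow> real \<Rightarrow> (real \<Rightarrow> real^2) \<Rightarrow> bool" where
  "C2_boundary_param \<Omega> L \<gamma> \<longleftrightarrow>
     0 < L \<and> (\<forall>s. \<gamma> (s + L) = \<gamma> s) \<and> inj_on \<gamma> {0..<L} \<and> range \<gamma> = frontier \<Omega> \<and>
     (\<exists>\<gamma>' \<gamma>''. (\<forall>s. (\<gamma> has_vector_derivative \<gamma>' s) (at s)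
                   \<and> (\<gamma>' has_vector_derivative \<gamma>'' s) (at s)
                   \<and> norm (\<gamma>' s) = 1)
               \<and> continuous_on UNIV \<gamma>'')"

definition arc_length :: "real \<Rightarrow> (real \<Rightarrow> real^2) \<Rightarrow> (real^2) measure" where
  "arc_length L \<gamma> = distr (restrict_space lborel {0..<L}) borel \<gamma>"

definition inward_normal :: "(real^2) set \<Rightarrow> (real \<Rightarrow> real^2) \<Rightarrow> real^2 \<Rightarrow> real^2" where
  "inward_normal \<Omega> \<gamma> Z =
     (THE u. norm u = 1 \<and> (\<exists>s. \<gamma> s = Z \<and> u \<bullet> vector_derivative \<gamma> (at s) = 0)
             \<and> (\<forall>\<^sub>F t in at_right 0. Z + t *\<^sub>R u \<in> \<Omega>))"

definition inflow_boundary :: "(real^2) set \<Rightarrow> (real \<Rightarrow> real^2) \<Rightarrow> real^2 \<Rightarrow> (real^2) set" where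
  "inflow_boundary \<Omega> \<gamma> w = {Z \<in> frontier \<Omega>. 0 < w \<bullet> inward_normal \<Omega> \<gamma> Z}"


section \<open>Mollifiers\<close>

definition smooth :: "('a::euclidean_space \<Rightarrow> real) \<Rightarrow> bool" where
  "smooth f \<longleftrightarrow>
     (\<forall>bs. set bs \<subseteq> Basis \<longrightarrow>
        foldr (\<lambda>b g x. frechet_derivative g (at x) b) bs f differentiable_on UNIV)"

definition mollifier :: "real \<Rightarrow> ('a::euclidean_space \<Rightarrow> real) \<Rightarrow> bool" where
  "mollifier r \<mu> \<longleftrightarrow> smooth \<mu> \<and> (\<forall>x. 0 \<le> \<mu> x) \<and> (\<forall>x. r < norm x \<longrightarrow> \<mu> x = 0)
                   \<and> integrable lborel \<mu> \<and> (LINT x|lborel. \<mu> x) = 1"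

definition convolution :: "('a::euclidean_space \<Rightarrow> real) \<Rightarrow> ('a \<Rightarrow> real) \<Rightarrow> 'a \<Rightarrow> real" where
  "convolution f \<mu> x = (LINT y|lborel. f (x - y) * \<mu> y)"

text \<open>Convolution on the boundary curve, with respect to arc length: the mollifier lives on
  the real line and the boundary is identified with the reals modulo \<open>L\<close>.\<close>

definition boundary_convolution ::
  "real \<Rightarrow> (real \<Rightarrow> real^2) \<Rightarrow> (real^2 \<Rightarrow> real) \<Rightarrow> (real \<Rightarrow> real) \<Rightarrow> real^2 \<Rightarrow> real" where
  "boundary_convolution L \<gamma> g \<mu> Z = convolution (g \<circ> \<gamma>) \<mu> (the_inv_into {0..<L} \<gamma> Z)"

text \<open>Data for the velocity \<open>w\<close>: truncation at \<open>k/2\<close>, continued by 0 to the part of the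
  boundary where no datum is prescribed, and mollified.\<close>

definition mollified_data ::
  "(real^2) set \<Rightarrow> real \<Rightarrow> (real \<Rightarrow> real^2) \<Rightarrow> (real \<Rightarrow> real) \<Rightarrow> nat \<Rightarrow> real^2 \<Rightarrow> (real^2 \<Rightarrow> real)
     \<Rightarrow> real^2 \<Rightarrow> real" where
  "mollified_data \<Omega> L \<gamma> \<mu> k w b =
     boundary_convolution L \<gamma>
       (\<lambda>Z. if Z \<in> inflow_boundary \<Omega> \<gamma> w then min (b Z) (real k / 2) else 0) \<mu>"

text \<open>Boundary value at \<open>Z\<close> of an $L^1$ function along the characteristic of direction \<open>w\<close>
  through \<open>Z\<close>, followed into the domain. Averaging makes the value independent of
  the representative for almost every \<open>Z\<close>; for a function that is absolutely continuous along the
  characteristic it is the usual limit.\<close>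

definition boundary_value ::
  "(real^2) set \<Rightarrow> (real \<Rightarrow> real^2) \<Rightarrow> real^2 \<Rightarrow> (real^2 \<Rightarrow> real) \<Rightarrow> real^2 \<Rightarrow> real" where
  "boundary_value \<Omega> \<gamma> w F Z =
     Lim (at_right 0)
       (\<lambda>h. (LINT s:{0..h}|lborel. F (Z + (s * sgn (w \<bullet> inward_normal \<Omega> \<gamma> Z)) *\<^sub>R w)) / h)"

definition normal_extension ::
  "(real^2) set \<Rightarrow> (real \<Rightarrow> real^2) \<Rightarrow> real^2 \<Rightarrow> (real^2 \<Rightarrow> real) \<Rightarrow> real^2 \<Rightarrow> real" where
  "normal_extension \<Omega> \<gamma> w F x =
     (if x \<in> \<Omega> then F x
      else boundary_value \<Omega> \<gamma> w F
             (THE Z. Z \<in> frontier \<Omega> \<and> (\<exists>t\<ge>0. x = Z - t *\<^sub>R inward_normal \<Omega> \<gamma> Z)))"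


section \<open>Discrete velocity models\<close>

definition discrete_velocity_model ::
  "('i::finite \<Rightarrow> real^2) \<Rightarrow> ('i \<Rightarrow> 'i \<Rightarrow> 'i \<Rightarrow> 'i \<Rightarrow> real) \<Rightarrow> bool" where
  "discrete_velocity_model v \<Gamma> \<longleftrightarrow>
     inj v \<and> (\<forall>i. v i \<noteq> 0) \<and>
     (\<forall>i j l m. 0 \<le> \<Gamma> i j l m \<and> \<Gamma> i j l m = \<Gamma> j i l m \<and> \<Gamma> i j l m = \<Gamma> l m i j) \<and>
     (\<forall>i j l m. \<Gamma> i j l m \<noteq> 0 \<longrightarrow>
        v i + v j = v l + v m \<and>
        (norm (v i))\<^sup>2 + (norm (v j))\<^sup>2 = (norm (v l))\<^sup>2 + (norm (v m))\<^sup>2)"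

definition normal_model ::
  "('i::finite \<Rightarrow> real^2) \<Rightarrow> ('i \<Rightarrow> 'i \<Rightarrow> 'i \<Rightarrow> 'i \<Rightarrow> real) \<Rightarrow> bool" where
  "normal_model v \<Gamma> \<longleftrightarrow>
     (\<forall>\<Psi> :: real^2 \<Rightarrow> real.
        (\<forall>i j l m. 0 < \<Gamma> i j l m \<longrightarrow> \<Psi> (v i) + \<Psi> (v j) = \<Psi> (v l) + \<Psi> (v m)) \<longrightarrow>
        (\<exists>a b c. \<forall>i. \<Psi> (v i) = a + b \<bullet> v i + c * (norm (v i))\<^sup>2))"

definition interacting :: "('i \<Rightarrow> 'i \<Rightarrow> 'i \<Rightarrow> 'i \<Rightarrow> real) \<Rightarrow> 'i \<Rightarrow> 'i \<Rightarrow> bool" where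
  "interacting \<Gamma> i j \<longleftrightarrow> (\<exists>l m. 0 < \<Gamma> i j l m)"


section \<open>Stationary transport equations and the approximations\<close>

text \<open>For \<open>z\<close> in the domain, \<open>z - entry_time \<Omega> w z *\<^sub>R w\<close> is the point of the
  boundary where the characteristic of direction \<open>w\<close> through \<open>z\<close> enters the domain.\<close>

definition entry_time :: "(real^2) set \<Rightarrow> real^2 \<Rightarrow> real^2 \<Rightarrow> real" where
  "entry_time \<Omega> w z = Sup {s. 0 \<le> s \<and> z - s *\<^sub>R w \<in> \<Omega>}"

text \<open>Mild formulation, by integration along almost all characteristics, of
  $\alpha F + w\cdot\nabla F = G$ in the domain with $F = b$ on the inflow boundary.\<close>

definition mild_transport_solution ::
  "(real^2) set \<Rightarrow> real^2 \<Rightarrow> real \<Rightarrow> (real^2 \<Rightarrow> real) \<Rightarrow> (real^2 \<Rightarrow> real) \<Rightarrow> (real^2 \<Rightarrow> real) \<Rightarrow> bool"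
where
  "mild_transport_solution \<Omega> w \<alpha> G b F \<longleftrightarrow>
     (AE z in lborel. z \<in> \<Omega> \<longrightarrow>
        set_integrable lborel {0..entry_time \<Omega> w z}
          (\<lambda>s. G (z - s *\<^sub>R w) - \<alpha> * F (z - s *\<^sub>R w)) \<and>
        F z = b (z - entry_time \<Omega> w z *\<^sub>R w)
              + (LINT s:{0..entry_time \<Omega> w z}|lborel. G (z - s *\<^sub>R w) - \<alpha> * F (z - s *\<^sub>R w)))"

definition L1_plus :: "(real^2) set \<Rightarrow> (real^2 \<Rightarrow> real) \<Rightarrow> bool" where
  "L1_plus \<Omega> F \<longleftrightarrow> set_integrable lborel \<Omega> F \<and> (AE z in lborel. z \<in> \<Omega> \<longrightarrow> 0 \<le> F z)"

definition trunc :: "nat \<Rightarrow> real \<Rightarrow> real" where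
  "trunc k x = x / (1 + x / real k)"

text \<open>In \<open>mollified_collision\<close> the argument \<open>H\<close> is the mollified version of \<open>F\<close>.\<close>

definition mollified_collision ::
  "('i::finite \<Rightarrow> 'i \<Rightarrow> 'i \<Rightarrow> 'i \<Rightarrow> real) \<Rightarrow> nat \<Rightarrow> ('i \<Rightarrow> real^2 \<Rightarrow> real) \<Rightarrow> ('i \<Rightarrow> real^2 \<Rightarrow> real)
     \<Rightarrow> 'i \<Rightarrow> real^2 \<Rightarrow> real" where
  "mollified_collision \<Gamma> k F H i z =
     (\<Sum>j\<in>UNIV. \<Sum>l\<in>UNIV. \<Sum>m\<in>UNIV. \<Gamma> i j l m *
        (trunc k (F l z) * trunc k (H m z) - trunc k (F i z) * trunc k (H j z)))"

definition mollified_approximation ::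
  "(real^2) set \<Rightarrow> real \<Rightarrow> (real \<Rightarrow> real^2) \<Rightarrow> ('i::finite \<Rightarrow> real^2) \<Rightarrow> ('i \<Rightarrow> 'i \<Rightarrow> 'i \<Rightarrow> 'i \<Rightarrow> real)
     \<Rightarrow> ('i \<Rightarrow> real^2 \<Rightarrow> real) \<Rightarrow> (real^2 \<Rightarrow> real) \<Rightarrow> (real \<Rightarrow> real) \<Rightarrow> real \<Rightarrow> nat
     \<Rightarrow> ('i \<Rightarrow> real^2 \<Rightarrow> real) \<Rightarrow> bool" where
  "mollified_approximation \<Omega> L \<gamma> v \<Gamma> f\<^sub>b \<mu> \<mu>\<^sub>b \<alpha> k F \<longleftrightarrow>
     (\<forall>i. L1_plus \<Omega> (F i) \<and>
          mild_transport_solution \<Omega> (v i) \<alpha>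
            (mollified_collision \<Gamma> k F
               (\<lambda>j. convolution (normal_extension \<Omega> \<gamma> (v j) (F j)) \<mu>) i)
            (mollified_data \<Omega> L \<gamma> \<mu>\<^sub>b k (v i) (f\<^sub>b i))
            (F i))"

definition gain ::
  "('i::finite \<Rightarrow> 'i \<Rightarrow> 'i \<Rightarrow> 'i \<Rightarrow> real) \<Rightarrow> nat \<Rightarrow> ('i \<Rightarrow> real^2 \<Rightarrow> real) \<Rightarrow> 'i \<Rightarrow> real^2 \<Rightarrow> real" where
  "gain \<Gamma> k F i z =
     (\<Sum>j\<in>UNIV. \<Sum>l\<in>UNIV. \<Sum>m\<in>UNIV. \<Gamma> i j l m *
        (F l z / (1 + F l z / real k)) * (F m z / (1 + F m z / real k)))"

definition collision_frequency ::
  "('i::finite \<Rightarrow> 'i \<Rightarrow> 'i \<Rightarrow> 'i \<Rightarrow> real) \<Rightarrow> nat \<Rightarrow> ('i \<Rightarrow> real^2 \<Rightarrow> real) \<Rightarrow> 'i \<Rightarrow> real^2 \<Rightarrow> real" where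
  "collision_frequency \<Gamma> k F i z =
     (\<Sum>j\<in>UNIV. \<Sum>l\<in>UNIV. \<Sum>m\<in>UNIV. \<Gamma> i j l m *
        (F j z / ((1 + F i z / real k) * (1 + F j z / real k))))"

definition limit_approximation ::
  "(real^2) set \<Rightarrow> real \<Rightarrow> (real \<Rightarrow> real^2) \<Rightarrow> ('i::finite \<Rightarrow> real^2) \<Rightarrow> ('i \<Rightarrow> 'i \<Rightarrow> 'i \<Rightarrow> 'i \<Rightarrow> real)
     \<Rightarrow> ('i \<Rightarrow> real^2 \<Rightarrow> real) \<Rightarrow> (real \<Rightarrow> real) \<Rightarrow> nat \<Rightarrow> ('i \<Rightarrow> real^2 \<Rightarrow> real) \<Rightarrow> bool" where
  "limit_approximation \<Omega> L \<gamma> v \<Gamma> f\<^sub>b \<mu>\<^sub>b k F \<longleftrightarrow>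
     (\<forall>i. L1_plus \<Omega> (F i) \<and>
          mild_transport_solution \<Omega> (v i) 0
            (\<lambda>z. gain \<Gamma> k F i z - F i z * collision_frequency \<Gamma> k F i z)
            (mollified_data \<Omega> L \<gamma> \<mu>\<^sub>b k (v i) (f\<^sub>b i))
            (F i))"

definition tendsto_L1 ::
  "(real^2) set \<Rightarrow> (nat \<Rightarrow> 'i::finite \<Rightarrow> real^2 \<Rightarrow> real) \<Rightarrow> ('i \<Rightarrow> real^2 \<Rightarrow> real) \<Rightarrow> bool" where
  "tendsto_L1 \<Omega> G F \<longleftrightarrow> (\<forall>i. (\<lambda>q. LINT z:\<Omega>|lborel. \<bar>G q i z - F i z\<bar>) \<longlonglongrightarrow> 0)"


section \<open>Weak topology of $(L^1(\Omega))^p$\<close>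

definition L1_tuples :: "(real^2) set \<Rightarrow> ('i::finite \<Rightarrow> real^2 \<Rightarrow> real) set" where
  "L1_tuples \<Omega> = {F. \<forall>i. set_integrable lborel \<Omega> (F i)}"

definition Linf_tuples :: "(real^2) set \<Rightarrow> ('i::finite \<Rightarrow> real^2 \<Rightarrow> real) set" where
  "Linf_tuples \<Omega> = {g. \<forall>i. set_borel_measurable lborel \<Omega> (g i) \<and>
                           (\<exists>B. AE z in lborel. z \<in> \<Omega> \<longrightarrow> \<bar>g i z\<bar> \<le> B)}"

text \<open>The initial topology for the pairings with the elements of the dual space
  $(L^\infty(\Omega))^p$. Functions are not identified modulo null sets, so the topology is not
  Hausdorff; this does not affect compactness, since functions that agree almost everywhere
  belong to the same open sets.\<close>

definition weak_L1_topology :: "(real^2) set \<Rightarrow> ('i::finite \<Rightarrow> real^2 \<Rightarrow> real) topology" where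
  "weak_L1_topology \<Omega> =
     pullback_topology (L1_tuples \<Omega>)
       (\<lambda>F. \<lambda>g\<in>Linf_tuples \<Omega>. \<Sum>i\<in>UNIV. LINT z:\<Omega>|lborel. F i z * g i z)
       (product_topology (\<lambda>_. euclideanreal) (Linf_tuples \<Omega>))"

definition relatively_weakly_compact_L1 ::
  "(real^2) set \<Rightarrow> ('i::finite \<Rightarrow> real^2 \<Rightarrow> real) set \<Rightarrow> bool" where
  "relatively_weakly_compact_L1 \<Omega> S \<longleftrightarrow>
     S \<subseteq> L1_tuples \<Omega> \<and>
     compactin (weak_L1_topology \<Omega>) (weak_L1_topology \<Omega> closure_of S)"

end

theory Submission
  imports Defs
begin

text \<open>The components of the functions \<open>F k\<close> are non-negative and \<open>\<Omega>\<close> has finite measure, so that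
  weak compactness follows from equi-integrability: this is the Dunford--Pettis theorem, in the form
  \<open>relatively_weakly_compact_L1_if_equiintegrable\<close>. Three estimates on the equation solved by \<open>F k\<close>, with
  bounds independent of the truncation \<open>k\<close>, give the equi-integrability.

  Outflow. On a characteristic of direction \<open>v i\<close> the component \<open>F i\<close> is Lipschitz, hence has a
  value where the characteristic leaves the domain. Conservation of mass bounds the outgoing
  mass by the ingoing one. Multiplication by \<open>ln (trunc k (F i))\<close> and summation over \<open>i\<close> give an
  entropy balance with a non-positive production, so the outgoing entropy is bounded by
  the ingoing one. The density of this entropy grows faster than linearly up to the level \<open>k\<close>, so the outgoing
  values are equi-integrable (\<open>outflow_tail\<close>).

  Exponential bound. Along its characteristic, \<open>F i\<close> can only be reduced at the rate given by the collision
  frequency, so that its values inside are at most \<open>exp N\<close> times the outgoing value as soon as the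
  frequency has integral at most \<open>N\<close> on the characteristic. Only velocities that are not
  parallel to \<open>v i\<close> contribute to the frequency. The flux of the momentum component
  normal to \<open>v i\<close>, in the direction normal to \<open>v i\<close>, involves precisely these velocities, each with a
  positive weight, and it changes from one line parallel to \<open>v i\<close> to another
  by boundary terms only. This bounds the integral on almost every line by the total mass flux
  (\<open>line_momentum_bound\<close>) and reduces the tails of \<open>F i\<close> to those of the outgoing values
  (\<open>uniform_tail\<close>).

  Ingoing entropy. The entropy of the mollified data has to be bounded uniformly in \<open>k\<close>. The data are integrable
  only against the weight \<open>v \<bullet> n\<close>, and mollification at the scale \<open>1/k\<close> moves mass from places
  where this weight is small to places where it is larger. The loss is confined
  to the set where \<open>\<bar>v \<bullet> n\<bar>\<close> is of order \<open>1/k\<close>. There the variation of \<open>v \<bullet> n\<close> is of order \<open>1/k\<close>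
  as well, because the curvature of a convex curve has a sign (\<open>grazing_band_estimate\<close>), and this
  compensates the size of data truncated at \<open>k/2\<close> (\<open>mollified_inflow_entropy_bound\<close>).\<close>

section \<open>Weak compactness of equi-integrable families\<close>

lemma compactin_pullback_topology:
  assumes "compactin T C" "C \<subseteq> f ` A"
  shows "compactin (pullback_topology A f T) (f -` C \<inter> A)"
  unfolding compactin_def
proof (intro conjI allI impI)
  show "f -` C \<inter> A \<subseteq> topspace (pullback_topology A f T)"
    using compactin_subset_topspace[OF assms(1)] by (auto simp: topspace_pullback_topology)
  fix \<U> assume U: "(\<forall>u\<in>\<U>. openin (pullback_topology A f T) u) \<and> f -` C \<inter> A \<subseteq> \<Union>\<U>"
  then have "\<forall>u\<in>\<U>. \<exists>w. openin T w \<and> u = f -` w \<inter> A"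
    by (simp add: openin_pullback_topology)
  then obtain W where W: "\<And>u. u \<in> \<U> \<Longrightarrow> openin T (W u) \<and> u = f -` W u \<inter> A" by metis
  have "C \<subseteq> \<Union>(W ` \<U>)"
  proof
    fix c assume "c \<in> C"
    then obtain a where a: "a \<in> A" "c = f a" using assms(2) by auto
    then obtain u where u: "u \<in> \<U>" "a \<in> u" using U \<open>c \<in> C\<close> by blast
    have "a \<in> f -` W u \<inter> A" using W[OF u(1)] u(2) by simp
    then show "c \<in> \<Union>(W ` \<U>)" using u a by auto
  qed
  moreover have "\<forall>w\<in>W ` \<U>. openin T w" using W by auto
  ultimately obtain \<F> where F: "finite \<F>" "\<F> \<subseteq> W ` \<U>" "C \<subseteq> \<Union>\<F>"
    using assms(1) unfolding compactin_def by meson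
  then obtain \<V> where V: "\<V> \<subseteq> \<U>" "finite \<V>" "\<F> = W ` \<V>" by (meson finite_subset_image)
  have "f -` C \<inter> A \<subseteq> \<Union>\<V>"
  proof
    fix a assume "a \<in> f -` C \<inter> A"
    then obtain u where u: "u \<in> \<V>" "f a \<in> W u" "a \<in> A" using F V by blast
    then have "a \<in> f -` W u \<inter> A" by simp
    then show "a \<in> \<Union>\<V>" using W[of u] u V by auto
  qed
  then show "\<exists>\<F>. finite \<F> \<and> \<F> \<subseteq> \<U> \<and> f -` C \<inter> A \<subseteq> \<Union>\<F>" using V by blast
qed

text \<open>A weak topology is a pullback of a product topology. Compactness may be checked in the product as
  long as the compact set there consists of values of the map.\<close>

lemma compactin_pullback_closure_of:
  assumes S: "S \<subseteq> A" "f ` S \<subseteq> C" and C: "compactin T C" "closedin T C" "C \<subseteq> f ` A"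
  shows "compactin (pullback_topology A f T) (pullback_topology A f T closure_of S)"
proof (rule closed_compactin)
  let ?P = "pullback_topology A f T"
  show "compactin ?P (f -` C \<inter> A)" by (rule compactin_pullback_topology[OF C(1,3)])
  have "topspace ?P - (f -` C \<inter> A) = f -` (topspace T - C) \<inter> A"
    by (auto simp: topspace_pullback_topology)
  moreover have "openin T (topspace T - C)" using C(2) by (simp add: closedin_def)
  ultimately have "openin ?P (topspace ?P - (f -` C \<inter> A))"
    by (metis openin_pullback_topology)
  then have "closedin ?P (f -` C \<inter> A)"
    unfolding closedin_def using compactin_subset_topspace[OF C(1)]
    by (auto simp: topspace_pullback_topology)
  then show "?P closure_of S \<subseteq> f -` C \<inter> A"
    by (intro closure_of_minimal) (use S in auto)
qed simp

text \<open>Basic neighbourhoods in a product constrain finitely many coordinates.\<close>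

lemma product_closure_of_approx:
  fixes l :: "'i \<Rightarrow> real"
  assumes l: "l \<in> product_topology (\<lambda>_. euclideanreal) I closure_of X"
    and J: "finite J" "J \<subseteq> I" and e: "0 < e"
  shows "\<exists>x\<in>X. \<forall>j\<in>J. \<bar>x j - l j\<bar> < e"
proof -
  let ?V = "\<lambda>j. if j \<in> J then ball (l j) e else UNIV"
  have "openin (product_topology (\<lambda>_. euclideanreal) I) (\<Pi>\<^sub>E i\<in>I. ?V i)"
  proof (rule product_topology_basis)
    show "openin euclideanreal (?V i)" for i by auto
    show "finite {i. ?V i \<noteq> topspace euclideanreal}"
      by (rule finite_subset[OF _ J(1)]) (auto split: if_splits)
  qed
  moreover have "l \<in> (\<Pi>\<^sub>E i\<in>I. ?V i)"
    using l e by (auto simp: in_closure_of PiE_def)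
  ultimately obtain x where x: "x \<in> X" "x \<in> (\<Pi>\<^sub>E i\<in>I. ?V i)"
    using l unfolding in_closure_of by blast
  have "\<bar>x j - l j\<bar> < e" if "j \<in> J" for j
    using PiE_mem[OF x(2), of j] that J by (auto simp: dist_real_def abs_minus_commute)
  then show ?thesis using x by auto
qed

text \<open>Boundedness is required on the space of the measure only, so that the class is stable under
  changes of a function outside it.\<close>

definition bounded_measurable :: "'a measure \<Rightarrow> ('a \<Rightarrow> real) \<Rightarrow> bool" where
  "bounded_measurable M g \<longleftrightarrow> g \<in> borel_measurable M \<and> (\<exists>B. \<forall>x\<in>space M. \<bar>g x\<bar> \<le> B)"

lemma bounded_measurable_add:
  "bounded_measurable M g \<Longrightarrow> bounded_measurable M h \<Longrightarrow> bounded_measurable M (\<lambda>x. g x + h x)"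
  unfolding bounded_measurable_def by (auto, meson abs_triangle_ineq add_mono order_trans)

lemma bounded_measurable_scale:
  "bounded_measurable M g \<Longrightarrow> bounded_measurable M (\<lambda>x. c * g x)"
  unfolding bounded_measurable_def by (auto simp: abs_mult) (meson abs_ge_zero mult_left_mono)

lemma bounded_measurable_indicator: "A \<in> sets M \<Longrightarrow> bounded_measurable M (indicator A)"
  unfolding bounded_measurable_def by (auto intro!: exI[of _ 1] simp: indicator_def)

lemma (in finite_measure) integrable_bounded_measurable:
  "bounded_measurable M g \<Longrightarrow> integrable M g"
  unfolding bounded_measurable_def by (auto intro!: integrable_const_bound[of g] AE_I2)

text \<open>The last assumption is equi-integrability in dual form. It makes the set function \<open>A
  \<mapsto> m (indicator A)\<close> countably additive and absolutely continuous, so that Radon--Nikodym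
  yields a density; the same assumption lets \<open>m\<close> pass to monotone limits, hence to all bounded
  functions.\<close>

lemma (in finite_measure) positive_functional_representation:
  fixes m :: "('a \<Rightarrow> real) \<Rightarrow> real"
  assumes add: "\<And>g h. bounded_measurable M g \<Longrightarrow> bounded_measurable M h \<Longrightarrow>
      m (\<lambda>x. g x + h x) = m g + m h"
    and scale: "\<And>g c. bounded_measurable M g \<Longrightarrow> m (\<lambda>x. c * g x) = c * m g"
    and pos: "\<And>g. bounded_measurable M g \<Longrightarrow> (\<And>x. x \<in> space M \<Longrightarrow> 0 \<le> g x) \<Longrightarrow> 0 \<le> m g"
    and ui: "\<And>e. 0 < e \<Longrightarrow> \<exists>K\<ge>0. \<forall>g. bounded_measurable M g \<longrightarrow> (\<forall>x\<in>space M. 0 \<le> g x \<and> g x \<le> 1) \<longrightarrow>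
      m g \<le> e + K * (\<integral>x. g x \<partial>M)"
  obtains f where "integrable M f" "\<And>x. 0 \<le> f x"
    "\<And>g. bounded_measurable M g \<Longrightarrow> m g = (\<integral>x. f x * g x \<partial>M)"
proof -
  note bmI = bounded_measurable_indicator
  define B where "B A = m (indicator A)" for A
  have null: "B A = 0" if "A \<in> sets M" "emeasure M A = 0" for A
  proof -
    have "B A \<le> e" if "0 < e" for e
    proof -
      obtain K where K: "\<And>g. bounded_measurable M g \<Longrightarrow> (\<forall>x\<in>space M. 0 \<le> g x \<and> g x \<le> 1) \<Longrightarrow>
          m g \<le> e + K * (\<integral>x. g x \<partial>M)" using ui[OF \<open>0 < e\<close>] by blast
      have "m (indicator A) \<le> e + K * (\<integral>x. indicator A x \<partial>M)"
        by (intro K bmI) (use \<open>A \<in> sets M\<close> in \<open>auto simp: indicator_def\<close>)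
      also have "(\<integral>x. indicator A x \<partial>M) = (0::real)"
        using \<open>A \<in> sets M\<close> \<open>emeasure M A = 0\<close> by (simp add: measure_def)
      finally show ?thesis by (simp add: B_def)
    qed
    then have "B A \<le> 0" by (meson dense_ge)
    moreover have "0 \<le> B A" unfolding B_def by (intro pos bmI that) auto
    ultimately show ?thesis by simp
  qed
  have Badd: "B (A \<union> A') = B A + B A'" if "A \<in> sets M" "A' \<in> sets M" "A \<inter> A' = {}" for A A'
  proof -
    have "indicator (A \<union> A') = (\<lambda>x. indicator A x + indicator A' x :: real)"
      using that by (auto simp: indicator_def fun_eq_iff)
    then show ?thesis unfolding B_def using add[OF bmI bmI] that by metis
  qed
  have Bpos: "0 \<le> B A" if "A \<in> sets M" for A unfolding B_def by (intro pos bmI that) auto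
  define N where "N = measure_of (space M) (sets M) (\<lambda>A. ennreal (B A))"
  have ca: "countably_additive (sets M) (\<lambda>A. ennreal (B A))"
  proof (rule sets.empty_continuous_imp_countably_additive)
    show "positive (sets M) (\<lambda>A. ennreal (B A))" using null[of "{}"] by (auto simp: positive_def)
    show "additive (sets M) (\<lambda>A. ennreal (B A))"
      by (auto simp: additive_def Badd Bpos)
    fix A :: "nat \<Rightarrow> 'a set" assume A: "range A \<subseteq> sets M" "decseq A" "(\<Inter>i. A i) = {}"
    have "(\<lambda>i. B (A i)) \<longlonglongrightarrow> 0"
    proof (rule LIMSEQ_I)
      fix e :: real assume "0 < e"
      then obtain K where K: "0 \<le> K" "\<And>g. bounded_measurable M g \<Longrightarrow> (\<forall>x\<in>space M. 0 \<le> g x \<and> g x \<le> 1) \<Longrightarrow>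
          m g \<le> e/2 + K * (\<integral>x. g x \<partial>M)" using ui[of "e/2"] by auto
      have "(\<lambda>i. measure M (A i)) \<longlonglongrightarrow> measure M (\<Inter>i. A i)"
        by (rule finite_Lim_measure_decseq[OF A(1,2)])
      then have "(\<lambda>i. e/2 + K * measure M (A i)) \<longlonglongrightarrow> e/2 + K * 0"
        using A(3) by (intro tendsto_intros) simp
      then have "\<forall>\<^sub>F i in sequentially. e/2 + K * measure M (A i) < e"
        by (rule order_tendstoD(2)) (use \<open>0 < e\<close> in simp)
      then obtain n0 where n0: "\<And>i. i \<ge> n0 \<Longrightarrow> e/2 + K * measure M (A i) < e"
        unfolding eventually_sequentially by auto
      have "norm (B (A i) - 0) < e" if "i \<ge> n0" for i
      proof -
        have Ai: "A i \<in> sets M" using A by auto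
        have "m (indicator (A i)) \<le> e/2 + K * (\<integral>x. indicator (A i) x \<partial>M)"
          by (intro K bmI Ai) (auto simp: indicator_def)
        then show ?thesis using Bpos[OF Ai] n0[OF that] Ai unfolding B_def by simp
      qed
      then show "\<exists>no. \<forall>n\<ge>no. norm (B (A n) - 0) < e" by blast
    qed
    then show "(\<lambda>i. ennreal (B (A i))) \<longlonglongrightarrow> 0"
      using tendsto_ennrealI by fastforce
  qed auto
  have setsN[simp]: "sets N = sets M" "space N = space M" unfolding N_def by simp_all
  have N: "emeasure N A = ennreal (B A)" if "A \<in> sets M" for A
    unfolding N_def
    by (rule emeasure_measure_of_sigma)
      (use ca null[of "{}"] that sets.sigma_algebra_axioms in \<open>auto simp: positive_def\<close>)
  have "absolutely_continuous M N"
    unfolding absolutely_continuous_def by (auto simp: null_sets_def N null)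
  then obtain h where h: "h \<in> borel_measurable M" "density M h = N"
    using Radon_Nikodym[of N] by auto
  have hN: "(\<integral>\<^sup>+x. h x * indicator A x \<partial>M) = ennreal (B A)" if "A \<in> sets M" for A
    using N[OF that] emeasure_density[OF h(1) that] h(2) by simp
  have "(\<integral>\<^sup>+x. h x \<partial>M) = ennreal (B (space M))"
    using hN[of "space M"] by (simp cong: nn_integral_cong)
  then have "(\<integral>\<^sup>+x. h x \<partial>M) \<noteq> \<infinity>" by simp
  then have hfin: "AE x in M. h x \<noteq> \<infinity>" using nn_integral_PInf_AE h(1) by blast
  define f where "f x = enn2real (h x)" for x
  have fm[measurable]: "f \<in> borel_measurable M" unfolding f_def using h(1) by measurable
  have f0: "0 \<le> f x" for x by (simp add: f_def)
  have fh: "AE x in M. ennreal (f x) = h x" using hfin by eventually_elim (simp add: f_def top.not_eq_extremum)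
  have fint: "integrable M f"
  proof (rule integrableI_nonneg)
    have "(\<integral>\<^sup>+x. ennreal (f x) \<partial>M) = (\<integral>\<^sup>+x. h x \<partial>M)" by (rule nn_integral_cong_AE[OF fh])
    then show "(\<integral>\<^sup>+x. ennreal (f x) \<partial>M) < \<infinity>" using \<open>(\<integral>\<^sup>+x. h x \<partial>M) = _\<close> by simp
  qed (use f0 in auto)
  have fgint: "integrable M (\<lambda>x. f x * g x)" if g: "bounded_measurable M g" for g
  proof -
    obtain C where C: "\<And>x. x \<in> space M \<Longrightarrow> \<bar>g x\<bar> \<le> C" and gm[measurable]: "g \<in> borel_measurable M"
      using g unfolding bounded_measurable_def by auto
    show ?thesis
    proof (rule Bochner_Integration.integrable_bound)
      show "integrable M (\<lambda>x. C * f x)" using fint by simp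
      have "norm (f x * g x) \<le> norm (C * f x)" if "x \<in> space M" for x
        using C[OF that] f0[of x] mult_right_mono[OF C[OF that] f0[of x]]
        by (simp add: abs_mult mult.commute)
      then show "AE x in M. norm (f x * g x) \<le> norm (C * f x)" by simp
    qed measurable
  qed
  have ind: "m (indicator A) = (\<integral>x. f x * indicator A x \<partial>M)" if A: "A \<in> sets M" for A
  proof -
    have "(\<integral>\<^sup>+x. ennreal (f x * indicator A x) \<partial>M) = (\<integral>\<^sup>+x. h x * indicator A x \<partial>M)"
      by (rule nn_integral_cong_AE) (use fh in eventually_elim, auto simp: indicator_def)
    then have "(\<integral>\<^sup>+x. ennreal (f x * indicator A x) \<partial>M) = ennreal (B A)" using hN[OF A] by simp
    then show ?thesis unfolding B_def[symmetric]
      using A f0 Bpos[OF A] by (subst integral_eq_nn_integral) auto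
  qed
  have nonneg: "bounded_measurable M g \<longrightarrow> m g = (\<integral>x. f x * g x \<partial>M)"
    if "g \<in> borel_measurable M" "\<And>x. 0 \<le> g x" for g
    using that
  proof (induction rule: borel_measurable_induct_real)
    case (set A)
    then show ?case using ind by simp
  next
    case (mult u c)
    show ?case
    proof (cases "c = 0")
      case True
      have "bounded_measurable M (\<lambda>_. 0::real)" by (auto simp: bounded_measurable_def)
      then show ?thesis using scale[of "\<lambda>_. 0" 0] True by simp
    next
      case False
      show ?thesis
      proof
        assume "bounded_measurable M (\<lambda>x. c * u x)"
        from bounded_measurable_scale[OF this, of "1/c"] have "bounded_measurable M u"
          using False by simp
        then show "m (\<lambda>x. c * u x) = (\<integral>x. f x * (c * u x) \<partial>M)"
          using mult scale[of u c] by (simp add: mult.left_commute)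
      qed
    qed
  next
    case (add u v)
    show ?case
    proof
      assume b: "bounded_measurable M (\<lambda>x. v x + u x)"
      then obtain C where C: "\<And>x. x \<in> space M \<Longrightarrow> \<bar>v x + u x\<bar> \<le> C"
        unfolding bounded_measurable_def by auto
      have uv: "\<bar>u x\<bar> \<le> C" "\<bar>v x\<bar> \<le> C" if "x \<in> space M" for x
        using C[OF that] add.hyps(2)[of x] add.hyps(4)[of x] by linarith+
      have u: "bounded_measurable M u" and v: "bounded_measurable M v"
        unfolding bounded_measurable_def using add.hyps(1,3) uv by meson+
      show "m (\<lambda>x. v x + u x) = (\<integral>x. f x * (v x + u x) \<partial>M)"
        using add.IH u v assms(1)[OF v u] fgint[OF u] fgint[OF v]
        by (simp add: distrib_left)
    qed
  next
    case (seq U)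
    show ?case
    proof
      assume g: "bounded_measurable M g"
      obtain C0 where C0: "\<And>x. x \<in> space M \<Longrightarrow> \<bar>g x\<bar> \<le> C0" using g unfolding bounded_measurable_def
        by auto
      define C where "C = max C0 1"
      have C: "\<And>x. x \<in> space M \<Longrightarrow> \<bar>g x\<bar> \<le> C" "C > 0" using C0 by (fastforce simp: C_def)+
      have le: "U n x \<le> g x" if "x \<in> space M" for n x
        using seq.hyps(3) seq.hyps(4)[OF that]
        by (intro incseq_le[of "\<lambda>n. U n x"]) (auto simp: incseq_def le_fun_def)
      have Ub: "\<bar>U n x\<bar> \<le> C" if "x \<in> space M" for n x
        using le[OF that, of n] C(1)[OF that] seq.hyps(2)[of n x] by linarith
      have bU: "bounded_measurable M (U n)" for n
        unfolding bounded_measurable_def using seq.hyps(1) Ub by auto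
      have [measurable]: "g \<in> borel_measurable M" using g by (simp add: bounded_measurable_def)
      have [measurable]: "U n \<in> borel_measurable M" for n by (rule seq.hyps(1))
      have lim1: "(\<lambda>n. m (U n)) \<longlonglongrightarrow> (\<integral>x. f x * g x \<partial>M)"
      proof -
        have "(\<lambda>n. \<integral>x. f x * U n x \<partial>M) \<longlonglongrightarrow> (\<integral>x. f x * g x \<partial>M)"
        proof (rule integral_dominated_convergence[where w = "\<lambda>x. f x * C"])
          show "integrable M (\<lambda>x. f x * C)" using fint by simp
          show "AE x in M. (\<lambda>i. f x * U i x) \<longlonglongrightarrow> f x * g x"
            using seq.hyps(4) by (intro AE_I2 tendsto_intros) auto
          show "AE x in M. norm (f x * U n x) \<le> f x * C" for n
            using Ub f0 by (intro AE_I2) (auto simp: abs_mult intro!: mult_left_mono)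
        qed measurable
        then show ?thesis using seq.IH bU by simp
      qed
      have lim2: "(\<lambda>n. (\<integral>x. g x - U n x \<partial>M)) \<longlonglongrightarrow> 0"
      proof -
        have "(\<lambda>n. (\<integral>x. g x - U n x \<partial>M)) \<longlonglongrightarrow> (\<integral>x. 0 \<partial>M)"
        proof (rule integral_dominated_convergence[where w = "\<lambda>x. 2 * C"])
          show "AE x in M. (\<lambda>i. g x - U i x) \<longlonglongrightarrow> 0"
            using seq.hyps(4) by (intro AE_I2) (auto intro!: tendsto_eq_intros)
          show "AE x in M. norm (g x - U n x) \<le> 2 * C" for n
            using Ub[of _ n] C(1) by (intro AE_I2) (fastforce simp: abs_le_iff)
        qed auto
        then show ?thesis by simp
      qed
      have "(\<lambda>n. m (U n)) \<longlonglongrightarrow> m g"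
      proof (rule LIMSEQ_I)
        fix e :: real assume "0 < e"
        define e' where "e' = e / (2 * C)"
        have e': "0 < e'" using \<open>0 < e\<close> C(2) by (simp add: e'_def)
        obtain K where K: "0 \<le> K" "\<And>g. bounded_measurable M g \<Longrightarrow> (\<forall>x\<in>space M. 0 \<le> g x \<and> g x \<le> 1) \<Longrightarrow>
          m g \<le> e' + K * (\<integral>x. g x \<partial>M)" using ui[OF e'] by auto
        have "(\<lambda>n. e / 2 + K * (\<integral>x. g x - U n x \<partial>M)) \<longlonglongrightarrow> e / 2 + K * 0"
          by (intro tendsto_intros lim2)
        then have "\<forall>\<^sub>F n in sequentially. e / 2 + K * (\<integral>x. g x - U n x \<partial>M) < e"
          by (rule order_tendstoD(2)) (use \<open>0 < e\<close> in simp)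
        then obtain n0 where n0: "\<And>n. n \<ge> n0 \<Longrightarrow> e / 2 + K * (\<integral>x. g x - U n x \<partial>M) < e"
          unfolding eventually_sequentially by auto
        have "norm (m (U n) - m g) < e" if "n \<ge> n0" for n
        proof -
          let ?d = "\<lambda>x. g x + (-1) * U n x"
          have bd: "bounded_measurable M ?d"
            by (rule bounded_measurable_add[OF g bounded_measurable_scale[OF bU]])
          have "m (\<lambda>x. (1 / C) * ?d x) \<le> e' + K * (\<integral>x. (1 / C) * ?d x \<partial>M)"
          proof (rule K(2)[OF bounded_measurable_scale[OF bd]], intro ballI conjI)
            fix x assume x: "x \<in> space M"
            show "0 \<le> 1 / C * ?d x" using le[OF x, of n] C(2) by simp
            show "1 / C * ?d x \<le> 1" using seq.hyps(2)[of n x] C(1)[OF x] C(2) by simp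
          qed
          then have "m ?d / C \<le> e' + K * (\<integral>x. ?d x \<partial>M) / C"
            using scale[OF bd, of "1 / C"] by simp
          then have "m ?d \<le> C * e' + K * (\<integral>x. ?d x \<partial>M)"
            using C(2) by (simp add: field_simps)
          also have "\<dots> < e" using n0[OF that] C(2) by (simp add: e'_def)
          finally have "m ?d < e" .
          moreover have "0 \<le> m ?d" by (rule pos[OF bd]) (use le[of _ n] in simp)
          moreover have "m ?d = m g - m (U n)"
            using add[OF g bounded_measurable_scale[OF bU, of "-1" n]] scale[OF bU, of "-1" n] by simp
          ultimately show ?thesis by simp
        qed
        then show "\<exists>no. \<forall>n\<ge>no. norm (m (U n) - m g) < e" by blast
      qed
      then show "m g = (\<integral>x. f x * g x \<partial>M)" using lim1 LIMSEQ_unique by blast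
    qed
  qed
  show ?thesis
  proof (rule that[OF fint f0])
    fix g assume g: "bounded_measurable M g"
    then obtain C0 where C0: "\<And>x. x \<in> space M \<Longrightarrow> \<bar>g x\<bar> \<le> C0"
      unfolding bounded_measurable_def by auto
    have gm[measurable]: "g \<in> borel_measurable M" using g by (simp add: bounded_measurable_def)
    have k: "bounded_measurable M (\<lambda>_. k::real)" for k by (auto simp: bounded_measurable_def)
    define C where "C = max C0 0"
    define g' where "g' x = max (g x + C) 0" for x
    have gk: "bounded_measurable M (\<lambda>x. g x + C)" by (rule bounded_measurable_add[OF g k])
    have eq: "g' x = g x + C" if "x \<in> space M" for x
      using C0[OF that] by (auto simp: g'_def C_def)
    have g': "bounded_measurable M g'" unfolding bounded_measurable_def
    proof
      show "g' \<in> borel_measurable M" unfolding g'_def by measurable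
      show "\<exists>B. \<forall>x\<in>space M. \<bar>g' x\<bar> \<le> B" using gk eq by (auto simp: bounded_measurable_def)
    qed
    have d: "bounded_measurable M (\<lambda>x. g' x + (-1) * (g x + C))"
      by (rule bounded_measurable_add[OF g' bounded_measurable_scale[OF gk]])
    have d': "bounded_measurable M (\<lambda>x. (-1) * (g' x + (-1) * (g x + C)))"
      by (rule bounded_measurable_scale[OF d])
    have "m (\<lambda>x. g' x + (-1) * (g x + C)) = 0"
      using pos[OF d] pos[OF d'] scale[OF d, of "-1"] eq by force
    then have "m g' = m (\<lambda>x. g x + C)"
      using add[OF g' bounded_measurable_scale[OF gk, of "-1"]] scale[OF gk, of "-1"] by simp
    moreover have "m g' = (\<integral>x. f x * g' x \<partial>M)"
      using nonneg[of g'] g' by (auto simp: g'_def bounded_measurable_def)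
    moreover have "(\<integral>x. f x * g' x \<partial>M) = (\<integral>x. f x * (g x + C) \<partial>M)"
      by (rule Bochner_Integration.integral_cong) (simp_all add: eq)
    moreover have "m (\<lambda>_. C) = (\<integral>x. f x * C \<partial>M)"
      using nonneg[of "\<lambda>x. C"] k by (auto simp: C_def)
    ultimately show "m g = (\<integral>x. f x * g x \<partial>M)"
      using add[OF g k[of C]] fgint[OF g] fgint[OF k[of C]] by (simp add: distrib_left)
  qed
qed

text \<open>Linear inequalities between finitely many coordinates survive in the closure. Applied to the
  pairings with bounded functions, this shows that every limit functional is linear, positive and as
  absolutely continuous as the family itself.\<close>

lemma closure_of_linear_le:
  fixes l :: "'a \<Rightarrow> real" and p :: "'j \<Rightarrow> 'a"
  assumes l: "l \<in> product_topology (\<lambda>_. euclideanreal) I closure_of X"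
    and J: "finite J" "p ` J \<subseteq> I"
    and le: "\<And>x. x \<in> X \<Longrightarrow> (\<Sum>j\<in>J. c j * x (p j)) \<le> b"
  shows "(\<Sum>j\<in>J. c j * l (p j)) \<le> b"
proof (rule field_le_epsilon)
  fix e :: real assume e: "0 < e"
  define s where "s = (\<Sum>j\<in>J. \<bar>c j\<bar>) + 1"
  have s: "0 < s" unfolding s_def by (smt (verit) abs_ge_zero sum_nonneg)
  obtain x where x: "x \<in> X" "\<forall>q\<in>p ` J. \<bar>x q - l q\<bar> < e / s"
    using product_closure_of_approx[OF l _ J(2), of "e / s"] J(1) e s by auto
  have "(\<Sum>j\<in>J. c j * l (p j)) - (\<Sum>j\<in>J. c j * x (p j)) = (\<Sum>j\<in>J. c j * (l (p j) - x (p j)))"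
    by (simp add: sum_subtractf right_diff_distrib)
  also have "\<dots> \<le> (\<Sum>j\<in>J. \<bar>c j\<bar> * (e / s))"
  proof (rule sum_mono)
    fix j assume "j \<in> J"
    then have "\<bar>l (p j) - x (p j)\<bar> \<le> e / s" using x(2) by (force simp: abs_minus_commute)
    then have "\<bar>c j * (l (p j) - x (p j))\<bar> \<le> \<bar>c j\<bar> * (e / s)"
      by (simp only: abs_mult) (rule mult_left_mono, auto)
    then show "c j * (l (p j) - x (p j)) \<le> \<bar>c j\<bar> * (e / s)" by linarith
  qed
  also have "\<dots> = (s - 1) * (e / s)" unfolding sum_distrib_right[symmetric] by (simp add: s_def)
  also have "\<dots> \<le> e" using s e by (simp add: field_simps)
  finally show "(\<Sum>j\<in>J. c j * l (p j)) \<le> b + e" using le[OF x(1)] by simp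
qed

text \<open>By Tychonoff the values of the pairings have a compact closure in the product over all bounded
  test tuples. Every point of this closure is a positive linear functional with the uniform absolute
  continuity of the family, hence is given by an integrable tuple, and compactness can be pulled back.\<close>

theorem relatively_weakly_compact_L1_if_equiintegrable:
  fixes S :: "('i::finite \<Rightarrow> real^2 \<Rightarrow> real) set"
  assumes \<Omega>: "\<Omega> \<in> sets borel" "emeasure lborel \<Omega> < \<infinity>"
    and int: "\<And>F i. F \<in> S \<Longrightarrow> set_integrable lborel \<Omega> (F i)"
    and nn: "\<And>F i. F \<in> S \<Longrightarrow> AE z in lborel. z \<in> \<Omega> \<longrightarrow> 0 \<le> F i z"
    and ui: "\<And>e. 0 < e \<Longrightarrow> \<exists>K. \<forall>F\<in>S. \<forall>i. (LINT z:\<Omega>|lborel. (if K < F i z then F i z else 0)) \<le> e"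
  shows "relatively_weakly_compact_L1 \<Omega> S"
proof -
  define M where "M = restrict_space (lborel :: (real^2) measure) \<Omega>"
  have \<Omega>': "\<Omega> \<inter> space lborel \<in> sets (lborel :: (real^2) measure)" using \<Omega> by simp
  have spM[simp]: "space M = \<Omega>" by (simp add: M_def space_restrict_space)
  interpret finite_measure M
    by (rule finite_measureI) (use \<Omega> in \<open>simp add: M_def emeasure_restrict_space\<close>)
  have setint: "(LINT z:\<Omega>|lborel. h z) = (\<integral>z. h z \<partial>M)" for h :: "real^2 \<Rightarrow> real"
    unfolding M_def set_lebesgue_integral_def by (rule integral_restrict_space[OF \<Omega>', symmetric])
  have setintb: "set_integrable lborel \<Omega> h \<longleftrightarrow> integrable M h" for h :: "real^2 \<Rightarrow> real"
    unfolding M_def set_integrable_def by (rule integrable_restrict_space[OF \<Omega>', symmetric])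
  have setbm: "set_borel_measurable lborel \<Omega> h \<longleftrightarrow> h \<in> borel_measurable M" for h :: "real^2 \<Rightarrow> real"
    unfolding M_def set_borel_measurable_def by (rule borel_measurable_restrict_space_iff[OF \<Omega>', symmetric])
  have AEM: "(AE z in lborel. z \<in> \<Omega> \<longrightarrow> P z) \<longleftrightarrow> (AE z in M. P z)" for P
    unfolding M_def by (rule AE_restrict_space_iff[OF \<Omega>', symmetric])
  define pair where "pair F g = (\<Sum>i\<in>UNIV. \<integral>z. F i z * g i z \<partial>M)" for F g :: "'i \<Rightarrow> real^2 \<Rightarrow> real"
  define \<Lambda> where "\<Lambda> F = restrict (pair F) (Linf_tuples \<Omega>)" for F :: "'i \<Rightarrow> real^2 \<Rightarrow> real"
  let ?T = "product_topology (\<lambda>_. euclideanreal) (Linf_tuples \<Omega> :: ('i \<Rightarrow> real^2 \<Rightarrow> real) set)"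
  have weak: "weak_L1_topology \<Omega> = pullback_topology (L1_tuples \<Omega>) \<Lambda> ?T"
    unfolding weak_L1_topology_def \<Lambda>_def pair_def setint by simp
  have iF: "integrable M (F i)" if "F \<in> S" for F i using int[OF that] setintb by simp
  have nF: "AE z in M. 0 \<le> F i z" if "F \<in> S" for F i using nn[OF that] AEM by simp
  have LinfE: "\<exists>h. (\<forall>i. bounded_measurable M (h i)) \<and> (\<forall>i. AE z in M. g i z = h i z)"
    if "g \<in> Linf_tuples \<Omega>" for g :: "'i \<Rightarrow> real^2 \<Rightarrow> real"
  proof -
    have gm: "g i \<in> borel_measurable M" for i using that setbm by (simp add: Linf_tuples_def)
    have "\<forall>i. \<exists>B. AE z in M. \<bar>g i z\<bar> \<le> B" using that AEM by (simp add: Linf_tuples_def)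
    then obtain B where B: "\<And>i. AE z in M. \<bar>g i z\<bar> \<le> B i" by metis
    define h where "h i z = max (- \<bar>B i\<bar>) (min \<bar>B i\<bar> (g i z))" for i z
    have "bounded_measurable M (h i)" for i
      unfolding bounded_measurable_def
    proof
      show "h i \<in> borel_measurable M" unfolding h_def using gm[of i] by measurable
      show "\<exists>B. \<forall>x\<in>space M. \<bar>h i x\<bar> \<le> B" by (intro exI[of _ "\<bar>B i\<bar>"]) (auto simp: h_def)
    qed
    moreover have "AE z in M. g i z = h i z" for i
      using B[of i] by eventually_elim (auto simp: h_def)
    ultimately show ?thesis by blast
  qed
  have pair_cong: "pair F g = pair F h"
    if "F \<in> S \<or> (\<forall>i. F i \<in> borel_measurable M)" "\<And>i. AE z in M. g i z = h i z" "g \<in> Linf_tuples \<Omega>"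
      "\<And>i. bounded_measurable M (h i)" for F g h
  proof -
    have Fm: "F i \<in> borel_measurable M" for i using that(1) iF by blast
    have gm: "g i \<in> borel_measurable M" for i using that(3) setbm by (simp add: Linf_tuples_def)
    have hm: "h i \<in> borel_measurable M" for i using that(4) by (simp add: bounded_measurable_def)
    have "(\<integral>z. F i z * g i z \<partial>M) = (\<integral>z. F i z * h i z \<partial>M)" for i
      using that(2)[of i] Fm[of i] gm[of i] hm[of i] by (intro integral_cong_AE) (auto elim: eventually_mono)
    then show ?thesis by (simp add: pair_def)
  qed
  have Fg: "integrable M (\<lambda>z. F i z * g z)" if FS: "F \<in> S" and bg: "bounded_measurable M g" for F i g
  proof -
    have [measurable]: "g \<in> borel_measurable M" using that(2) by (simp add: bounded_measurable_def)
    have [measurable]: "F i \<in> borel_measurable M" using iF[OF that(1)] by auto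
    obtain B where B: "\<And>x. x \<in> \<Omega> \<Longrightarrow> \<bar>g x\<bar> \<le> B" using bg by (auto simp: bounded_measurable_def)
    show ?thesis
    proof (rule Bochner_Integration.integrable_bound)
      show "integrable M (\<lambda>z. \<bar>B\<bar> * \<bar>F i z\<bar>)" using iF[OF that(1)] by simp
      show "AE z in M. norm (F i z * g z) \<le> norm (\<bar>B\<bar> * \<bar>F i z\<bar>)"
      proof (rule AE_I2)
        fix z assume "z \<in> space M"
        then have "\<bar>g z\<bar> \<le> \<bar>B\<bar>" using B[of z] by simp
        then show "norm (F i z * g z) \<le> norm (\<bar>B\<bar> * \<bar>F i z\<bar>)"
          by (simp add: abs_mult mult.commute mult_right_mono)
      qed
    qed measurable
  qed
  (* A test function with values between 0 and 1 sees at most the tail of F above the level K0, and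
     K0 times its own integral. *)
  have UI: "\<exists>K\<ge>0. \<forall>F\<in>S. \<forall>i. \<forall>g. bounded_measurable M g \<longrightarrow> (\<forall>x\<in>space M. 0 \<le> g x \<and> g x \<le> 1) \<longrightarrow>
      (\<integral>z. F i z * g z \<partial>M) \<le> e + K * (\<integral>z. g z \<partial>M)" if e: "0 < e" for e
  proof -
    obtain K0 where K0: "\<And>F i. F \<in> S \<Longrightarrow> (\<integral>z. (if K0 < F i z then F i z else 0) \<partial>M) \<le> e"
      using ui[OF e] setint by metis
    show ?thesis
    proof (intro exI[of _ "max K0 0"] conjI ballI allI impI)
      fix F i g assume F: "F \<in> S" and g: "bounded_measurable M g" "\<forall>x\<in>space M. 0 \<le> g x \<and> g x \<le> 1"
      have [measurable]: "F i \<in> borel_measurable M" using iF[OF F] by auto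
      have i1: "integrable M (\<lambda>z. if K0 < F i z then F i z else 0)"
        by (rule Bochner_Integration.integrable_bound[OF iF[OF F, of i]]) auto
      have i2: "integrable M (\<lambda>z. max K0 0 * g z)" using integrable_bounded_measurable[OF g(1)] by simp
      have "(\<integral>z. F i z * g z \<partial>M) \<le> (\<integral>z. (if K0 < F i z then F i z else 0) + max K0 0 * g z \<partial>M)"
      proof (rule integral_mono_AE[OF Fg[OF F g(1)] Bochner_Integration.integrable_add[OF i1 i2]])
        show "AE z in M. F i z * g z \<le> (if K0 < F i z then F i z else 0) + max K0 0 * g z"
          using nF[OF F, of i] AE_space
        proof eventually_elim
          fix z assume z: "0 \<le> F i z" "z \<in> space M"
          then have g01: "0 \<le> g z" "g z \<le> 1" using g(2) by auto
          show "F i z * g z \<le> (if K0 < F i z then F i z else 0) + max K0 0 * g z"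
          proof (cases "K0 < F i z")
            case True
            have "F i z * g z \<le> F i z * 1" using z g01 by (intro mult_left_mono)
            moreover have "0 \<le> max K0 0 * g z" using g01 by simp
            ultimately show ?thesis using True by simp
          next
            case False
            then show ?thesis using g01 z by (auto intro: mult_right_mono)
          qed
        qed
      qed
      also have "\<dots> \<le> e + max K0 0 * (\<integral>z. g z \<partial>M)"
        using K0[OF F, of i] i1 i2 by simp
      finally show "(\<integral>z. F i z * g z \<partial>M) \<le> e + max K0 0 * (\<integral>z. g z \<partial>M)" .
    qed simp
  qed
  have bnd: "\<exists>b. \<forall>F\<in>S. \<bar>pair F g\<bar> \<le> b" if g: "g \<in> Linf_tuples \<Omega>" for g
  proof -
    obtain K where K: "\<And>F i g. F \<in> S \<Longrightarrow> bounded_measurable M g \<Longrightarrow> (\<forall>x\<in>space M. 0 \<le> g x \<and> g x \<le> 1) \<Longrightarrow>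
      (\<integral>z. F i z * g z \<partial>M) \<le> 1 + K * (\<integral>z. g z \<partial>M)" using UI[OF zero_less_one] by blast
    have one: "bounded_measurable M (\<lambda>_. 1)" by (auto simp: bounded_measurable_def)
    define m where "m = 1 + K * (\<integral>z. 1 \<partial>M)"
    have m: "(\<integral>z. F i z \<partial>M) \<le> m" if "F \<in> S" for F i
      using K[OF that one, of i] by (simp add: m_def)
    obtain h where h: "\<And>i. bounded_measurable M (h i)" "\<And>i. AE z in M. g i z = h i z"
      using LinfE[OF g] by blast
    have "\<forall>i. \<exists>B. \<forall>x\<in>\<Omega>. \<bar>h i x\<bar> \<le> B" using h(1) by (simp add: bounded_measurable_def)
    then obtain B where B: "\<And>i x. x \<in> \<Omega> \<Longrightarrow> \<bar>h i x\<bar> \<le> B i" by metis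
    have "\<bar>pair F g\<bar> \<le> (\<Sum>i\<in>UNIV. \<bar>B i\<bar> * m)" if F: "F \<in> S" for F
    proof -
      have "\<bar>\<integral>z. F i z * h i z \<partial>M\<bar> \<le> \<bar>B i\<bar> * m" for i
      proof -
        have "\<bar>\<integral>z. F i z * h i z \<partial>M\<bar> \<le> (\<integral>z. \<bar>B i\<bar> * F i z \<partial>M)"
        proof (rule integral_abs_bound[THEN order_trans], rule integral_mono_AE)
          show "integrable M (\<lambda>z. \<bar>F i z * h i z\<bar>)" using Fg[OF F h(1)] by simp
          show "integrable M (\<lambda>z. \<bar>B i\<bar> * F i z)" using iF[OF F] by simp
          show "AE z in M. \<bar>F i z * h i z\<bar> \<le> \<bar>B i\<bar> * F i z"
            using nF[OF F, of i] AE_space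
          proof eventually_elim
            case (elim z)
            then have "\<bar>h i z\<bar> \<le> \<bar>B i\<bar>" using B[of z i] by simp
            then show ?case using elim by (simp add: abs_mult mult.commute mult_left_mono)
          qed
        qed
        also have "\<dots> \<le> \<bar>B i\<bar> * m" using m[OF F, of i] by (simp add: mult_left_mono)
        finally show ?thesis .
      qed
      then have "\<bar>pair F h\<bar> \<le> (\<Sum>i\<in>UNIV. \<bar>B i\<bar> * m)"
        unfolding pair_def by (intro order_trans[OF sum_abs] sum_mono)
      moreover have "pair F g = pair F h" using F by (intro pair_cong h g) auto
      ultimately show ?thesis by simp
    qed
    then show ?thesis by blast
  qed
  then obtain b where b: "\<And>g F. g \<in> Linf_tuples \<Omega> \<Longrightarrow> F \<in> S \<Longrightarrow> \<bar>pair F g\<bar> \<le> b g" by metis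
  define C where "C = ?T closure_of (\<Lambda> ` S)"
  (* Test tuples with a single non-zero component recover the components of a limit functional. *)
  define one where "one i g = (\<lambda>j. if j = i then g else (\<lambda>_. 0))" for i :: 'i and g :: "real^2 \<Rightarrow> real"
  have oneL: "one i g \<in> Linf_tuples \<Omega>" if bg: "bounded_measurable M g" for i g
  proof -
    obtain B where B: "\<And>x. x \<in> \<Omega> \<Longrightarrow> \<bar>g x\<bar> \<le> B" and gm: "g \<in> borel_measurable M"
      using bg by (auto simp: bounded_measurable_def)
    have "AE z in M. \<bar>one i g j z\<bar> \<le> \<bar>B\<bar>" for j
      using B by (intro AE_I2) (fastforce simp: one_def)
    moreover have "one i g j \<in> borel_measurable M" for j using gm by (simp add: one_def)
    ultimately show ?thesis unfolding Linf_tuples_def setbm AEM by blast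
  qed
  have pair_one: "pair F (one i g) = (\<integral>z. F i z * g z \<partial>M)" for F i g
  proof -
    have "pair F (one i g) = (\<Sum>j\<in>UNIV. if j = i then (\<integral>z. F i z * g z \<partial>M) else 0)"
      unfolding pair_def by (rule sum.cong) (auto simp: one_def)
    then show ?thesis by simp
  qed
  have \<Lambda>_one: "\<Lambda> F (one i g) = (\<integral>z. F i z * g z \<partial>M)" if "bounded_measurable M g" for F i g
    using oneL[OF that] by (simp add: \<Lambda>_def pair_one)
  have topT: "\<Lambda> ` S \<subseteq> topspace ?T" by (auto simp: \<Lambda>_def)
  have box: "compactin ?T (\<Pi>\<^sub>E g\<in>Linf_tuples \<Omega>. {- b g..b g})"
    by (simp add: compactin_PiE)
  have "C \<subseteq> (\<Pi>\<^sub>E g\<in>Linf_tuples \<Omega>. {- b g..b g})"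
    unfolding C_def
  proof (rule closure_of_minimal)
    show "\<Lambda> ` S \<subseteq> (\<Pi>\<^sub>E g\<in>Linf_tuples \<Omega>. {- b g..b g})"
      using b by (fastforce simp: \<Lambda>_def abs_le_iff)
    show "closedin ?T (\<Pi>\<^sub>E g\<in>Linf_tuples \<Omega>. {- b g..b g})"
      by (simp add: closedin_product_topology)
  qed
  then have compC: "compactin ?T C" using box by (intro closed_compactin[OF box]) (auto simp: C_def)
  have "C \<subseteq> \<Lambda> ` L1_tuples \<Omega>"
  proof
    fix l assume l: "l \<in> C"
    note lin = closure_of_linear_le[OF l[unfolded C_def]]
    have "\<exists>f. integrable M f \<and> (\<forall>g. bounded_measurable M g \<longrightarrow> l (one i g) = (\<integral>z. f z * g z \<partial>M))" for i
    proof (rule positive_functional_representation[of "\<lambda>g. l (one i g)"])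
      have lin2: "a * l (one i f) + b * l (one i g) + c * l (one i h) \<le> d"
        if bm: "bounded_measurable M f" "bounded_measurable M g" "bounded_measurable M h"
          and le: "\<And>F. F \<in> S \<Longrightarrow> a * (\<integral>z. F i z * f z \<partial>M) + b * (\<integral>z. F i z * g z \<partial>M)
            + c * (\<integral>z. F i z * h z \<partial>M) \<le> d" for a b c d f g h
      proof -
        let ?p = "\<lambda>n::nat. one i (if n = 0 then f else if n = 1 then g else h)"
        let ?c = "\<lambda>n::nat. if n = 0 then a else if n = 1 then b else c"
        have sum3: "(\<Sum>n\<in>{..<3}. ?c n * x (?p n)) = a * x (one i f) + b * x (one i g) + c * x (one i h)"
          for x :: "('i \<Rightarrow> real^2 \<Rightarrow> real) \<Rightarrow> real"
          by (simp add: numeral_3_eq_3 lessThan_Suc)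
        have "(\<Sum>n\<in>{..<3}. ?c n * l (?p n)) \<le> d"
        proof (rule lin)
          show "?p ` {..<3} \<subseteq> Linf_tuples \<Omega>" using bm oneL by auto
          fix x assume "x \<in> \<Lambda> ` S"
          then obtain F where "F \<in> S" "x = \<Lambda> F" by auto
          then show "(\<Sum>n\<in>{..<3}. ?c n * x (?p n)) \<le> d"
            unfolding sum3 using le[of F] bm by (simp add: \<Lambda>_one)
        qed simp
        then show ?thesis unfolding sum3 .
      qed
      {
        fix g h assume gh: "bounded_measurable M g" "bounded_measurable M h"
        note s = bounded_measurable_add[OF gh]
        have e: "(\<integral>z. F i z * (g z + h z) \<partial>M) = (\<integral>z. F i z * g z \<partial>M) + (\<integral>z. F i z * h z \<partial>M)" if "F \<in> S" for F
          using Fg[OF that gh(1)] Fg[OF that gh(2)] by (simp add: distrib_left)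
        show "l (one i (\<lambda>x. g x + h x)) = l (one i g) + l (one i h)"
          using lin2[OF s gh, of 1 "-1" "-1" 0] lin2[OF s gh, of "-1" 1 1 0] e by simp
      }
      {
        fix g c assume g: "bounded_measurable M g"
        note s = bounded_measurable_scale[OF g, of c]
        have e: "(\<integral>z. F i z * (c * g z) \<partial>M) = c * (\<integral>z. F i z * g z \<partial>M)" for F
          by (simp add: mult.left_commute)
        show "l (one i (\<lambda>x. c * g x)) = c * l (one i g)"
          using lin2[OF s g g, of 1 "-c" 0 0] lin2[OF s g g, of "-1" c 0 0] e by simp
      }
      {
        fix g assume g: "bounded_measurable M g" "\<And>x. x \<in> space M \<Longrightarrow> 0 \<le> g x"
        have "0 \<le> (\<integral>z. F i z * g z \<partial>M)" if "F \<in> S" for F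
          using nF[OF that, of i] AE_space by (intro integral_nonneg_AE, eventually_elim) (use g in simp)
        then show "0 \<le> l (one i g)" using lin2[OF g(1) g(1) g(1), of "-1" 0 0 0] by simp
      }
      {
        fix e :: real assume "0 < e"
        then obtain K where K: "K \<ge> 0" "\<And>F i g. F \<in> S \<Longrightarrow> bounded_measurable M g \<Longrightarrow> (\<forall>x\<in>space M. 0 \<le> g x \<and> g x \<le> 1) \<Longrightarrow>
          (\<integral>z. F i z * g z \<partial>M) \<le> e + K * (\<integral>z. g z \<partial>M)" using UI[of e] by blast
        have "l (one i g) \<le> e + K * (\<integral>z. g z \<partial>M)"
          if g: "bounded_measurable M g" "\<forall>x\<in>space M. 0 \<le> g x \<and> g x \<le> 1" for g
          using lin2[OF g(1) g(1) g(1), of 1 0 0] K(2)[OF _ g] by simp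
        then show "\<exists>K\<ge>0. \<forall>g. bounded_measurable M g \<longrightarrow> (\<forall>x\<in>space M. 0 \<le> g x \<and> g x \<le> 1) \<longrightarrow>
          l (one i g) \<le> e + K * (\<integral>z. g z \<partial>M)" using K(1) by blast
      }
    qed blast
    then obtain f where f: "\<And>i. integrable M (f i)"
      "\<And>i g. bounded_measurable M g \<Longrightarrow> l (one i g) = (\<integral>z. f i z * g z \<partial>M)" by metis
    have "l = \<Lambda> f"
    proof
      fix g show "l g = \<Lambda> f g"
      proof (cases "g \<in> Linf_tuples \<Omega>")
        case False
        have "l \<in> topspace ?T" using l by (simp add: C_def in_closure_of)
        then have "l \<in> extensional (Linf_tuples \<Omega>)" by (simp add: PiE_def)
        then show ?thesis using False by (simp add: \<Lambda>_def extensional_def)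
      next
        case True
        obtain h where h: "\<And>i. bounded_measurable M (h i)" "\<And>i. AE z in M. g i z = h i z"
          using LinfE[OF True] by blast
        let ?p = "\<lambda>q. case q of None \<Rightarrow> g | Some i \<Rightarrow> one i (h i)"
        have sub: "range ?p \<subseteq> Linf_tuples \<Omega>" using True oneL h by (auto split: option.splits)
        have sum: "(\<Sum>q\<in>UNIV. (case q of None \<Rightarrow> a | Some i \<Rightarrow> b) * x (?p q)) = a * x g + b * (\<Sum>i\<in>UNIV. x (one i (h i)))"
          for x :: "('i \<Rightarrow> real^2 \<Rightarrow> real) \<Rightarrow> real" and a b
          by (simp add: UNIV_option_conv sum.reindex sum_distrib_left)
        have "\<Lambda> F g = (\<Sum>i\<in>UNIV. \<Lambda> F (one i (h i)))" if "F \<in> S" for F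
        proof -
          have "\<Lambda> F g = pair F h" using True that h by (simp add: \<Lambda>_def pair_cong)
          then show ?thesis by (simp add: \<Lambda>_one h pair_def)
        qed
        then have "l g = (\<Sum>i\<in>UNIV. l (one i (h i)))"
          using lin[of UNIV ?p "\<lambda>q. case q of None \<Rightarrow> 1 | Some i \<Rightarrow> -1" 0]
            lin[of UNIV ?p "\<lambda>q. case q of None \<Rightarrow> -1 | Some i \<Rightarrow> 1" 0] sub
          unfolding sum by force
        also have "\<dots> = pair f h" by (simp add: f(2) h(1) pair_def)
        also have "\<dots> = pair f g" using f(1) by (intro pair_cong[symmetric] h True) auto
        finally show ?thesis using True by (simp add: \<Lambda>_def)
      qed
    qed
    moreover have "f \<in> L1_tuples \<Omega>" using f(1) setintb by (simp add: L1_tuples_def)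
    ultimately show "l \<in> \<Lambda> ` L1_tuples \<Omega>" by blast
  qed
  moreover have "S \<subseteq> L1_tuples \<Omega>" using int by (auto simp: L1_tuples_def)
  moreover have "\<Lambda> ` S \<subseteq> C" unfolding C_def by (rule closure_of_subset[OF topT])
  ultimately show ?thesis
    unfolding relatively_weakly_compact_L1_def weak
    using compactin_pullback_closure_of[of S "L1_tuples \<Omega>" \<Lambda> C ?T] compC
    by (simp add: C_def)
qed

section \<open>Primitives of bounded functions\<close>

text \<open>A substitute for the fundamental theorem of calculus when \<open>g\<close> is only measurable:
  \<open>f\<close> is an indefinite integral of the bounded function \<open>g\<close> on the whole
  line.\<close>

definition bounded_primitive :: "(real \<Rightarrow> real) \<Rightarrow> (real \<Rightarrow> real) \<Rightarrow> bool" where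
  "bounded_primitive f g \<longleftrightarrow> g \<in> borel_measurable borel \<and> (\<exists>K. \<forall>x. \<bar>g x\<bar> \<le> K) \<and>
     (\<forall>s t. s \<le> t \<longrightarrow> f t - f s = integral {s..t} g)"

lemma continuous_times_bounded_set_integrable:
  fixes h g :: "real \<Rightarrow> real"
  assumes h: "continuous_on {a..b} h" and g: "g \<in> borel_measurable borel" "\<And>x. \<bar>g x\<bar> \<le> K"
  shows "set_integrable lborel {a..b} (\<lambda>t. h t * g t)"
proof -
  have "bounded (h ` {a..b})" by (intro compact_imp_bounded compact_continuous_image h) auto
  then obtain B where B: "\<And>t. t \<in> {a..b} \<Longrightarrow> \<bar>h t\<bar> \<le> B"
    unfolding bounded_iff by fastforce
  have K: "0 \<le> K" using g(2)[of 0] by linarith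
  have m: "(\<lambda>t. indicator {a..b} t *\<^sub>R h t) \<in> borel_measurable borel"
    by (rule borel_measurable_continuous_on_indicator[OF _ h]) auto
  show ?thesis unfolding set_integrable_def
  proof (rule integrableI_bounded_set[where A = "{a..b}" and B = "\<bar>B\<bar> * K"])
    show "(\<lambda>x. indicator {a..b} x *\<^sub>R (h x * g x)) \<in> borel_measurable lborel"
      using borel_measurable_times[OF m g(1)] by (simp add: mult.assoc)
    show "AE x\<in>{a..b} in lborel. norm (indicator {a..b} x *\<^sub>R (h x * g x)) \<le> \<bar>B\<bar> * K"
    proof (intro AE_I2 impI)
      fix x assume "x \<in> {a..b}"
      then have "\<bar>h x\<bar> \<le> \<bar>B\<bar>" using B by force
      then have "\<bar>h x\<bar> * \<bar>g x\<bar> \<le> \<bar>B\<bar> * K" using g(2)[of x] by (intro mult_mono) auto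
      then show "norm (indicator {a..b} x *\<^sub>R (h x * g x)) \<le> \<bar>B\<bar> * K"
        using K by (simp add: abs_mult indicator_def)
    qed
  qed (auto simp: emeasure_lborel_Icc_eq)
qed

lemma continuous_times_bounded_integrable_on:
  fixes h g :: "real \<Rightarrow> real"
  assumes "continuous_on {a..b} h" "g \<in> borel_measurable borel" "\<And>x. \<bar>g x\<bar> \<le> K"
  shows "(\<lambda>t. h t * g t) integrable_on {a..b}"
  using continuous_times_bounded_set_integrable[OF assms] set_borel_integral_eq_integral(1) by blast

lemma bounded_borel_integrable_on:
  fixes g :: "real \<Rightarrow> real"
  assumes "g \<in> borel_measurable borel" "\<And>x. \<bar>g x\<bar> \<le> K"
  shows "g integrable_on {a..b}"
  using continuous_times_bounded_integrable_on[OF _ assms, of a b "\<lambda>_. 1"] by simp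

lemma integral_abs_le:
  fixes h :: "real \<Rightarrow> real"
  assumes "h integrable_on {s..t}" "s \<le> t" "\<And>x. x \<in> {s..t} \<Longrightarrow> \<bar>h x\<bar> \<le> B"
  shows "\<bar>integral {s..t} h\<bar> \<le> B * (t - s)"
  using has_integral_bound_real[of B "{}" h "integral {s..t} h" s t] integrable_integral[OF assms(1)] assms(2,3)
    order_trans[OF abs_ge_zero assms(3)[of s]] by (simp add: content_real)

lemma bounded_primitive_lipschitz:
  assumes "bounded_primitive f g" "\<And>x. \<bar>g x\<bar> \<le> K"
  shows "\<bar>f t - f s\<bar> \<le> K * \<bar>t - s\<bar>"
proof -
  have *: "\<bar>f t - f s\<bar> \<le> K * (t - s)" if "s \<le> t" for s t
  proof -
    have "g integrable_on {s..t}" using assms unfolding bounded_primitive_def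
      by (intro bounded_borel_integrable_on) auto
    then have "\<bar>integral {s..t} g\<bar> \<le> K * (t - s)"
      using that assms(2) by (intro integral_abs_le)
    then show ?thesis using assms(1) that unfolding bounded_primitive_def by simp
  qed
  show ?thesis using *[of s t] *[of t s] by (cases "s \<le> t") (auto simp: abs_minus_commute)
qed

lemma bounded_primitive_continuous:
  assumes "bounded_primitive f g"
  shows "continuous_on X f"
proof -
  obtain K where K: "\<And>x. \<bar>g x\<bar> \<le> K" using assms by (auto simp: bounded_primitive_def)
  have "K-lipschitz_on X f"
    using bounded_primitive_lipschitz[OF assms K] K[of 0] by (intro lipschitz_onI) (auto simp: dist_real_def)
  then show ?thesis by (rule lipschitz_on_continuous_on)
qed

text \<open>The product and chain rules below compare both sides through their difference \<open>D\<close>,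
  whose increments turn out to be quadratic in the step; on a subdivision into \<open>n\<close> parts they add
  up to a multiple of \<open>1/n\<close>.\<close>

lemma constant_if_quadratic_increments:
  fixes D :: "real \<Rightarrow> real"
  assumes D: "\<And>s t. a \<le> s \<Longrightarrow> s \<le> t \<Longrightarrow> t \<le> b \<Longrightarrow> \<bar>D t - D s\<bar> \<le> C * (t - s)\<^sup>2" and ab: "a \<le> b"
  shows "D b = D a"
proof -
  have le: "\<bar>D b - D a\<bar> \<le> C * (b - a)\<^sup>2 * inverse (real (Suc n))" for n
  proof -
    define h where "h = (b - a) / real (Suc n)"
    have hn: "h * real (Suc n) = b - a" by (simp add: h_def)
    have h0: "0 \<le> h" using ab by (simp add: h_def)
    define p where "p i = a + h * real i" for i
    have pb: "p i \<le> b" if "i \<le> Suc n" for i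
    proof -
      have "h * real i \<le> h * real (Suc n)" using that h0 by (intro mult_left_mono) auto
      then show ?thesis using hn by (simp add: p_def)
    qed
    have "D b - D a = (\<Sum>i<Suc n. D (p (Suc i)) - D (p i))"
      by (subst sum_lessThan_telescope) (use hn in \<open>simp add: p_def\<close>)
    also have "\<bar>\<dots>\<bar> \<le> (\<Sum>i<Suc n. \<bar>D (p (Suc i)) - D (p i)\<bar>)" by (rule sum_abs)
    also have "\<dots> \<le> (\<Sum>i<Suc n. C * h\<^sup>2)"
    proof (rule sum_mono)
      fix i assume "i \<in> {..<Suc n}"
      then have "\<bar>D (p (Suc i)) - D (p i)\<bar> \<le> C * (p (Suc i) - p i)\<^sup>2"
        using pb[of "Suc i"] h0 by (intro D) (auto simp: p_def algebra_simps)
      then show "\<bar>D (p (Suc i)) - D (p i)\<bar> \<le> C * h\<^sup>2" by (simp add: p_def algebra_simps)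
    qed
    also have "\<dots> = C * (h * real (Suc n))\<^sup>2 * inverse (real (Suc n))"
      by (simp add: power_mult_distrib power2_eq_square field_simps)
    finally show ?thesis using hn by simp
  qed
  have "(\<lambda>n. C * (b - a)\<^sup>2 * inverse (real (Suc n))) \<longlonglongrightarrow> C * (b - a)\<^sup>2 * 0"
    by (intro tendsto_intros LIMSEQ_inverse_real_of_nat)
  then have "\<bar>D b - D a\<bar> \<le> C * (b - a)\<^sup>2 * 0"
    by (rule LIMSEQ_le_const) (use le in auto)
  then show ?thesis by simp
qed

lemma bounded_primitive_product:
  assumes f: "bounded_primitive f g" and p: "bounded_primitive \<phi> \<rho>" and ab: "a \<le> b"
  shows "\<phi> b * f b - \<phi> a * f a = integral {a..b} (\<lambda>t. \<rho> t * f t + \<phi> t * g t)"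
    and "(\<lambda>t. \<rho> t * f t + \<phi> t * g t) integrable_on {a..b}"
proof -
  obtain K1 where K1: "\<And>x. \<bar>g x\<bar> \<le> K1" using f by (auto simp: bounded_primitive_def)
  obtain K2 where K2: "\<And>x. \<bar>\<rho> x\<bar> \<le> K2" using p by (auto simp: bounded_primitive_def)
  have K0: "0 \<le> K1" "0 \<le> K2" using K1[of 0] K2[of 0] by auto
  have gm: "g \<in> borel_measurable borel" "\<rho> \<in> borel_measurable borel"
    using f p by (auto simp: bounded_primitive_def)
  note cf = bounded_primitive_continuous[OF f] and cp = bounded_primitive_continuous[OF p]
  let ?h = "\<lambda>t. \<rho> t * f t + \<phi> t * g t"
  have hi: "?h integrable_on {s..t}" for s t
    using integrable_add[OF continuous_times_bounded_integrable_on[OF cf gm(2) K2]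
      continuous_times_bounded_integrable_on[OF cp gm(1) K1]] by (simp add: mult.commute)
  then show "?h integrable_on {a..b}" .
  define D where "D t = \<phi> t * f t - integral {a..t} ?h" for t
  have "D b = D a"
  proof (rule constant_if_quadratic_increments[OF _ ab, where C = "2 * K1 * K2"])
    fix s t assume st: "a \<le> s" "s \<le> t" "t \<le> b"
    have split: "integral {a..t} ?h = integral {a..s} ?h + integral {s..t} ?h"
      using Henstock_Kurzweil_Integration.integral_combine[OF st(1,2) hi] by simp
    have e1: "\<phi> t - \<phi> s = integral {s..t} \<rho>" "f t - f s = integral {s..t} g"
      using f p st by (auto simp: bounded_primitive_def)
    have i1: "\<rho> integrable_on {s..t}" "g integrable_on {s..t}"
      using bounded_borel_integrable_on[OF gm(2) K2] bounded_borel_integrable_on[OF gm(1) K1] by auto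
    have "D t - D s = f t * (\<phi> t - \<phi> s) + \<phi> s * (f t - f s) - integral {s..t} ?h"
      unfolding D_def split by (simp add: algebra_simps)
    also have "\<dots> = integral {s..t} (\<lambda>x. f t * \<rho> x + \<phi> s * g x) - integral {s..t} ?h"
      unfolding e1 using i1 by (subst Henstock_Kurzweil_Integration.integral_add) (auto intro: integrable_on_mult_right)
    also have "\<dots> = integral {s..t} (\<lambda>x. (f t * \<rho> x + \<phi> s * g x) - ?h x)"
      by (rule Henstock_Kurzweil_Integration.integral_diff[symmetric])
        (use i1 hi in \<open>auto intro!: integrable_add integrable_on_mult_right\<close>)
    finally have Dd: "D t - D s = integral {s..t} (\<lambda>x. (f t * \<rho> x + \<phi> s * g x) - ?h x)" .
    have "\<bar>integral {s..t} (\<lambda>x. (f t * \<rho> x + \<phi> s * g x) - ?h x)\<bar> \<le> (2 * K1 * K2 * (t - s)) * (t - s)"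
    proof (rule integral_abs_le[OF _ st(2)])
      show "(\<lambda>x. (f t * \<rho> x + \<phi> s * g x) - ?h x) integrable_on {s..t}"
        by (rule integrable_diff) (use i1 hi in \<open>auto intro!: integrable_add integrable_on_mult_right\<close>)
      fix x assume x: "x \<in> {s..t}"
      have "\<bar>f t - f x\<bar> \<le> K1 * (t - s)"
        using bounded_primitive_lipschitz[OF f K1, of t x] x K0(1)
        by (smt (verit) atLeastAtMost_iff mult_left_mono)
      then have a: "\<bar>\<rho> x * (f t - f x)\<bar> \<le> K2 * (K1 * (t - s))"
        unfolding abs_mult using K2[of x] K0 by (intro mult_mono) auto
      have "\<bar>\<phi> s - \<phi> x\<bar> \<le> K2 * (t - s)"
        using bounded_primitive_lipschitz[OF p K2, of s x] x K0(2)
        by (smt (verit) atLeastAtMost_iff mult_left_mono)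
      then have b: "\<bar>g x * (\<phi> s - \<phi> x)\<bar> \<le> K1 * (K2 * (t - s))"
        unfolding abs_mult using K1[of x] K0 by (intro mult_mono) auto
      have "(f t * \<rho> x + \<phi> s * g x) - ?h x = \<rho> x * (f t - f x) + g x * (\<phi> s - \<phi> x)"
        by (simp add: algebra_simps)
      then have "\<bar>(f t * \<rho> x + \<phi> s * g x) - ?h x\<bar> \<le> K2 * (K1 * (t - s)) + K1 * (K2 * (t - s))"
        using a b by linarith
      also have "\<dots> = 2 * K1 * K2 * (t - s)" by (simp add: algebra_simps)
      finally show "\<bar>(f t * \<rho> x + \<phi> s * g x) - ?h x\<bar> \<le> 2 * K1 * K2 * (t - s)" .
    qed
    then show "\<bar>D t - D s\<bar> \<le> 2 * K1 * K2 * (t - s)\<^sup>2" unfolding Dd by (simp add: power2_eq_square mult.assoc)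
  qed
  then show "\<phi> b * f b - \<phi> a * f a = integral {a..b} ?h" by (simp add: D_def)
qed

text \<open>The mean value theorem supplies one point \<open>z\<close> on each step; the Lipschitz bound on
  \<open>\<Phi>'\<close> makes the error quadratic.\<close>

lemma bounded_primitive_chain:
  assumes f: "bounded_primitive f g" and ab: "a \<le> b"
    and X: "convex X" "\<And>t. t \<in> {a..b} \<Longrightarrow> f t \<in> X"
    and d: "\<And>x. x \<in> X \<Longrightarrow> (\<Phi> has_real_derivative \<Phi>' x) (at x within X)"
    and lip: "\<Lambda>-lipschitz_on X \<Phi>'"
  shows "\<Phi> (f b) - \<Phi> (f a) = integral {a..b} (\<lambda>t. \<Phi>' (f t) * g t)"
    and "set_integrable lborel {a..b} (\<lambda>t. \<Phi>' (f t) * g t)"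
proof -
  obtain K where K: "\<And>x. \<bar>g x\<bar> \<le> K" using f by (auto simp: bounded_primitive_def)
  have K0: "0 \<le> K" using K[of 0] by auto
  have L0: "0 \<le> \<Lambda>" using lip lipschitz_on_nonneg by blast
  have gm: "g \<in> borel_measurable borel" using f by (auto simp: bounded_primitive_def)
  let ?h = "\<lambda>t. \<Phi>' (f t) * g t"
  have "continuous_on {a..b} (\<lambda>t. \<Phi>' (f t))"
    by (rule continuous_on_compose2[OF lipschitz_on_continuous_on[OF lip] bounded_primitive_continuous[OF f]])
      (use X(2) in auto)
  note c = this
  show "set_integrable lborel {a..b} ?h" by (rule continuous_times_bounded_set_integrable[OF c gm K])
  have hi0: "?h integrable_on {a..b}" by (rule continuous_times_bounded_integrable_on[OF c gm K])
  have hi: "?h integrable_on {s..t}" if "a \<le> s" "t \<le> b" for s t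
    by (rule integrable_subinterval_real[OF hi0]) (use that in auto)
  define D where "D t = \<Phi> (f t) - integral {a..t} ?h" for t
  have "D b = D a"
  proof (rule constant_if_quadratic_increments[OF _ ab, where C = "2 * \<Lambda> * K * K"])
    fix s t assume st: "a \<le> s" "s \<le> t" "t \<le> b"
    have split: "integral {a..t} ?h = integral {a..s} ?h + integral {s..t} ?h"
      using Henstock_Kurzweil_Integration.integral_combine[OF st(1,2) hi] st by simp
    have e1: "f t - f s = integral {s..t} g" using f st by (auto simp: bounded_primitive_def)
    have gi: "g integrable_on {s..t}" by (rule bounded_borel_integrable_on[OF gm K])
    have mv: "\<exists>z\<in>{u..w}. \<Phi> w - \<Phi> u = (w - u) * \<Phi>' z" if uw: "u \<in> X" "w \<in> X" "u \<le> w" for u w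
    proof -
      have sub: "{u..w} \<subseteq> X" using X(1) uw
        by (metis closed_segment_eq_real_ivl1 closed_segment_subset)
      have "\<exists>x\<in>{u..w}. \<Phi> w - \<Phi> u = (\<lambda>y. y * \<Phi>' x) (w - u)"
      proof (rule mvt_very_simple[OF uw(3)])
        fix x assume "u \<le> x" "x \<le> w"
        then show "(\<Phi> has_derivative (\<lambda>y. y * \<Phi>' x)) (at x within {u..w})"
          using d[of x] sub has_derivative_subset[of \<Phi> "\<lambda>y. y * \<Phi>' x" x X "{u..w}"]
          by (auto simp: has_field_derivative_def mult_commute_abs)
      qed
      then show ?thesis by simp
    qed
    have fX: "f s \<in> X" "f t \<in> X" using X(2) st by auto
    obtain z where z: "z \<in> X" "\<bar>z - f s\<bar> \<le> \<bar>f t - f s\<bar>" "\<Phi> (f t) - \<Phi> (f s) = (f t - f s) * \<Phi>' z"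
    proof (cases "f s \<le> f t")
      case True
      obtain z where "z \<in> {f s..f t}" "\<Phi> (f t) - \<Phi> (f s) = (f t - f s) * \<Phi>' z"
        using mv[OF fX True] by auto
      moreover have "{f s..f t} \<subseteq> X" using X(1) fX True
        by (metis closed_segment_eq_real_ivl1 closed_segment_subset)
      ultimately show ?thesis by (intro that[of z]) auto
    next
      case False
      then obtain z where "z \<in> {f t..f s}" "\<Phi> (f s) - \<Phi> (f t) = (f s - f t) * \<Phi>' z"
        using mv[OF fX(2,1)] by auto
      moreover have "{f t..f s} \<subseteq> X" using X(1) fX False
        by (metis closed_segment_eq_real_ivl1 closed_segment_subset linear)
      ultimately show ?thesis by (intro that[of z]) (auto simp: algebra_simps)
    qed
    have "D t - D s = \<Phi>' z * integral {s..t} g - integral {s..t} ?h"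
      unfolding D_def split using z(3) e1 by (simp add: mult.commute)
    also have "\<dots> = integral {s..t} (\<lambda>x. \<Phi>' z * g x) - integral {s..t} ?h" by simp
    also have "\<dots> = integral {s..t} (\<lambda>x. \<Phi>' z * g x - ?h x)"
      by (rule Henstock_Kurzweil_Integration.integral_diff[symmetric])
        (use gi hi st in \<open>auto intro!: integrable_on_mult_right\<close>)
    finally have Dd: "D t - D s = integral {s..t} (\<lambda>x. \<Phi>' z * g x - ?h x)" .
    have "\<bar>integral {s..t} (\<lambda>x. \<Phi>' z * g x - ?h x)\<bar> \<le> (2 * \<Lambda> * K * K * (t - s)) * (t - s)"
    proof (rule integral_abs_le[OF _ st(2)])
      show "(\<lambda>x. \<Phi>' z * g x - ?h x) integrable_on {s..t}"
        by (rule integrable_diff) (use gi hi st in \<open>auto intro!: integrable_on_mult_right\<close>)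
      fix x assume x: "x \<in> {s..t}"
      have "\<bar>f t - f s\<bar> \<le> K * (t - s)" using bounded_primitive_lipschitz[OF f K, of t s] st by simp
      moreover have "\<bar>f x - f s\<bar> \<le> K * (t - s)"
        using bounded_primitive_lipschitz[OF f K, of x s] x K0
        by (smt (verit) atLeastAtMost_iff mult_left_mono)
      ultimately have zx: "\<bar>z - f x\<bar> \<le> 2 * K * (t - s)" using z(2) by linarith
      have "\<bar>\<Phi>' z - \<Phi>' (f x)\<bar> \<le> \<Lambda> * \<bar>z - f x\<bar>"
        using lipschitz_onD[OF lip z(1), of "f x"] X(2)[of x] x st by (simp add: dist_real_def)
      also have "\<dots> \<le> \<Lambda> * (2 * K * (t - s))" by (rule mult_left_mono[OF zx L0])
      finally have "\<bar>\<Phi>' z - \<Phi>' (f x)\<bar> * \<bar>g x\<bar> \<le> \<Lambda> * (2 * K * (t - s)) * K"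
        using K[of x] K0 L0 st by (intro mult_mono) auto
      then have "\<bar>(\<Phi>' z - \<Phi>' (f x)) * g x\<bar> \<le> 2 * \<Lambda> * K * K * (t - s)"
        by (simp add: abs_mult mult_ac)
      then show "\<bar>\<Phi>' z * g x - ?h x\<bar> \<le> 2 * \<Lambda> * K * K * (t - s)"
        by (simp add: left_diff_distrib)
    qed
    then show "\<bar>D t - D s\<bar> \<le> 2 * \<Lambda> * K * K * (t - s)\<^sup>2" unfolding Dd by (simp add: power2_eq_square mult.assoc)
  qed
  then show "\<Phi> (f b) - \<Phi> (f a) = integral {a..b} ?h" by (simp add: D_def)
qed

section \<open>Coordinates along a direction\<close>

text \<open>Rotation by a right angle.\<close>

definition perp :: "real^2 \<Rightarrow> real^2" where "perp w = vector [- (w $ 2), w $ 1]"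

lemma perp_nth [simp]: "perp w $ 1 = - (w $ 2)" "perp w $ 2 = w $ 1"
  by (simp_all add: perp_def)

lemma inner_real2: "x \<bullet> y = x $ 1 * y $ 1 + x $ 2 * y $ 2" for x y :: "real^2"
  by (simp add: inner_vec_def sum_2)

lemma perp_inner: "perp x \<bullet> perp y = x \<bullet> y" "perp x \<bullet> x = 0" "x \<bullet> perp x = 0"
    "x \<bullet> perp y = - (perp x \<bullet> y)" "perp (perp x) = - x"
  by (simp_all add: inner_real2 vec_eq_iff forall_2)

lemma norm_perp [simp]: "norm (perp x) = norm x"
  by (simp add: norm_eq_sqrt_inner perp_inner)

text \<open>The coordinates \<open>(y, t)\<close> of the plane for which \<open>y\<close> labels the
  characteristics of direction \<open>w\<close> and \<open>t\<close> is the time along them. Their Jacobian is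
  \<open>(norm w)\<^sup>2\<close>.\<close>

definition char_point :: "real^2 \<Rightarrow> real \<Rightarrow> real \<Rightarrow> real^2" where
  "char_point w y t = y *\<^sub>R perp w + t *\<^sub>R w"

lemma char_point_inner:
  "char_point w y t \<bullet> w = t * (norm w)\<^sup>2" "char_point w y t \<bullet> perp w = y * (norm w)\<^sup>2"
  by (simp_all add: char_point_def inner_real2 power2_norm_eq_inner algebra_simps)

lemma norm_char_point: "(norm (char_point w y t))\<^sup>2 = (y\<^sup>2 + t\<^sup>2) * (norm w)\<^sup>2"
  unfolding power2_norm_eq_inner char_point_def
  by (simp add: inner_real2 power2_eq_square algebra_simps)

lemma char_point_surj:
  assumes "w \<noteq> 0" shows "char_point w ((z \<bullet> perp w) / (norm w)\<^sup>2) ((z \<bullet> w) / (norm w)\<^sup>2) = z"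
proof -
  have n: "(norm w)\<^sup>2 = w $ 1 * w $ 1 + w $ 2 * w $ 2" by (simp add: power2_norm_eq_inner inner_real2)
  have N: "(norm w)\<^sup>2 \<noteq> 0" using assms by simp
  have "char_point w ((z \<bullet> perp w) / (norm w)\<^sup>2) ((z \<bullet> w) / (norm w)\<^sup>2)
      = (1 / (norm w)\<^sup>2) *\<^sub>R ((z \<bullet> perp w) *\<^sub>R perp w + (z \<bullet> w) *\<^sub>R w)"
    by (simp add: char_point_def scaleR_add_right)
  also have "(z \<bullet> perp w) *\<^sub>R perp w + (z \<bullet> w) *\<^sub>R w = (norm w)\<^sup>2 *\<^sub>R z"
    unfolding n by (simp add: vec_eq_iff forall_2 inner_real2 algebra_simps)
  finally show ?thesis using N by simp
qed

lemma continuous_char_point [continuous_intros]: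
  "continuous_on X f \<Longrightarrow> continuous_on X g \<Longrightarrow> continuous_on X (\<lambda>x. char_point w (f x) (g x))"
  unfolding char_point_def by (intro continuous_intros)

lemma measurable_char_point [measurable]:
  "(\<lambda>p. char_point w (fst p) (snd p)) \<in> borel_measurable (lborel \<Otimes>\<^sub>M lborel)"
  "(\<lambda>p. char_point w (fst p) (snd p)) \<in> borel_measurable (borel \<Otimes>\<^sub>M borel)"
  "char_point w y \<in> borel_measurable borel"
proof -
  have c: "continuous_on UNIV (\<lambda>p. char_point w (fst p) (snd p))" by (intro continuous_intros)
  have "(\<lambda>p. char_point w (fst p) (snd p)) \<in> borel_measurable borel"
    by (rule borel_measurable_continuous_onI[OF c])
  then show "(\<lambda>p. char_point w (fst p) (snd p)) \<in> borel_measurable (borel \<Otimes>\<^sub>M borel)"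
    by (simp add: borel_prod)
  then show "(\<lambda>p. char_point w (fst p) (snd p)) \<in> borel_measurable (lborel \<Otimes>\<^sub>M lborel)"
    by (simp cong: measurable_cong_sets sets_pair_measure_cong)
  show "char_point w y \<in> borel_measurable borel"
    by (intro borel_measurable_continuous_onI continuous_intros)
qed

lemma lborel_real2: "distr (lborel \<Otimes>\<^sub>M lborel) borel (\<lambda>p. vector [fst p, snd p]) = (lborel :: (real^2) measure)"
proof (rule lborel_eqI[symmetric])
  have e: "(\<lambda>p::real\<times>real. vector [fst p, snd p]) = (\<lambda>p. fst p *\<^sub>R axis 1 1 + snd p *\<^sub>R axis 2 1 :: real^2)"
    by (auto simp: vec_eq_iff forall_2 axis_def)
  have c: "continuous_on UNIV (\<lambda>p::real\<times>real. vector [fst p, snd p] :: real^2)"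
    unfolding e by (intro continuous_intros)
  have m: "(\<lambda>p::real\<times>real. vector [fst p, snd p] :: real^2) \<in> borel_measurable (lborel \<Otimes>\<^sub>M lborel)"
    using borel_measurable_continuous_onI[OF c] by (simp add: lborel_prod)
  fix l u :: "real^2" assume "\<And>b. b \<in> Basis \<Longrightarrow> l \<bullet> b \<le> u \<bullet> b"
  then have "l \<bullet> axis i 1 \<le> u \<bullet> axis i 1" for i by (auto simp: Basis_vec_def)
  then have lu: "l $ 1 \<le> u $ 1" "l $ 2 \<le> u $ 2" by (auto simp: inner_axis)
  have pre: "(\<lambda>p. vector [fst p, snd p]) -` box l u \<inter> space (lborel \<Otimes>\<^sub>M lborel)
      = {l $ 1<..<u $ 1} \<times> {l $ 2<..<u $ 2}"
    by (auto simp: mem_box_cart forall_2 space_pair_measure)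
  have "(\<Prod>b\<in>Basis. (u - l) \<bullet> b) = (\<Prod>i\<in>UNIV. (u - l) $ i)"
    by (subst prod.reindex_bij_betw[symmetric, of "\<lambda>i. axis i 1" UNIV])
      (auto simp: bij_betw_def inj_on_def axis_eq_axis Basis_vec_def inner_axis image_def)
  also have "\<dots> = (u $ 1 - l $ 1) * (u $ 2 - l $ 2)" by (simp add: prod_2 UNIV_2)
  finally show "emeasure (distr (lborel \<Otimes>\<^sub>M lborel) borel (\<lambda>p. vector [fst p, snd p])) (box l u)
      = ennreal (\<Prod>b\<in>Basis. (u - l) \<bullet> b)"
    using lu by (simp add: emeasure_distr m pre lborel.emeasure_pair_measure_Times ennreal_mult)
qed simp

lemma lborel_linear_char:
  assumes w: "w \<noteq> 0"
  shows "lborel = density (distr lborel borel (\<lambda>x::real^2. char_point w (x $ 1) (x $ 2))) (\<lambda>_. ennreal ((norm w)\<^sup>2))"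
proof (rule lborel_eqI)
  let ?L = "\<lambda>x::real^2. char_point w (x $ 1) (x $ 2)"
  let ?I = "\<lambda>z::real^2. vector [(z \<bullet> perp w) / (norm w)\<^sup>2, (z \<bullet> w) / (norm w)\<^sup>2] :: real^2"
  have Lm: "?L \<in> borel_measurable borel"
    by (intro borel_measurable_continuous_onI continuous_intros)
  have linL: "linear ?L"
    by (rule linearI) (simp_all add: char_point_def algebra_simps)
  have linI: "linear ?I"
    by (rule linearI) (simp_all add: vec_eq_iff forall_2 inner_add_left add_divide_distrib)
  have LI: "?L (?I z) = z" for z using char_point_surj[OF w] by simp
  have IL: "?I (?L x) = x" for x
    using w by (simp add: char_point_inner vec_eq_iff forall_2)
  fix l u :: "real^2" assume lu: "\<And>b. b \<in> Basis \<Longrightarrow> l \<bullet> b \<le> u \<bullet> b"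
  let ?S = "?I ` box l u"
  have S: "?S \<in> lmeasurable" by (rule measurable_linear_image[OF linI]) auto
  have vim: "?L -` box l u = ?S"
  proof (intro equalityI subsetI)
    fix x assume "x \<in> ?L -` box l u"
    then have "?L x \<in> box l u" by simp
    then have "?I (?L x) \<in> ?S" by (rule imageI)
    then show "x \<in> ?S" by (simp only: IL)
  next
    fix x assume "x \<in> ?S"
    then show "x \<in> ?L -` box l u" using LI by auto
  qed
  have LS: "?L ` ?S = box l u" by (simp only: image_image LI image_ident)
  have Sb: "?S \<in> sets borel" unfolding vim[symmetric] using measurable_sets[OF Lm, of "box l u"] by simp
  have det: "\<bar>det (matrix ?L)\<bar> = (norm w)\<^sup>2"
  proof -
    have n: "(norm w)\<^sup>2 = w $ 1 * w $ 1 + w $ 2 * w $ 2" by (simp add: power2_norm_eq_inner inner_real2)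
    have "det (matrix ?L) = - (w $ 1 * w $ 1 + w $ 2 * w $ 2)"
      by (simp add: det_2 matrix_def char_point_def axis_def)
    then show ?thesis unfolding n by (simp add: abs_if) (smt (verit) zero_le_square)
  qed
  have m: "measure lebesgue (box l u) = (norm w)\<^sup>2 * measure lebesgue ?S"
    using measure_linear_image[OF linL S] unfolding LS det .
  have "emeasure (density (distr lborel borel ?L) (\<lambda>_. ennreal ((norm w)\<^sup>2))) (box l u)
      = ennreal ((norm w)\<^sup>2) * emeasure lborel ?S"
    using Lm by (simp add: emeasure_density nn_integral_cmult emeasure_distr vim)
  also have "emeasure lborel ?S = ennreal (measure lebesgue ?S)"
    using emeasure_eq_measure2[OF S] Sb by (simp add: emeasure_completion)
  also have "ennreal ((norm w)\<^sup>2) * \<dots> = ennreal (measure lebesgue (box l u))"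
    unfolding m by (simp add: ennreal_mult)
  also have "\<dots> = ennreal (\<Prod>b\<in>Basis. (u - l) \<bullet> b)"
    using lu by (simp add: measure_completion measure_lborel_box)
  finally show "emeasure (density (distr lborel borel ?L) (\<lambda>_. ennreal ((norm w)\<^sup>2))) (box l u)
      = ennreal (\<Prod>b\<in>Basis. (u - l) \<bullet> b)" .
qed simp

lemma lborel_char:
  assumes w: "w \<noteq> 0"
  shows "lborel = density (distr (lborel \<Otimes>\<^sub>M lborel) borel (\<lambda>p. char_point w (fst p) (snd p)))
    (\<lambda>_. ennreal ((norm w)\<^sup>2))"
proof -
  have e: "(\<lambda>p::real\<times>real. vector [fst p, snd p]) = (\<lambda>p. fst p *\<^sub>R axis 1 1 + snd p *\<^sub>R axis 2 1 :: real^2)"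
    by (auto simp: vec_eq_iff forall_2 axis_def)
  have c: "continuous_on UNIV (\<lambda>p::real\<times>real. vector [fst p, snd p] :: real^2)"
    unfolding e by (intro continuous_intros)
  have m: "(\<lambda>p::real\<times>real. vector [fst p, snd p] :: real^2) \<in> borel_measurable (lborel \<Otimes>\<^sub>M lborel)"
    using borel_measurable_continuous_onI[OF c] by (simp add: lborel_prod)
  have Lm: "(\<lambda>x::real^2. char_point w (x $ 1) (x $ 2)) \<in> borel_measurable borel"
    by (intro borel_measurable_continuous_onI continuous_intros)
  have "distr lborel borel (\<lambda>x::real^2. char_point w (x $ 1) (x $ 2))
      =  distr (lborel \<Otimes>\<^sub>M lborel) borel (\<lambda>p. char_point w (fst p) (snd p))"
    by (subst lborel_real2[symmetric], subst distr_distr[OF Lm m]) (simp add: comp_def)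
  then show ?thesis using lborel_linear_char[OF w] by simp
qed

lemma nn_integral_char:
  assumes w: "w \<noteq> 0" and f[measurable]: "f \<in> borel_measurable borel"
  shows "(\<integral>\<^sup>+z. f z \<partial>lborel) = ennreal ((norm w)\<^sup>2) * (\<integral>\<^sup>+y. \<integral>\<^sup>+t. f (char_point w y t) \<partial>lborel \<partial>lborel)"
proof -
  have "(\<integral>\<^sup>+z. f z \<partial>lborel) = ennreal ((norm w)\<^sup>2) *
      (\<integral>\<^sup>+p. f (char_point w (fst p) (snd p)) \<partial>(lborel \<Otimes>\<^sub>M lborel))"
    by (subst lborel_char[OF w]) (simp add: nn_integral_density nn_integral_distr nn_integral_cmult)
  also have "(\<integral>\<^sup>+p. f (char_point w (fst p) (snd p)) \<partial>(lborel \<Otimes>\<^sub>M lborel))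
      = (\<integral>\<^sup>+y. \<integral>\<^sup>+t. f (char_point w y t) \<partial>lborel \<partial>lborel)"
    by (subst lborel.nn_integral_fst[symmetric]) simp_all
  finally show ?thesis .
qed

text \<open>Fubini for null sets: a property that holds almost everywhere holds almost everywhere on almost
  every characteristic.\<close>

lemma AE_char:
  assumes w: "w \<noteq> 0" and P: "AE z in lborel. P z"
  shows "AE y in lborel. AE t in lborel. P (char_point w y t)"
proof -
  obtain N where N: "N \<in> sets lborel" "emeasure lborel N = 0" "{z. \<not> P z} \<subseteq> N"
    using P by (auto elim!: AE_E)
  have [measurable]: "N \<in> sets borel" using N by simp
  have "(\<integral>\<^sup>+z. indicator N z \<partial>lborel) = 0" using N by simp
  then have "(\<integral>\<^sup>+y. \<integral>\<^sup>+t. indicator N (char_point w y t) \<partial>lborel \<partial>lborel) = 0"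
    using nn_integral_char[OF w, of "indicator N"] w by simp
  then have "AE y in lborel. (\<integral>\<^sup>+t. indicator N (char_point w y t) \<partial>lborel) = 0"
    by (subst (asm) nn_integral_0_iff_AE) (auto intro!: lborel.borel_measurable_nn_integral_fst[of "\<lambda>p. indicator N (char_point w (fst p) (snd p))" lborel, simplified])
  then show ?thesis
  proof eventually_elim
    case (elim y)
    have "(\<lambda>t. indicator N (char_point w y t) :: ennreal) \<in> borel_measurable lborel" by measurable
    then have "AE t in lborel. indicator N (char_point w y t) = (0::ennreal)"
      using elim by (subst (asm) nn_integral_0_iff_AE) auto
    then show ?case
      by eventually_elim (use N(3) in \<open>auto simp: indicator_def split: if_splits\<close>)
  qed
qed

lemma integral_char:
  fixes f :: "real^2 \<Rightarrow> real"
  assumes w: "w \<noteq> 0" and f: "integrable lborel f"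
  shows "(\<integral>z. f z \<partial>lborel) = (norm w)\<^sup>2 * (\<integral>y. \<integral>t. f (char_point w y t) \<partial>lborel \<partial>lborel)"
    and "integrable lborel (\<lambda>y. \<integral>t. f (char_point w y t) \<partial>lborel)"
    and "AE y in lborel. integrable lborel (\<lambda>t. f (char_point w y t))"
proof -
  have [measurable]: "f \<in> borel_measurable borel" using f by auto
  have i: "integrable (lborel \<Otimes>\<^sub>M lborel) (\<lambda>p. f (char_point w (fst p) (snd p)))"
  proof -
    have "integrable (density (distr (lborel \<Otimes>\<^sub>M lborel) borel (\<lambda>p. char_point w (fst p) (snd p))) (\<lambda>_. ennreal ((norm w)\<^sup>2))) f"
      using f lborel_char[OF w] by simp
    then show ?thesis using w by (simp add: integrable_density integrable_distr_eq)
  qed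
  have "(\<integral>z. f z \<partial>lborel) = (norm w)\<^sup>2 * (\<integral>p. f (char_point w (fst p) (snd p)) \<partial>(lborel \<Otimes>\<^sub>M lborel))"
    by (subst lborel_char[OF w]) (simp add: integral_density integral_distr)
  also have "(\<integral>p. f (char_point w (fst p) (snd p)) \<partial>(lborel \<Otimes>\<^sub>M lborel))
      = (\<integral>y. \<integral>t. f (char_point w y t) \<partial>lborel \<partial>lborel)"
    using lborel_pair.integral_fst'[OF i] by simp
  finally show "(\<integral>z. f z \<partial>lborel) = (norm w)\<^sup>2 * (\<integral>y. \<integral>t. f (char_point w y t) \<partial>lborel \<partial>lborel)" .
  show "integrable lborel (\<lambda>y. \<integral>t. f (char_point w y t) \<partial>lborel)"
    using lborel_pair.integrable_fst'[OF i] by simp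
  show "AE y in lborel. integrable lborel (\<lambda>t. f (char_point w y t))"
    using lborel_pair.AE_integrable_fst'[OF i] by simp
qed

section \<open>Convex curves and their chords\<close>

lemma strictly_convex_imp_convex:
  assumes "open \<Omega>" "strictly_convex \<Omega>" shows "convex \<Omega>"
  unfolding convex_contains_segment
proof (intro ballI)
  fix x y assume xy: "x \<in> \<Omega>" "y \<in> \<Omega>"
  have "open_segment x y \<subseteq> \<Omega>" if "x \<noteq> y"
    using assms that xy closure_subset interior_subset unfolding strictly_convex_def by blast
  then show "closed_segment x y \<subseteq> \<Omega>"
    using xy by (cases "x = y") (auto simp: open_segment_def)
qed

text \<open>An arc length parametrization of the boundary, with its two derivatives made explicit.\<close>

locale convex_curve =
  fixes \<Omega> :: "(real^2) set" and L :: real and \<gamma> \<gamma>' \<gamma>'' :: "real \<Rightarrow> real^2"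
  assumes opn: "open \<Omega>" and bdd: "bounded \<Omega>" and cvx: "convex \<Omega>" and L0: "0 < L"
    and per: "\<And>s. \<gamma> (s + L) = \<gamma> s" and inj: "inj_on \<gamma> {0..<L}" and rng: "range \<gamma> = frontier \<Omega>"
    and d1: "\<And>s. (\<gamma> has_vector_derivative \<gamma>' s) (at s)"
    and d2: "\<And>s. (\<gamma>' has_vector_derivative \<gamma>'' s) (at s)"
    and nrm: "\<And>s. norm (\<gamma>' s) = 1" and c2: "continuous_on UNIV \<gamma>''"
begin

lemma nonempty: "\<Omega> \<noteq> {}"
  using rng by auto

lemma curve_boundary: "\<gamma> s \<in> closure \<Omega>" "\<gamma> s \<notin> \<Omega>"
proof -
  have "\<gamma> s \<in> frontier \<Omega>" using rng by auto
  then show "\<gamma> s \<in> closure \<Omega>" "\<gamma> s \<notin> \<Omega>" using opn by (auto simp: frontier_def interior_open)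
qed

lemma continuous_curve: "continuous_on X \<gamma>" "continuous_on X \<gamma>'"
  using d1 d2 by (auto intro!: continuous_at_imp_continuous_on has_vector_derivative_continuous)

text \<open>The function \<open>m \<bullet> (\<gamma> \<tau> - \<gamma> s)\<close> of \<open>\<tau>\<close>
  has a minimum at \<open>s\<close>.\<close>

lemma tangent_to_supporting_line:
  assumes "\<And>x. x \<in> \<Omega> \<Longrightarrow> 0 \<le> m \<bullet> (x - \<gamma> s)"
  shows "m \<bullet> \<gamma>' s = 0"
proof -
  have nn: "0 \<le> m \<bullet> (x - \<gamma> s)" if "x \<in> closure \<Omega>" for x
  proof -
    have "closed {x. 0 \<le> m \<bullet> (x - \<gamma> s)}" by (intro closed_Collect_le continuous_intros)
    then have "closure \<Omega> \<subseteq> {x. 0 \<le> m \<bullet> (x - \<gamma> s)}" using assms by (intro closure_minimal) auto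
    then show ?thesis using that by auto
  qed
  have "((\<lambda>\<tau>. m \<bullet> (\<gamma> \<tau> - \<gamma> s)) has_vector_derivative m \<bullet> \<gamma>' s) (at s)"
    by (auto intro!: derivative_eq_intros d1 simp: has_vector_derivative_def inner_diff_right
        intro: has_derivative_eq_rhs) (auto intro!: derivative_eq_intros d1[unfolded has_vector_derivative_def])
  then have "((\<lambda>\<tau>. m \<bullet> (\<gamma> \<tau> - \<gamma> s)) has_real_derivative m \<bullet> \<gamma>' s) (at s)"
    by (simp add: has_real_derivative_iff_has_vector_derivative)
  then show ?thesis
    by (rule DERIV_local_min[of _ _ _ 1]) (use nn curve_boundary(1) in auto)
qed

text \<open>Separation of \<open>\<Omega>\<close> from \<open>T\<close>. With a single point \<open>T\<close>
  this gives the normal; with a ray, it shows that transversal rays enter the domain.\<close>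

lemma supporting_line:
  assumes T: "convex T" "\<gamma> s \<in> T" "T \<inter> \<Omega> = {}"
  obtains m where "norm m = 1" "\<And>x. x \<in> \<Omega> \<Longrightarrow> 0 < m \<bullet> (x - \<gamma> s)" "\<And>x. x \<in> T \<Longrightarrow> m \<bullet> (x - \<gamma> s) \<le> 0"
proof -
  obtain a b where ab: "a \<noteq> 0" "\<And>x. x \<in> T \<Longrightarrow> a \<bullet> x \<le> b" "\<And>x. x \<in> \<Omega> \<Longrightarrow> a \<bullet> x \<ge> b"
    using separating_hyperplane_sets[OF T(1) cvx _ nonempty T(3)] T(2) by blast
  have "closure \<Omega> \<subseteq> {x. a \<bullet> x \<ge> b}"
    by (intro closure_minimal) (use ab(3) in \<open>auto intro!: closed_Collect_le continuous_intros\<close>)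
  then have b: "a \<bullet> \<gamma> s = b" using curve_boundary(1)[of s] ab(2)[OF T(2)] by force
  have pos: "0 < a \<bullet> (x - \<gamma> s)" if x: "x \<in> \<Omega>" for x
  proof -
    obtain e where e: "0 < e" "ball x e \<subseteq> \<Omega>" using opn x open_contains_ball by blast
    let ?y = "x - (e / 2 / norm a) *\<^sub>R a"
    have "?y \<in> \<Omega>" using e ab(1) by (intro subsetD[OF e(2)]) (simp add: dist_norm)
    then have "b \<le> a \<bullet> x - (e / 2 / norm a) * (a \<bullet> a)" using ab(3)[of ?y] by (simp add: inner_diff_right)
    moreover have "0 < (e / 2 / norm a) * (a \<bullet> a)" using e ab(1) by simp
    ultimately show ?thesis using b by (simp add: inner_diff_right)
  qed
  show ?thesis
  proof (rule that[of "sgn a"])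
    show "norm (sgn a) = 1" using ab(1) by (simp add: norm_sgn)
    show "0 < sgn a \<bullet> (x - \<gamma> s)" if "x \<in> \<Omega>" for x
      using pos[OF that] ab(1) by (simp add: sgn_div_norm)
    show "sgn a \<bullet> (x - \<gamma> s) \<le> 0" if "x \<in> T" for x
      using ab(2)[OF that] b ab(1) by (simp add: sgn_div_norm inner_diff_right mult_le_0_iff)
  qed
qed

lemma unit_normal_cases:
  assumes "norm m = 1" "m \<bullet> \<gamma>' s = 0" shows "m = perp (\<gamma>' s) \<or> m = - perp (\<gamma>' s)"
proof -
  have "\<gamma>' s \<noteq> 0" using nrm[of s] by auto
  then have m: "m = (m \<bullet> perp (\<gamma>' s)) *\<^sub>R perp (\<gamma>' s)"
    using char_point_surj[of "\<gamma>' s" m] assms(2) nrm[of s] by (simp add: char_point_def)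
  then have "\<bar>m \<bullet> perp (\<gamma>' s)\<bar> = 1" using assms(1) nrm[of s]
    by (metis norm_scaleR norm_perp mult.right_neutral)
  then show ?thesis using m by (metis abs_eq_iff' scaleR_one scaleR_minus1_left abs_1 abs_eq_iff)
qed

text \<open>At every point one of the two unit normals points inwards. Which one is decided by the sign of a
  continuous function without zeros.\<close>

lemma orientation_ex:
  "\<exists>\<epsilon>. (\<epsilon> = 1 \<or> \<epsilon> = -1) \<and> (\<forall>s. \<forall>x\<in>\<Omega>. 0 < \<epsilon> * (perp (\<gamma>' s) \<bullet> (x - \<gamma> s)))"
proof -
  obtain z where z: "z \<in> \<Omega>" using nonempty by auto
  have dich: "(\<forall>x\<in>\<Omega>. 0 < perp (\<gamma>' s) \<bullet> (x - \<gamma> s)) \<or> (\<forall>x\<in>\<Omega>. 0 < - (perp (\<gamma>' s) \<bullet> (x - \<gamma> s)))" for s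
  proof -
    obtain m where m: "norm m = 1" "\<And>x. x \<in> \<Omega> \<Longrightarrow> 0 < m \<bullet> (x - \<gamma> s)"
      using supporting_line[of "{\<gamma> s}" s] curve_boundary(2)[of s] by auto
    then have "m = perp (\<gamma>' s) \<or> m = - perp (\<gamma>' s)"
      by (intro unit_normal_cases tangent_to_supporting_line) (auto intro: less_imp_le)
    then show ?thesis using m(2) by auto
  qed
  let ?f = "\<lambda>s. perp (\<gamma>' s) \<bullet> (z - \<gamma> s)"
  have cont: "continuous_on UNIV ?f"
    unfolding inner_real2 perp_nth by (intro continuous_intros continuous_curve)
  have nz: "?f s \<noteq> 0" for s using dich[of s] z by force
  have sgn: "(\<forall>s. 0 < ?f s) \<or> (\<forall>s. ?f s < 0)"
  proof (rule ccontr)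
    assume "\<not> ?thesis"
    then obtain s t where st: "?f s < 0" "0 < ?f t" using nz by (meson linorder_neqE_linordered_idom)
    have "connected (range ?f)" by (intro connected_continuous_image cont connected_UNIV)
    then have "0 \<in> range ?f" using st by (meson connectedD_interval rangeI less_imp_le)
    then show False using nz by auto
  qed
  show ?thesis
  proof (cases "\<forall>s. 0 < ?f s")
    case True
    have "0 < 1 * (perp (\<gamma>' s) \<bullet> (x - \<gamma> s))" if x: "x \<in> \<Omega>" for s x
      using dich[of s]
    proof
      assume "\<forall>x\<in>\<Omega>. 0 < perp (\<gamma>' s) \<bullet> (x - \<gamma> s)"
      then show ?thesis using x by simp
    next
      assume "\<forall>x\<in>\<Omega>. 0 < - (perp (\<gamma>' s) \<bullet> (x - \<gamma> s))"
      then have "0 < - ?f s" using z by blast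
      then show ?thesis using True[rule_format, of s] by linarith
    qed
    then show ?thesis by blast
  next
    case False
    then have neg: "?f s < 0" for s using sgn by blast
    have "0 < (-1) * (perp (\<gamma>' s) \<bullet> (x - \<gamma> s))" if x: "x \<in> \<Omega>" for s x
      using dich[of s]
    proof
      assume "\<forall>x\<in>\<Omega>. 0 < perp (\<gamma>' s) \<bullet> (x - \<gamma> s)"
      then have "0 < ?f s" using z by blast
      then show ?thesis using neg[of s] by linarith
    next
      assume "\<forall>x\<in>\<Omega>. 0 < - (perp (\<gamma>' s) \<bullet> (x - \<gamma> s))"
      then have "0 < - (perp (\<gamma>' s) \<bullet> (x - \<gamma> s))" using x by blast
      then show ?thesis by simp
    qed
    then show ?thesis by blast
  qed
qed

definition orientation :: real where
  "orientation = (SOME \<epsilon>. (\<epsilon> = 1 \<or> \<epsilon> = -1) \<and> (\<forall>s. \<forall>x\<in>\<Omega>. 0 < \<epsilon> * (perp (\<gamma>' s) \<bullet> (x - \<gamma> s))))"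

definition normal :: "real \<Rightarrow> real^2" where "normal s = orientation *\<^sub>R perp (\<gamma>' s)"

lemma orientation: "orientation = 1 \<or> orientation = -1"
  and normal_pos: "x \<in> \<Omega> \<Longrightarrow> 0 < normal s \<bullet> (x - \<gamma> s)"
  using someI_ex[OF orientation_ex] unfolding orientation_def[symmetric] normal_def by auto

lemma norm_normal [simp]: "norm (normal s) = 1"
  using orientation nrm by (auto simp: normal_def)

lemma normal_tangent: "normal s \<bullet> \<gamma>' s = 0"
  by (simp add: normal_def perp_inner)

text \<open>This identifies every inward supporting direction at \<open>\<gamma> s\<close>, also one obtained
  from another parameter of the same point.\<close>

lemma normal_unique:
  assumes "norm m = 1" "\<And>x. x \<in> \<Omega> \<Longrightarrow> 0 < m \<bullet> (x - \<gamma> s)"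
  shows "m = normal s"
proof -
  obtain z where z: "z \<in> \<Omega>" using nonempty by auto
  have "m \<bullet> \<gamma>' s = 0" using assms(2) by (intro tangent_to_supporting_line) (auto intro: less_imp_le)
  then have "m = perp (\<gamma>' s) \<or> m = - perp (\<gamma>' s)" by (rule unit_normal_cases[OF assms(1)])
  then have "m = normal s \<or> m = - normal s" using orientation by (auto simp: normal_def)
  then show ?thesis using assms(2)[OF z] normal_pos[OF z, of s] by auto
qed

text \<open>Otherwise the ray would be separated from \<open>\<Omega>\<close> by a line, which can only be the
  tangent, while \<open>d\<close> points to its inner side.\<close>

lemma enters_domain:
  assumes "0 < d \<bullet> normal s"
  shows "\<forall>\<^sub>F t in at_right 0. \<gamma> s + t *\<^sub>R d \<in> \<Omega>"
proof -
  let ?T = "(\<lambda>t. \<gamma> s + t *\<^sub>R d) ` {0..}"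
  have "?T \<inter> \<Omega> \<noteq> {}"
  proof
    assume disj: "?T \<inter> \<Omega> = {}"
    have conv: "convex ?T"
    proof -
      have "convex ((\<lambda>x. \<gamma> s + x) ` ((\<lambda>t. t *\<^sub>R d) ` {0..}))"
        by (intro convex_translation convex_linear_image) (auto simp: linear_iff algebra_simps)
      then show ?thesis by (simp add: image_image)
    qed
    have "\<gamma> s \<in> ?T" by (auto simp: image_iff intro!: bexI[of _ 0])
    then obtain m where m: "norm m = 1" "\<And>x. x \<in> \<Omega> \<Longrightarrow> 0 < m \<bullet> (x - \<gamma> s)" "\<And>x. x \<in> ?T \<Longrightarrow> m \<bullet> (x - \<gamma> s) \<le> 0"
      using supporting_line[OF conv _ disj] by blast
    have "m \<bullet> (\<gamma> s + 1 *\<^sub>R d - \<gamma> s) \<le> 0" by (rule m(3), rule image_eqI[of _ _ 1]) auto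
    then show False using normal_unique[OF m(1,2)] assms by (simp add: inner_commute)
  qed
  then obtain t where t: "0 \<le> t" "\<gamma> s + t *\<^sub>R d \<in> \<Omega>" by auto
  have t0: "0 < t" using t curve_boundary(2)[of s] by (cases "t = 0") auto
  have "\<gamma> s + r *\<^sub>R d \<in> \<Omega>" if "0 < r" "r < t" for r
  proof -
    have "\<gamma> s - (r / t) *\<^sub>R (\<gamma> s - (\<gamma> s + t *\<^sub>R d)) \<in> interior \<Omega>"
    proof (rule mem_interior_closure_convex_shrink[OF cvx _ curve_boundary(1)])
      show "\<gamma> s + t *\<^sub>R d \<in> interior \<Omega>" using t(2) opn by (simp add: interior_open)
      show "0 < r / t" "r / t \<le> 1" using that by (simp_all add: field_simps)
    qed
    moreover have "\<gamma> s - (r / t) *\<^sub>R (\<gamma> s - (\<gamma> s + t *\<^sub>R d)) = \<gamma> s + r *\<^sub>R d"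
      using t0 by (simp add: algebra_simps)
    ultimately show ?thesis using opn t0 by (simp add: interior_open)
  qed
  then show ?thesis using eventually_at_right_real[OF t0] by (auto elim: eventually_mono)
qed

lemma inward_normal_curve: "inward_normal \<Omega> \<gamma> (\<gamma> s) = normal s"
  unfolding inward_normal_def
proof (rule the_equality)
  have vd: "vector_derivative \<gamma> (at s) = \<gamma>' s" for s using d1 by (rule vector_derivative_at)
  have "normal s \<bullet> normal s = 1" by (simp add: dot_square_norm)
  then show "norm (normal s) = 1 \<and> (\<exists>sa. \<gamma> sa = \<gamma> s \<and> normal s \<bullet> vector_derivative \<gamma> (at sa) = 0) \<and>
      (\<forall>\<^sub>F t in at_right 0. \<gamma> s + t *\<^sub>R normal s \<in> \<Omega>)"
    using normal_tangent[of s] by (auto simp: vd intro!: enters_domain)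
  fix u assume u: "norm u = 1 \<and> (\<exists>sa. \<gamma> sa = \<gamma> s \<and> u \<bullet> vector_derivative \<gamma> (at sa) = 0) \<and>
      (\<forall>\<^sub>F t in at_right 0. \<gamma> s + t *\<^sub>R u \<in> \<Omega>)"
  then obtain \<tau> where \<tau>: "\<gamma> \<tau> = \<gamma> s" "u \<bullet> \<gamma>' \<tau> = 0" by (auto simp: vd)
  have "normal \<tau> = normal s" by (rule normal_unique) (use normal_pos[of _ \<tau>] \<tau>(1) in auto)
  have "\<forall>\<^sub>F t in at_right 0. \<gamma> s + t *\<^sub>R u \<in> \<Omega> \<and> 0 < (t::real)"
    using u eventually_at_right_less[of 0] by (auto intro: eventually_conj)
  then obtain t :: real where t: "\<gamma> s + t *\<^sub>R u \<in> \<Omega>" "0 < t"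
    using eventually_happens'[OF trivial_limit_at_right_real] by blast
  have "0 < normal s \<bullet> (\<gamma> s + t *\<^sub>R u - \<gamma> s)" by (rule normal_pos[OF t(1)])
  then have "0 < normal s \<bullet> u" using t(2) by (simp add: zero_less_mult_iff)
  moreover have "u = perp (\<gamma>' \<tau>) \<or> u = - perp (\<gamma>' \<tau>)" using u \<tau> by (intro unit_normal_cases) auto
  then have "u = normal \<tau> \<or> u = - normal \<tau>" using orientation by (auto simp: normal_def)
  ultimately show "u = normal s" unfolding \<open>normal \<tau> = normal s\<close> by (auto simp: dot_square_norm)
qed

definition curvature :: "real \<Rightarrow> real" where "curvature s = \<gamma>'' s \<bullet> normal s"

text \<open>A negative second derivative would carry the curve to the wrong side of its tangent.\<close>

lemma curvature_nonneg: "0 \<le> curvature s"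
proof (rule ccontr)
  assume neg: "\<not> 0 \<le> curvature s"
  let ?f = "\<lambda>\<tau>. normal s \<bullet> (\<gamma> \<tau> - \<gamma> s)" and ?g = "\<lambda>\<tau>. normal s \<bullet> \<gamma>' \<tau>"
  have f: "(?f has_real_derivative ?g \<tau>) (at \<tau>)" for \<tau>
    unfolding has_field_derivative_def
    by (auto intro!: derivative_eq_intros d1[unfolded has_vector_derivative_def])
  have g: "(?g has_real_derivative curvature s) (at s)"
    unfolding has_field_derivative_def curvature_def
    by (auto intro!: derivative_eq_intros d2[unfolded has_vector_derivative_def] simp: inner_commute)
  obtain d where d: "0 < d" "\<And>h. 0 < h \<Longrightarrow> h < d \<Longrightarrow> ?g (s + h) < ?g s"
    using DERIV_neg_dec_right[OF g] neg by auto
  have "\<exists>z>s. z < s + d / 2 \<and> ?f (s + d / 2) - ?f s = (s + d / 2 - s) * ?g z"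
    using d(1) f by (intro MVT2) auto
  then obtain z where z: "s < z" "z < s + d / 2" "?f (s + d / 2) = d / 2 * ?g z" by auto
  have "?g z < 0" using d(2)[of "z - s"] z normal_tangent[of s] d(1) by simp
  then have "d / 2 * ?g z < 0" using d(1) by (intro mult_pos_neg) auto
  then have "?f (s + d / 2) < 0" using z(3) by argo
  moreover have "0 \<le> ?f (s + d / 2)"
  proof -
    have "closure \<Omega> \<subseteq> {x. 0 \<le> normal s \<bullet> (x - \<gamma> s)}"
      using normal_pos[of _ s] by (intro closure_minimal closed_Collect_le continuous_intros) (auto intro: less_imp_le)
    then show ?thesis using curve_boundary(1) by blast
  qed
  ultimately show False by simp
qed

text \<open>The curve has unit speed, so that its acceleration is normal.\<close>

lemma frenet: "\<gamma>'' s = curvature s *\<^sub>R normal s"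
proof -
  have "((\<lambda>\<tau>. \<gamma>' \<tau> \<bullet> \<gamma>' \<tau>) has_derivative (\<lambda>h. \<gamma>' s \<bullet> (h *\<^sub>R \<gamma>'' s) + (h *\<^sub>R \<gamma>'' s) \<bullet> \<gamma>' s)) (at s)"
    by (intro has_derivative_inner d2[unfolded has_vector_derivative_def])
  moreover have "(\<lambda>\<tau>. \<gamma>' \<tau> \<bullet> \<gamma>' \<tau>) = (\<lambda>\<tau>. 1)" using nrm by (auto simp: dot_square_norm)
  ultimately have "((\<lambda>\<tau>::real. 1::real) has_derivative (\<lambda>h. \<gamma>' s \<bullet> (h *\<^sub>R \<gamma>'' s) + (h *\<^sub>R \<gamma>'' s) \<bullet> \<gamma>' s)) (at s)"
    by simp
  then have "(\<lambda>h. \<gamma>' s \<bullet> (h *\<^sub>R \<gamma>'' s) + (h *\<^sub>R \<gamma>'' s) \<bullet> \<gamma>' s) = (\<lambda>h. 0)"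
    by (rule has_derivative_unique) auto
  then have "\<gamma>'' s \<bullet> \<gamma>' s = 0" by (auto simp: fun_eq_iff inner_commute dest!: spec[of _ 1])
  moreover have "\<gamma>' s \<noteq> 0" using nrm[of s] by auto
  ultimately have "\<gamma>'' s = (\<gamma>'' s \<bullet> perp (\<gamma>' s)) *\<^sub>R perp (\<gamma>' s)"
    using char_point_surj[of "\<gamma>' s" "\<gamma>'' s"] nrm[of s] by (simp add: char_point_def)
  also have "\<dots> = curvature s *\<^sub>R normal s"
    using orientation by (elim disjE) (simp_all add: curvature_def normal_def)
  finally show ?thesis .
qed

lemma normal_component_derivative:
  "((\<lambda>s. v \<bullet> normal s) has_real_derivative - curvature s * (v \<bullet> \<gamma>' s)) (at s)"
  "((\<lambda>s. v \<bullet> \<gamma>' s) has_real_derivative curvature s * (v \<bullet> normal s)) (at s)"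
proof -
  show "((\<lambda>s. v \<bullet> \<gamma>' s) has_real_derivative curvature s * (v \<bullet> normal s)) (at s)"
    unfolding has_field_derivative_def
    by (auto intro!: derivative_eq_intros d2[unfolded has_vector_derivative_def] simp: frenet[of s])
  have D: "((\<lambda>s. (- orientation *\<^sub>R perp v) \<bullet> \<gamma>' s) has_real_derivative (- orientation *\<^sub>R perp v) \<bullet> \<gamma>'' s) (at s)"
    unfolding has_field_derivative_def
    by (auto intro!: derivative_eq_intros d2[unfolded has_vector_derivative_def])
  have e1: "(\<lambda>s. (- orientation *\<^sub>R perp v) \<bullet> \<gamma>' s) = (\<lambda>s. v \<bullet> normal s)"
    by (rule ext) (simp add: normal_def inner_real2 algebra_simps)
  have e2: "(- orientation *\<^sub>R perp v) \<bullet> \<gamma>'' s = - curvature s * (v \<bullet> \<gamma>' s)"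
  proof -
    have "orientation * orientation = 1" using orientation by auto
    moreover have "(- orientation *\<^sub>R perp v) \<bullet> (curvature s *\<^sub>R (orientation *\<^sub>R perp (\<gamma>' s)))
        = - curvature s * (orientation * orientation) * (perp v \<bullet> perp (\<gamma>' s))" by simp
    ultimately show ?thesis
      by (subst frenet) (simp only: normal_def perp_inner(1) mult_1_right)
  qed
  show "((\<lambda>s. v \<bullet> normal s) has_real_derivative - curvature s * (v \<bullet> \<gamma>' s)) (at s)"
    by (rule D[unfolded e1 e2])
qed

text \<open>Normal and tangent form an orthonormal basis.\<close>

lemma normal_tangent_pythagoras: "(v \<bullet> normal s)\<^sup>2 + (v \<bullet> \<gamma>' s)\<^sup>2 = (norm v)\<^sup>2"
proof -
  have "\<gamma>' s \<noteq> 0" using nrm[of s] by auto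
  then have "char_point (\<gamma>' s) (v \<bullet> perp (\<gamma>' s)) (v \<bullet> \<gamma>' s) = v"
    using char_point_surj[of "\<gamma>' s" v] nrm[of s] by simp
  then have "(norm v)\<^sup>2 = (v \<bullet> perp (\<gamma>' s))\<^sup>2 + (v \<bullet> \<gamma>' s)\<^sup>2"
    using norm_char_point[of "\<gamma>' s" "v \<bullet> perp (\<gamma>' s)" "v \<bullet> \<gamma>' s"] nrm[of s] by simp
  then show ?thesis using orientation by (elim disjE) (simp_all add: normal_def)
qed
end

lemma open_convex_bounded_real_interval:
  fixes I :: "real set"
  assumes "open I" "convex I" "bounded I" "I \<noteq> {}"
  shows "I = {Inf I<..<Sup I}" and "Inf I < Sup I"
proof -
  have bb: "bdd_below I" "bdd_above I" using assms(3) by (auto intro: bounded_imp_bdd_above bounded_imp_bdd_below)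
  show eq: "I = {Inf I<..<Sup I}"
  proof (intro equalityI subsetI)
    fix x assume x: "x \<in> I"
    then obtain e where e: "0 < e" "ball x e \<subseteq> I" using assms(1) open_contains_ball by blast
    have "x - e / 2 \<in> I" "x + e / 2 \<in> I" using e by (auto intro!: subsetD[OF e(2)] simp: dist_real_def)
    then have "Inf I \<le> x - e / 2" "x + e / 2 \<le> Sup I" using bb by (auto intro: cInf_lower cSup_upper)
    then show "x \<in> {Inf I<..<Sup I}" using e by auto
  next
    fix x assume x: "x \<in> {Inf I<..<Sup I}"
    then obtain u where u: "u \<in> I" "u < x" using cInf_lessD[OF assms(4), of x] by auto
    obtain w where w: "w \<in> I" "x < w" using x less_cSupD[OF assms(4), of x] by auto
    have "closed_segment u w \<subseteq> I" using assms(2) u w by (simp add: closed_segment_subset)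
    then show "x \<in> I" using u w by (auto simp: closed_segment_eq_real_ivl)
  qed
  show "Inf I < Sup I" using eq assms(4) by auto
qed

lemma nn_integral_continuous_Icc:
  fixes G :: "real \<Rightarrow> real"
  assumes "continuous_on {a..b} G" "\<And>x. x \<in> {a..b} \<Longrightarrow> 0 \<le> G x"
  shows "(\<integral>\<^sup>+x\<in>{a..b}. ennreal (G x) \<partial>lborel) = ennreal (integral {a..b} G)"
proof -
  have si: "set_integrable lborel {a..b} G" using borel_integrable_atLeastAtMost'[OF assms(1)] .
  then have i: "integrable lborel (\<lambda>x. G x * indicator {a..b} x)"
    by (simp add: set_integrable_def mult.commute)
  have "(\<integral>\<^sup>+x\<in>{a..b}. ennreal (G x) \<partial>lborel) = (\<integral>\<^sup>+x. ennreal (G x * indicator {a..b} x) \<partial>lborel)"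
    by (auto intro!: nn_integral_cong split: split_indicator)
  also have "\<dots> = ennreal (\<integral>x. G x * indicator {a..b} x \<partial>lborel)"
    by (rule nn_integral_eq_integral[OF i]) (use assms(2) in \<open>auto split: split_indicator\<close>)
  also have "(\<integral>x. G x * indicator {a..b} x \<partial>lborel) = integral {a..b} G"
    using set_borel_integral_eq_integral(2)[OF si] by (simp add: set_lebesgue_integral_def mult.commute)
  finally show ?thesis .
qed

context convex_curve begin

lemma periodic_int:
  fixes f :: "real \<Rightarrow> 'b"
  assumes "\<And>s. f (s + L) = f s" shows "f (s + of_int n * L) = f s"
proof -
  have nat: "f (s + real m * L) = f s" for m :: nat and s
    by (induction m) (use assms in \<open>auto simp: algebra_simps\<close>, metis add.assoc add.commute)
  show ?thesis
  proof (cases "n \<ge> 0")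
    case True then show ?thesis using nat[of s "nat n"] by simp
  next
    case False
    then show ?thesis using nat[of "s + of_int n * L" "nat (- n)"] by (simp add: algebra_simps)
  qed
qed

lemma periodic_tangent: "\<gamma>' (s + L) = \<gamma>' s"
proof -
  have "((\<lambda>x. \<gamma> (x + L)) has_vector_derivative \<gamma>' (s + L)) (at s)"
  proof -
    have "((\<lambda>x. x + L) has_vector_derivative 1) (at s)"
      unfolding has_real_derivative_iff_has_vector_derivative[symmetric] by (auto intro!: derivative_eq_intros)
    then show ?thesis
      using vector_diff_chain_at[of "\<lambda>x. x + L" 1 s \<gamma> "\<gamma>' (s + L)"] d1[of "s + L"] by (simp add: comp_def)
  qed
  then show ?thesis using d1[of s] per vector_derivative_unique_at by simp
qed

lemma periodic_normal: "normal (s + L) = normal s"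
  by (simp add: normal_def periodic_tangent)

lemma reduce_parameter: "\<exists>r\<in>{0..<L}. \<gamma> r = \<gamma> s \<and> normal r = normal s"
proof -
  define r where "r = s + of_int (- \<lfloor>s / L\<rfloor>) * L"
  have "of_int \<lfloor>s / L\<rfloor> * L \<le> (s / L) * L" using L0 by (intro mult_right_mono) auto
  moreover have "(s / L) * L < (of_int \<lfloor>s / L\<rfloor> + 1) * L" using L0 by (intro mult_strict_right_mono) linarith+
  ultimately have "of_int \<lfloor>s / L\<rfloor> * L \<le> s" "s < (of_int \<lfloor>s / L\<rfloor> + 1) * L" using L0 by simp_all
  then have "r \<in> {0..<L}" by (simp add: r_def algebra_simps)
  moreover have "\<gamma> r = \<gamma> s" "normal r = normal s"
    unfolding r_def by (rule periodic_int, rule per) (rule periodic_int, rule periodic_normal)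
  ultimately show ?thesis by blast
qed

text \<open>The times at which the characteristic with label \<open>y\<close> is inside the domain.\<close>

definition fibre :: "real^2 \<Rightarrow> real \<Rightarrow> real set" where
  "fibre w y = {t. char_point w y t \<in> \<Omega>}"

definition entry :: "real^2 \<Rightarrow> real \<Rightarrow> real" where "entry w y = Inf (fibre w y)"

lemma open_fibre: "open (fibre w y)"
proof -
  have "open (char_point w y -` \<Omega>)"
    by (rule open_vimage[OF opn]) (intro continuous_intros)
  then show ?thesis by (simp add: fibre_def vimage_def)
qed

lemma fibre_interval:
  assumes w: "w \<noteq> 0" and ne: "fibre w y \<noteq> {}"
  obtains b where "entry w y < b" "fibre w y = {entry w y<..<b}"
proof -
  have "convex (fibre w y)"
  proof (rule convexI)
    fix s t u v assume *: "s \<in> fibre w y" "t \<in> fibre w y" "0 \<le> u" "0 \<le> v" "u + v = (1::real)"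
    have "u *\<^sub>R char_point w y s + v *\<^sub>R char_point w y t \<in> \<Omega>"
      using * cvx by (auto simp: fibre_def intro: convexD)
    moreover have "u *\<^sub>R char_point w y s + v *\<^sub>R char_point w y t
        = (u + v) *\<^sub>R (y *\<^sub>R perp w) + (u * s + v * t) *\<^sub>R w"
      by (simp add: char_point_def algebra_simps)
    ultimately show "u *\<^sub>R s + v *\<^sub>R t \<in> fibre w y" using *(5) by (simp add: fibre_def char_point_def)
  qed
  moreover have "bounded (fibre w y)"
  proof -
    obtain B where B: "\<And>z. z \<in> \<Omega> \<Longrightarrow> norm z \<le> B" using bdd by (auto simp: bounded_iff)
    have "\<bar>t\<bar> \<le> B * norm w / (norm w)\<^sup>2" if "t \<in> fibre w y" for t
    proof -
      have "\<bar>t\<bar> * (norm w)\<^sup>2 = \<bar>char_point w y t \<bullet> w\<bar>" by (simp add: char_point_inner abs_mult)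
      also have "\<dots> \<le> norm (char_point w y t) * norm w" by (rule Cauchy_Schwarz_ineq2)
      also have "\<dots> \<le> B * norm w" using B that by (intro mult_right_mono) (auto simp: fibre_def)
      finally show ?thesis using w by (simp add: pos_le_divide_eq)
    qed
    then show ?thesis by (auto simp: bounded_iff)
  qed
  ultimately show ?thesis
    using open_convex_bounded_real_interval[OF open_fibre] ne that unfolding entry_def by blast
qed

lemma entry_time_char_point:
  assumes w: "w \<noteq> 0" and t: "t \<in> fibre w y"
  shows "entry_time \<Omega> w (char_point w y t) = t - entry w y"
    and "entry w y < t"
proof -
  obtain b where b: "fibre w y = {entry w y<..<b}" using fibre_interval[OF w, of y] t by blast
  have "{s. 0 \<le> s \<and> char_point w y t - s *\<^sub>R w \<in> \<Omega>} = {s. 0 \<le> s \<and> t - s \<in> fibre w y}"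
    by (auto simp: fibre_def char_point_def algebra_simps)
  also have "\<dots> = {0..<t - entry w y}" using t unfolding b by auto
  finally show "entry_time \<Omega> w (char_point w y t) = t - entry w y"
    using t unfolding entry_time_def b by simp
  show "entry w y < t" using t unfolding b by simp
qed

text \<open>The label of the characteristic through the boundary point \<open>\<gamma> s\<close>.\<close>

definition crossing :: "real^2 \<Rightarrow> real \<Rightarrow> real" where
  "crossing w s = (\<gamma> s \<bullet> perp w) / (norm w)\<^sup>2"

lemma entry_point_on_curve:
  assumes w: "w \<noteq> 0" and ne: "fibre w y \<noteq> {}"
  obtains s where "s \<in> {0..<L}" "char_point w y (entry w y) = \<gamma> s" "0 < w \<bullet> normal s"
proof -
  obtain b where b: "entry w y < b" "fibre w y = {entry w y<..<b}" using fibre_interval[OF w ne] .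
  let ?Z = "char_point w y (entry w y)"
  have "?Z \<notin> \<Omega>" using b by (auto simp: fibre_def)
  moreover have "?Z \<in> closure \<Omega>"
  proof -
    have "closure (fibre w y) = {entry w y..b}" using b by simp
    then have "entry w y \<in> closure (fibre w y)" using b(1) by simp
    moreover have "char_point w y ` closure (fibre w y) \<subseteq> closure (char_point w y ` fibre w y)"
      by (intro continuous_image_closure_subset[of UNIV]) (auto intro!: continuous_intros)
    moreover have "closure (char_point w y ` fibre w y) \<subseteq> closure \<Omega>"
      by (intro closure_mono) (auto simp: fibre_def)
    ultimately show ?thesis by blast
  qed
  ultimately have "?Z \<in> frontier \<Omega>" using opn by (simp add: frontier_def interior_open)
  then obtain s0 where "?Z = \<gamma> s0" using rng by auto
  then obtain s where s: "s \<in> {0..<L}" "?Z = \<gamma> s" using reduce_parameter[of s0] by auto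
  obtain t where t: "t \<in> fibre w y" using ne by auto
  have "0 < normal s \<bullet> (char_point w y t - \<gamma> s)" by (rule normal_pos) (use t in \<open>simp add: fibre_def\<close>)
  also have "char_point w y t - \<gamma> s = (t - entry w y) *\<^sub>R w"
    by (simp add: s(2)[symmetric] char_point_def algebra_simps)
  finally have "0 < w \<bullet> normal s" using entry_time_char_point(2)[OF w t]
    by (simp add: zero_less_mult_iff inner_commute)
  then show ?thesis using that s by blast
qed

text \<open>The characteristic through \<open>\<gamma> s\<close> is inside right after \<open>\<gamma>
  s\<close>, and by convexity never before.\<close>

lemma crossing_entry:
  assumes w: "w \<noteq> 0" and s: "0 < w \<bullet> normal s"
  shows "fibre w (crossing w s) \<noteq> {}" "char_point w (crossing w s) (entry w (crossing w s)) = \<gamma> s"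
proof -
  let ?y = "crossing w s" and ?t = "(\<gamma> s \<bullet> w) / (norm w)\<^sup>2"
  have g: "\<gamma> s = char_point w ?y ?t" using char_point_surj[OF w] by (simp add: crossing_def)
  have t0: "?t \<notin> fibre w ?y" using curve_boundary(2)[of s] g by (simp add: fibre_def)
  have eq: "\<gamma> s + r *\<^sub>R w = char_point w ?y (?t + r)" for r
    using g by (simp add: char_point_def algebra_simps)
  have "\<forall>\<^sub>F r in at_right 0. ?t + r \<in> fibre w ?y"
    using enters_domain[OF s] unfolding eq by (simp add: fibre_def)
  then obtain e where e: "0 < e" "\<And>r. 0 < r \<Longrightarrow> r < e \<Longrightarrow> ?t + r \<in> fibre w ?y"
    unfolding eventually_at_right_field by auto
  then have "?t + e / 2 \<in> fibre w ?y" by simp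
  then show ne: "fibre w ?y \<noteq> {}" by blast
  obtain b where b: "entry w ?y < b" "fibre w ?y = {entry w ?y<..<b}" using fibre_interval[OF w ne] .
  have "entry w ?y \<le> ?t"
  proof (rule field_le_epsilon)
    fix d :: real assume d: "0 < d"
    then have "?t + min d (e / 2) \<in> fibre w ?y" using e by (auto simp: min_def)
    then have "entry w ?y < ?t + min d (e / 2)" using b(2) by auto
    then show "entry w ?y \<le> ?t + d" by linarith
  qed
  moreover have "?t \<le> entry w ?y"
  proof (rule ccontr)
    assume "\<not> ?t \<le> entry w ?y"
    moreover have "?t < b" using \<open>?t + e / 2 \<in> fibre w ?y\<close> b(2) e(1) by auto
    ultimately show False using t0 b(2) by auto
  qed
  ultimately show "char_point w ?y (entry w ?y) = \<gamma> s" using g by simp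
qed

definition inflow_params :: "real^2 \<Rightarrow> real set" where
  "inflow_params w = {s\<in>{0..<L}. 0 < w \<bullet> normal s}"

lemma crossing_bij:
  assumes w: "w \<noteq> 0"
  shows "inj_on (crossing w) (inflow_params w)" "crossing w ` inflow_params w = {y. fibre w y \<noteq> {}}"
proof -
  show "inj_on (crossing w) (inflow_params w)"
  proof (rule inj_onI)
    fix s t assume st: "s \<in> inflow_params w" "t \<in> inflow_params w" "crossing w s = crossing w t"
    then have "\<gamma> s = \<gamma> t" using crossing_entry(2)[OF w, of s] crossing_entry(2)[OF w, of t]
      by (simp add: inflow_params_def)
    then show "s = t" using inj st by (auto simp: inflow_params_def inj_on_def)
  qed
  show "crossing w ` inflow_params w = {y. fibre w y \<noteq> {}}"
  proof (intro equalityI subsetI)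
    fix y assume "y \<in> {y. fibre w y \<noteq> {}}"
    then obtain s where s: "s \<in> {0..<L}" "char_point w y (entry w y) = \<gamma> s" "0 < w \<bullet> normal s"
      using entry_point_on_curve[OF w] by blast
    have "crossing w s = y" using w by (simp add: crossing_def s(2)[symmetric] char_point_inner)
    then show "y \<in> crossing w ` inflow_params w" using s by (auto simp: inflow_params_def)
  qed (auto simp: inflow_params_def crossing_entry(1)[OF w])
qed

lemma continuous_normal: "continuous_on X (\<lambda>s. w \<bullet> normal s)"
  by (intro continuous_at_imp_continuous_on ballI DERIV_isCont[OF normal_component_derivative(1)])

lemma inflow_params_borel: "inflow_params w \<in> sets borel"
proof -
  have "(\<lambda>s. w \<bullet> normal s) \<in> borel_measurable borel"
    by (rule borel_measurable_continuous_onI[OF continuous_normal])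
  then show ?thesis unfolding inflow_params_def by measurable
qed

text \<open>The flux weight \<open>w \<bullet> n\<close> on the curve is the Jacobian of the map from boundary
  points to labels of characteristics.\<close>

lemma inflow_change_of_variables:
  fixes \<Psi> :: "real^2 \<Rightarrow> real"
  assumes w: "w \<noteq> 0"
    and int: "(\<lambda>s. (w \<bullet> normal s) * \<Psi> (\<gamma> s)) absolutely_integrable_on inflow_params w"
  shows "(\<lambda>y. \<Psi> (char_point w y (entry w y))) absolutely_integrable_on {y. fibre w y \<noteq> {}}"
    and "(norm w)\<^sup>2 * integral {y. fibre w y \<noteq> {}} (\<lambda>y. \<Psi> (char_point w y (entry w y)))
      = integral (inflow_params w) (\<lambda>s. (w \<bullet> normal s) * \<Psi> (\<gamma> s))"
proof -
  let ?f = "\<lambda>y. \<Psi> (char_point w y (entry w y))" and ?S = "inflow_params w"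
  let ?g' = "\<lambda>s. (\<gamma>' s \<bullet> perp w) / (norm w)\<^sup>2"
  have eq: "\<bar>?g' s\<bar> * ?f (crossing w s) = (1 / (norm w)\<^sup>2) * ((w \<bullet> normal s) * \<Psi> (\<gamma> s))" if "s \<in> ?S" for s
  proof -
    have W: "0 < w \<bullet> normal s" using that by (simp add: inflow_params_def)
    have "w \<bullet> normal s = - orientation * (\<gamma>' s \<bullet> perp w)"
      by (simp add: normal_def inner_real2 algebra_simps)
    then have "\<bar>\<gamma>' s \<bullet> perp w\<bar> = w \<bullet> normal s" using W orientation by auto
    then show ?thesis using crossing_entry(2)[OF w W] by simp
  qed
  have d: "(crossing w has_field_derivative ?g' s) (at s within ?S)" for s
    unfolding crossing_def has_field_derivative_def using w
    by (auto intro!: derivative_eq_intros has_derivative_at_withinI[OF d1[unfolded has_vector_derivative_def]] simp: field_simps)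
  have "(\<lambda>s. \<bar>?g' s\<bar> * ?f (crossing w s)) absolutely_integrable_on ?S \<longleftrightarrow>
      (\<lambda>s. (1 / (norm w)\<^sup>2) * ((w \<bullet> normal s) * \<Psi> (\<gamma> s))) absolutely_integrable_on ?S"
    by (rule set_integrable_cong[OF refl refl eq])
  then have 1: "(\<lambda>s. \<bar>?g' s\<bar> * ?f (crossing w s)) absolutely_integrable_on ?S"
    using int by simp
  have 2: "integral ?S (\<lambda>s. \<bar>?g' s\<bar> * ?f (crossing w s))
      = integral ?S (\<lambda>s. (w \<bullet> normal s) * \<Psi> (\<gamma> s)) / (norm w)\<^sup>2"
    by (subst Henstock_Kurzweil_Integration.integral_cong[OF eq]) (auto simp: divide_inverse mult.commute)
  have "?f absolutely_integrable_on (crossing w ` ?S) \<and>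
      integral (crossing w ` ?S) ?f = integral ?S (\<lambda>s. \<bar>?g' s\<bar> * ?f (crossing w s))"
    by (rule has_absolute_integral_change_of_variables_1'[THEN iffD1, OF _ d crossing_bij(1)[OF w]])
      (use 1 inflow_params_borel in auto)
  then show "?f absolutely_integrable_on {y. fibre w y \<noteq> {}}"
    "(norm w)\<^sup>2 * integral {y. fibre w y \<noteq> {}} ?f = integral ?S (\<lambda>s. (w \<bullet> normal s) * \<Psi> (\<gamma> s))"
    using w unfolding crossing_bij(2)[OF w] 2 by simp_all
qed

lemma continuous_curvature: "continuous_on X curvature"
proof -
  have "curvature s = orientation * (\<gamma>'' s \<bullet> perp (\<gamma>' s))" for s by (simp add: curvature_def normal_def)
  then have "curvature = (\<lambda>s. orientation * (\<gamma>'' s \<bullet> perp (\<gamma>' s)))" by auto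
  moreover have "continuous_on X \<gamma>''" using c2 continuous_on_subset by blast
  ultimately show ?thesis unfolding inner_real2 perp_nth by (auto intro!: continuous_intros continuous_curve)
qed

text \<open>The derivative of \<open>v \<bullet> n\<close> is \<open>- \<kappa> (v \<bullet> \<tau>)\<close>,
  with \<open>\<kappa> \<ge> 0\<close> the curvature and \<open>\<tau>\<close> the tangent. Where \<open>v
  \<bullet> n\<close> is small, \<open>v \<bullet> \<tau>\<close> is close to \<open>norm v\<close> in
  modulus. The integral over full periods of the derivative of \<open>c arctan ((v \<bullet> n) / c) (v
  \<bullet> \<tau>)\<close> vanishes; as \<open>\<kappa>\<close> has a sign, this bounds the integral of
  \<open>\<kappa> (v \<bullet> \<tau>)\<^sup>2\<close> over the band by a multiple of \<open>c\<close>. The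
  bound holds in particular near points where the curvature vanishes.\<close>

lemma grazing_band_estimate:
  assumes v: "v \<noteq> 0" and p: "p = real m * L"
  shows "\<exists>K>0. \<forall>c>0. (\<integral>\<^sup>+s\<in>{-p..p}. ennreal (if \<bar>v \<bullet> normal s\<bar> < c then \<bar>curvature s * (v \<bullet> \<gamma>' s)\<bar> else 0) \<partial>lborel)
    \<le> ennreal (K * c)"
proof -
  let ?W = "\<lambda>s. v \<bullet> normal s" and ?U = "\<lambda>s. v \<bullet> \<gamma>' s"
  define B where "B = integral {-p..p} curvature"
  have p0: "-p \<le> p" using p L0 by simp
  have ci: "curvature integrable_on {-p..p}" by (intro integrable_continuous_interval continuous_curvature)
  have B0: "0 \<le> B" unfolding B_def by (intro integral_nonneg ci curvature_nonneg)
  have nv: "0 < norm v" using v by simp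
  have cU: "continuous_on X ?U" for X by (intro continuous_intros continuous_curve)
  have Uv: "\<bar>?U s\<bar> \<le> norm v" for s using Cauchy_Schwarz_ineq2[of v "\<gamma>' s"] nrm[of s] by simp
  have Wv: "\<bar>?W s\<bar> \<le> norm v" for s using Cauchy_Schwarz_ineq2[of v "normal s"] by simp
  have "(\<integral>\<^sup>+s\<in>{-p..p}. ennreal (if \<bar>?W s\<bar> < c then \<bar>curvature s * ?U s\<bar> else 0) \<partial>lborel)
      \<le> ennreal ((8 * B + 1) * c)" if c: "0 < c" for c
  proof (cases "c \<le> norm v / 2")
    case False
    have "(\<integral>\<^sup>+s\<in>{-p..p}. ennreal (if \<bar>?W s\<bar> < c then \<bar>curvature s * ?U s\<bar> else 0) \<partial>lborel)
        \<le> (\<integral>\<^sup>+s\<in>{-p..p}. ennreal (norm v * curvature s) \<partial>lborel)"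
    proof (intro nn_integral_mono mult_right_mono ennreal_leI)
      fix s
      have "\<bar>curvature s * ?U s\<bar> \<le> norm v * curvature s"
        using Uv[of s] curvature_nonneg[of s] by (simp add: abs_mult mult.commute mult_right_mono)
      then show "(if \<bar>?W s\<bar> < c then \<bar>curvature s * ?U s\<bar> else 0) \<le> norm v * curvature s"
        using curvature_nonneg[of s] by auto
    qed auto
    also have "\<dots> = ennreal (norm v * B)"
      by (subst nn_integral_continuous_Icc)
        (auto intro!: continuous_intros continuous_curvature mult_nonneg_nonneg curvature_nonneg simp: B_def)
    also have "\<dots> \<le> ennreal ((8 * B + 1) * c)"
    proof (rule ennreal_leI)
      have "norm v * B \<le> (2 * c) * B" using False B0 by (intro mult_right_mono) auto
      also have "\<dots> \<le> (8 * B + 1) * c" using c B0 by (simp add: algebra_simps)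
      finally show "norm v * B \<le> (8 * B + 1) * c" .
    qed
    finally show ?thesis .
  next
    case True
    (* The derivative of the test function c * arctan (W / c) * U is H - G. *)
    let ?G = "\<lambda>s. curvature s * (?U s)\<^sup>2 / (1 + (?W s / c)\<^sup>2)"
    let ?H = "\<lambda>s. c * arctan (?W s / c) * (curvature s * ?W s)"
    have pos: "0 < 1 + (?W s / c)\<^sup>2" for s by (smt (verit) zero_le_power2)
    have cG: "continuous_on X ?G" for X
    proof (rule continuous_on_divide)
      show "continuous_on X (\<lambda>s. curvature s * (?U s)\<^sup>2)"
        by (intro continuous_on_mult continuous_curvature continuous_on_power cU)
      show "continuous_on X (\<lambda>s. 1 + (?W s / c)\<^sup>2)"
        by (intro continuous_on_add continuous_on_const continuous_on_power continuous_on_divide continuous_normal)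
          (use c in auto)
      show "\<forall>s\<in>X. 1 + (?W s / c)\<^sup>2 \<noteq> 0" using pos by (metis less_irrefl)
    qed
    have cH: "continuous_on X ?H" for X
      by (intro continuous_on_mult continuous_on_arctan continuous_on_const continuous_on_divide
          continuous_curvature continuous_normal) (use c in auto)
    have der: "((\<lambda>s. c * arctan (?W s / c) * ?U s) has_real_derivative (?H s - ?G s)) (at s)" for s
    proof -
      have "((\<lambda>s. c * arctan (?W s / c) * ?U s) has_real_derivative
          (c * ((- curvature s * ?U s / c) * inverse (1 + (?W s / c)\<^sup>2)) * ?U s + (curvature s * ?W s) * (c * arctan (?W s / c)))) (at s)"
        by (rule derivative_eq_intros normal_component_derivative refl | use c in simp)+
      moreover have "c * ((- curvature s * ?U s / c) * inverse (1 + (?W s / c)\<^sup>2)) * ?U s = - ?G s"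
        using c by (simp add: power2_eq_square divide_inverse)
      ultimately show ?thesis by (simp add: mult.commute)
    qed
    have "((\<lambda>s. ?H s - ?G s) has_integral (c * arctan (?W p / c) * ?U p - c * arctan (?W (-p) / c) * ?U (-p))) {-p..p}"
      by (rule fundamental_theorem_of_calculus[OF p0])
        (use der has_field_derivative_at_within has_real_derivative_iff_has_vector_derivative in blast)
    moreover have "normal p = normal 0" "normal (- p) = normal 0" "\<gamma>' p = \<gamma>' 0" "\<gamma>' (-p) = \<gamma>' 0"
      using periodic_int[of normal, OF periodic_normal, of 0 "int m"] periodic_int[of normal, OF periodic_normal, of 0 "- int m"]
        periodic_int[of \<gamma>', OF periodic_tangent, of 0 "int m"] periodic_int[of \<gamma>', OF periodic_tangent, of 0 "- int m"] p by simp_all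
    ultimately have "((\<lambda>s. ?H s - ?G s) has_integral 0) {-p..p}" by simp
    then have "integral {-p..p} ?G = integral {-p..p} ?H"
      using Henstock_Kurzweil_Integration.integral_diff[of ?H "{-p..p}" ?G] integrable_continuous_interval[OF cH] integrable_continuous_interval[OF cG]
      by (simp add: integral_unique)
    also have "\<dots> \<le> integral {-p..p} (\<lambda>s. (2 * norm v * c) * curvature s)"
    proof (rule integral_le)
      show "?H integrable_on {-p..p}" by (intro integrable_continuous_interval cH)
      show "(\<lambda>s. (2 * norm v * c) * curvature s) integrable_on {-p..p}" using ci by (rule integrable_on_mult_right)
      fix s
      have "\<bar>arctan (?W s / c)\<bar> \<le> 2" using arctan_bounded[of "?W s / c"] pi_less_4 by linarith
      then have "\<bar>arctan (?W s / c)\<bar> * \<bar>?W s\<bar> \<le> 2 * norm v" using Wv[of s] by (intro mult_mono) auto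
      then have "c * curvature s * (arctan (?W s / c) * ?W s) \<le> c * curvature s * (2 * norm v)"
        using c curvature_nonneg[of s] by (intro mult_left_mono) (auto simp: abs_mult[symmetric])
      then show "?H s \<le> (2 * norm v * c) * curvature s" by (simp add: mult_ac)
    qed
    also have "\<dots> = 2 * norm v * c * B" by (simp add: B_def)
    finally have GB: "integral {-p..p} ?G \<le> 2 * norm v * c * B" .
    have G0: "0 \<le> ?G s" for s
      using curvature_nonneg[of s] pos[of s] by (intro divide_nonneg_pos mult_nonneg_nonneg) auto
    have "(\<integral>\<^sup>+s\<in>{-p..p}. ennreal (if \<bar>?W s\<bar> < c then \<bar>curvature s * ?U s\<bar> else 0) \<partial>lborel)
        \<le> (\<integral>\<^sup>+s\<in>{-p..p}. ennreal ((4 / norm v) * ?G s) \<partial>lborel)"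
    proof (intro nn_integral_mono mult_right_mono ennreal_leI)
      fix s
      show "(if \<bar>?W s\<bar> < c then \<bar>curvature s * ?U s\<bar> else 0) \<le> (4 / norm v) * ?G s"
      proof (cases "\<bar>?W s\<bar> < c")
        case W: True
        have "\<bar>?W s\<bar> \<le> norm v / 2" using W True by linarith
        then have "(?W s)\<^sup>2 \<le> (norm v / 2)\<^sup>2" by (rule power2_le_iff_abs_le[THEN iffD2, rotated]) (use nv in auto)
        then have "(?W s)\<^sup>2 * 4 \<le> (norm v)\<^sup>2" by (simp add: power_divide)
        then have "(norm v)\<^sup>2 \<le> (?U s)\<^sup>2 * 4"
          using normal_tangent_pythagoras[of v s] zero_le_power2[of "norm v"] by linarith
        then have "(norm v / 2)\<^sup>2 \<le> \<bar>?U s\<bar>\<^sup>2" by (simp add: power_divide)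
        then have "norm v / 2 \<le> \<bar>?U s\<bar>" by (rule power2_le_imp_le) auto
        then have "\<bar>?U s\<bar> * (norm v / 2) \<le> (?U s)\<^sup>2" by (metis abs_ge_zero mult_left_mono power2_abs power2_eq_square)
        then have a: "\<bar>?U s\<bar> \<le> (2 / norm v) * (?U s)\<^sup>2" using nv by (simp add: field_simps)
        have "(?W s / c)\<^sup>2 \<le> 1" using W c by (simp add: power2_le_iff_abs_le abs_divide abs_square_le_1)
        then have "(?U s)\<^sup>2 / 2 \<le> (?U s)\<^sup>2 / (1 + (?W s / c)\<^sup>2)"
          using pos[of s] by (intro divide_left_mono) auto
        note le = this
        note a
        also have "(2 / norm v) * (?U s)\<^sup>2 = (4 / norm v) * ((?U s)\<^sup>2 / 2)" by simp
        also have "\<dots> \<le> (4 / norm v) * ((?U s)\<^sup>2 / (1 + (?W s / c)\<^sup>2))"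
          by (rule mult_left_mono[OF le]) (use nv in auto)
        finally have "\<bar>?U s\<bar> \<le> (4 / norm v) * ((?U s)\<^sup>2 / (1 + (?W s / c)\<^sup>2))" .
        then have "curvature s * \<bar>?U s\<bar> \<le> curvature s * ((4 / norm v) * ((?U s)\<^sup>2 / (1 + (?W s / c)\<^sup>2)))"
          using curvature_nonneg[of s] by (intro mult_left_mono) auto
        also have "\<dots> = (4 / norm v) * ?G s" by simp
        finally show ?thesis using W curvature_nonneg[of s] by (simp only: abs_mult if_True abs_of_nonneg)
      next
        case False
        have "0 \<le> (4 / norm v) * ?G s" using nv by (intro mult_nonneg_nonneg G0) simp
        then show ?thesis using False by (simp only: if_False)
      qed
    qed auto
    also have "\<dots> = ennreal ((4 / norm v) * integral {-p..p} ?G)"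
    proof -
      have "(\<integral>\<^sup>+s\<in>{-p..p}. ennreal ((4 / norm v) * ?G s) \<partial>lborel)
          = ennreal (integral {-p..p} (\<lambda>s. (4 / norm v) * ?G s))"
      proof (rule nn_integral_continuous_Icc)
        show "continuous_on {-p..p} (\<lambda>s. (4 / norm v) * ?G s)" by (rule continuous_on_mult[OF continuous_on_const cG])
        show "0 \<le> (4 / norm v) * ?G s" for s using G0[of s] nv by (intro mult_nonneg_nonneg) auto
      qed
      then show ?thesis by (simp only: integral_mult_right)
    qed
    also have "\<dots> \<le> ennreal ((8 * B + 1) * c)"
    proof (rule ennreal_leI)
      have "(4 / norm v) * integral {-p..p} ?G \<le> (4 / norm v) * (2 * norm v * c * B)"
        using GB nv by (intro mult_left_mono) auto
      also have "\<dots> = 8 * B * c" using nv by simp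
      finally show "(4 / norm v) * integral {-p..p} ?G \<le> (8 * B + 1) * c" using c by (simp add: algebra_simps)
    qed
    finally show ?thesis .
  qed
  then show ?thesis using B0 by (intro exI[of _ "8 * B + 1"]) auto
qed
end

section \<open>The mollified boundary data\<close>

text \<open>If \<open>W r\<close> is below \<open>d\<close>, then \<open>W\<close> stays in a band of width
  proportional to \<open>d\<close> on the whole interval, because it is Lipschitz.\<close>

lemma increment_le_band_integral:
  fixes W W' :: "real \<Rightarrow> real"
  assumes der: "\<And>s. (W has_real_derivative W' s) (at s)" and cont: "continuous_on UNIV W'"
    and C: "\<And>s. \<bar>W' s\<bar> \<le> C" and d: "0 < d" and r: "\<bar>W r\<bar> < d" and h: "\<bar>h\<bar> \<le> d"
  shows "ennreal \<bar>W (r + h) - W r\<bar>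
    \<le> (\<integral>\<^sup>+\<tau>\<in>{-d..d}. ennreal (if \<bar>W (r + \<tau>)\<bar> < (1 + C) * d then \<bar>W' (r + \<tau>)\<bar> else 0) \<partial>lborel)"
proof -
  have C0: "0 \<le> C" using C[of 0] by linarith
  have der': "((\<lambda>\<tau>. W (r + \<tau>)) has_real_derivative W' (r + \<tau>)) (at \<tau>)" for \<tau>
    using der[of "\<tau> + r"] unfolding DERIV_shift by (simp add: add.commute)
  have c': "continuous_on X (\<lambda>\<tau>. W' (r + \<tau>))" for X
    by (rule continuous_on_compose2[OF cont]) (auto intro!: continuous_intros)
  have lip: "\<bar>W (r + \<tau>) - W r\<bar> \<le> C * d" if "\<bar>\<tau>\<bar> \<le> d" for \<tau>
  proof -
    have "norm (W (r + \<tau>) - W (r + 0)) \<le> C * norm (\<tau> - 0)"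
      by (rule field_differentiable_bound[of UNIV "\<lambda>\<tau>. W (r + \<tau>)" "\<lambda>\<tau>. W' (r + \<tau>)"]) (use der' C in auto)
    also have "\<dots> \<le> C * d" using that C0 by (intro mult_left_mono) auto
    finally show ?thesis by simp
  qed
  (* The segment from r to r + h is part of the interval of length 2 d around r. *)
  have "\<bar>W (r + h) - W r\<bar> \<le> integral {-d..d} (\<lambda>\<tau>. \<bar>W' (r + \<tau>)\<bar>)"
  proof -
    have *: "\<bar>W (r + b) - W (r + a)\<bar> \<le> integral {-d..d} (\<lambda>\<tau>. \<bar>W' (r + \<tau>)\<bar>)"
      if "a \<le> b" "-d \<le> a" "b \<le> d" for a b
    proof -
      have "((\<lambda>\<tau>. W' (r + \<tau>)) has_integral W (r + b) - W (r + a)) {a..b}"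
        by (rule fundamental_theorem_of_calculus[OF that(1)])
          (use der' has_field_derivative_at_within has_real_derivative_iff_has_vector_derivative in blast)
      then have "\<bar>W (r + b) - W (r + a)\<bar> = \<bar>integral {a..b} (\<lambda>\<tau>. W' (r + \<tau>))\<bar>" by (simp add: integral_unique)
      also have "\<dots> \<le> integral {a..b} (\<lambda>\<tau>. \<bar>W' (r + \<tau>)\<bar>)"
        unfolding real_norm_def[symmetric]
          by (rule Henstock_Kurzweil_Integration.integral_norm_bound_integral)
          (auto intro!: integrable_continuous_interval c' continuous_on_rabs)
      also have "\<dots> \<le> integral {-d..d} (\<lambda>\<tau>. \<bar>W' (r + \<tau>)\<bar>)"
        by (rule integral_subset_le) (use that in \<open>auto intro!: integrable_continuous_interval c' continuous_on_rabs\<close>)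
      finally show ?thesis .
    qed
    show ?thesis using *[of 0 h] *[of h 0] h d by (cases "0 \<le> h") (auto simp: abs_minus_commute)
  qed
  then have "ennreal \<bar>W (r + h) - W r\<bar> \<le> ennreal (integral {-d..d} (\<lambda>\<tau>. \<bar>W' (r + \<tau>)\<bar>))" by (rule ennreal_leI)
  also have "\<dots> = (\<integral>\<^sup>+\<tau>\<in>{-d..d}. ennreal \<bar>W' (r + \<tau>)\<bar> \<partial>lborel)"
    by (rule nn_integral_continuous_Icc[symmetric]) (auto intro!: c' continuous_on_rabs)
  also have "\<dots> = (\<integral>\<^sup>+\<tau>\<in>{-d..d}. ennreal (if \<bar>W (r + \<tau>)\<bar> < (1 + C) * d then \<bar>W' (r + \<tau>)\<bar> else 0) \<partial>lborel)"
  proof (rule nn_integral_cong)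
    fix \<tau>
    have "\<bar>W (r + \<tau>)\<bar> < (1 + C) * d" if "\<tau> \<in> {-d..d}"
      using lip[of \<tau>] r that by (simp add: algebra_simps abs_le_iff) linarith
    then show "ennreal \<bar>W' (r + \<tau>)\<bar> * indicator {-d..d} \<tau>
        = ennreal (if \<bar>W (r + \<tau>)\<bar> < (1 + C) * d then \<bar>W' (r + \<tau>)\<bar> else 0) * indicator {-d..d} \<tau>"
      by (auto split: split_indicator)
  qed
  finally show ?thesis .
qed

text \<open>The shift by \<open>h\<close> costs a constant factor where \<open>W \<ge> 1/k\<close>. Elsewhere
  the increment of \<open>W\<close> is bounded by an integral over the band, which contributes a term of order
  \<open>1/k\<^sup>2\<close> in the mean; it is multiplied by \<open>q\<close>, which is of order
  \<open>k\<^sup>2\<close>.\<close>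

lemma shifted_weight_bound:
  fixes W W' q :: "real \<Rightarrow> real"
  assumes der: "\<And>s. (W has_real_derivative W' s) (at s)" and cont: "continuous_on UNIV W'"
    and C: "\<And>s. \<bar>W' s\<bar> \<le> C" and p: "L + 2 \<le> p" "0 < L"
    and band: "\<And>c. 0 < c \<Longrightarrow> (\<integral>\<^sup>+s\<in>{-p..p}. ennreal (if \<bar>W s\<bar> < c then \<bar>W' s\<bar> else 0) \<partial>lborel) \<le> ennreal (K * c)"
    and K: "0 < K" and k: "1 \<le> k"
    and q[measurable]: "q \<in> borel_measurable borel" and q0: "\<And>s. 0 \<le> q s" "\<And>s. q s \<le> 2 * (real k)\<^sup>2"
    and qW: "\<And>s. W s \<le> 0 \<Longrightarrow> q s = 0"
    and A: "(\<integral>\<^sup>+s\<in>{-p..p}. ennreal (max (W s) 0 * q s) \<partial>lborel) \<le> ennreal A" "0 \<le> A"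
    and h: "\<bar>h\<bar> \<le> 1 / real k"
  shows "(\<integral>\<^sup>+s\<in>{0..L}. ennreal (max (W s) 0 * q (s - h)) \<partial>lborel) \<le> ennreal ((1 + C) * A + 4 * K * (1 + C))"
proof -
  have C0: "0 \<le> C" using C[of 0] by linarith
  define d where "d = 1 / real k"
  have d: "0 < d" "d \<le> 1" "\<bar>h\<bar> \<le> d" using k h by (auto simp: d_def)
  have kd: "(real k)\<^sup>2 * (d * d) = 1" using k by (simp add: d_def power2_eq_square)
  have cW: "continuous_on UNIV W" by (intro continuous_at_imp_continuous_on ballI DERIV_isCont[OF der])
  have Wm[measurable]: "W \<in> borel_measurable borel" by (rule borel_measurable_continuous_onI[OF cW])
  have W'm[measurable]: "W' \<in> borel_measurable borel" by (rule borel_measurable_continuous_onI[OF cont])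
  define B where "B s = ennreal (if \<bar>W s\<bar> < (1 + C) * d then \<bar>W' s\<bar> else 0)" for s
  have Bm[measurable]: "B \<in> borel_measurable borel" unfolding B_def by measurable
  (* Shifts of this interval by at most 1 stay inside the interval of the band estimate. *)
  define I where "I = {1 - p..p - 1}"
  have pw: "ennreal (max (W (r + h)) 0 * q r) \<le> ennreal (1 + C) * ennreal (max (W r) 0 * q r)
      + ennreal (2 * (real k)\<^sup>2) * (\<integral>\<^sup>+\<tau>\<in>{-d..d}. B (r + \<tau>) \<partial>lborel)" for r
  proof (cases "W r \<le> 0")
    case True
    then show ?thesis using qW by simp
  next
    case W: False
    show ?thesis
    proof (cases "d \<le> W r")
      case True
      have "norm (W (r + h) - W r) \<le> C * norm (r + h - r)"
        by (rule field_differentiable_bound[of UNIV W W']) (use der C in auto)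
      also have "\<dots> \<le> C * d" using d C0 by (intro mult_left_mono) auto
      also have "\<dots> \<le> C * W r" using True C0 by (intro mult_left_mono) auto
      finally have "max (W (r + h)) 0 \<le> (1 + C) * max (W r) 0"
        using W C0 by (auto simp: algebra_simps abs_le_iff)
      then have "max (W (r + h)) 0 * q r \<le> (1 + C) * (max (W r) 0 * q r)"
        unfolding mult.assoc[symmetric] by (rule mult_right_mono[OF _ q0(1)])
      then have "ennreal (max (W (r + h)) 0 * q r) \<le> ennreal ((1 + C) * (max (W r) 0 * q r))"
        by (rule ennreal_leI)
      also have "\<dots> = ennreal (1 + C) * ennreal (max (W r) 0 * q r)"
        by (rule ennreal_mult) (use C0 q0 in auto)
      finally show ?thesis by (rule order_trans) simp
    next
      case False
      have "max (W (r + h)) 0 \<le> max (W r) 0 + \<bar>W (r + h) - W r\<bar>" by linarith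
      then have "max (W (r + h)) 0 * q r \<le> (max (W r) 0 + \<bar>W (r + h) - W r\<bar>) * q r"
        by (rule mult_right_mono[OF _ q0(1)])
      also have "\<dots> \<le> (1 + C) * (max (W r) 0 * q r) + 2 * (real k)\<^sup>2 * \<bar>W (r + h) - W r\<bar>"
      proof -
        have "\<bar>W (r + h) - W r\<bar> * q r \<le> \<bar>W (r + h) - W r\<bar> * (2 * (real k)\<^sup>2)"
          by (rule mult_left_mono[OF q0(2)]) auto
        moreover have "0 \<le> C * (max (W r) 0 * q r)" using C0 q0(1)[of r] by simp
        ultimately show ?thesis by (simp add: algebra_simps)
      qed
      finally have "ennreal (max (W (r + h)) 0 * q r)
          \<le> ennreal ((1 + C) * (max (W r) 0 * q r) + 2 * (real k)\<^sup>2 * \<bar>W (r + h) - W r\<bar>)" by (rule ennreal_leI)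
      also have "\<dots> = ennreal (1 + C) * ennreal (max (W r) 0 * q r) + ennreal (2 * (real k)\<^sup>2) * ennreal \<bar>W (r + h) - W r\<bar>"
        using C0 q0(1)[of r] by (subst ennreal_plus) (auto simp: ennreal_mult)
      also have "\<dots> \<le> ennreal (1 + C) * ennreal (max (W r) 0 * q r)
          + ennreal (2 * (real k)\<^sup>2) * (\<integral>\<^sup>+\<tau>\<in>{-d..d}. B (r + \<tau>) \<partial>lborel)"
        unfolding B_def by (intro add_left_mono mult_left_mono increment_le_band_integral[OF der cont C d(1) _ d(3)])
          (use W False in auto)
      finally show ?thesis .
    qed
  qed
  have "(\<integral>\<^sup>+s\<in>{0..L}. ennreal (max (W s) 0 * q (s - h)) \<partial>lborel)
      = (\<integral>\<^sup>+r. ennreal (max (W (h + r)) 0 * q r) * indicator {0..L} (h + r) \<partial>lborel)"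
    by (subst nn_integral_real_affine[of _ 1 h]) (auto simp: one_ennreal_def[symmetric])
  also have "\<dots> \<le> (\<integral>\<^sup>+r. ennreal (max (W (r + h)) 0 * q r) * indicator I r \<partial>lborel)"
    by (intro nn_integral_mono) (use d p in \<open>auto simp: I_def add.commute split: split_indicator\<close>)
  also have "\<dots> \<le> (\<integral>\<^sup>+r. (ennreal (1 + C) * ennreal (max (W r) 0 * q r)
      + ennreal (2 * (real k)\<^sup>2) * (\<integral>\<^sup>+\<tau>\<in>{-d..d}. B (r + \<tau>) \<partial>lborel)) * indicator I r \<partial>lborel)"
    by (intro nn_integral_mono mult_right_mono pw) auto
  also have "\<dots> = ennreal (1 + C) * (\<integral>\<^sup>+r. ennreal (max (W r) 0 * q r) * indicator I r \<partial>lborel)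
      + ennreal (2 * (real k)\<^sup>2) * (\<integral>\<^sup>+r. \<integral>\<^sup>+\<tau>. B (r + \<tau>) * indicator {-d..d} \<tau> * indicator I r \<partial>lborel \<partial>lborel)"
  proof -
    let ?Y = "\<lambda>r. \<integral>\<^sup>+\<tau>\<in>{-d..d}. B (r + \<tau>) \<partial>lborel"
    have [measurable]: "I \<in> sets borel" by (simp add: I_def)
    have [measurable]: "?Y \<in> borel_measurable borel" by measurable
    have "(\<integral>\<^sup>+r. (ennreal (1 + C) * ennreal (max (W r) 0 * q r) + ennreal (2 * (real k)\<^sup>2) * ?Y r) * indicator I r \<partial>lborel)
        = (\<integral>\<^sup>+r. ennreal (1 + C) * (ennreal (max (W r) 0 * q r) * indicator I r)
            + ennreal (2 * (real k)\<^sup>2) * (?Y r * indicator I r) \<partial>lborel)"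
      by (simp only: distrib_right mult.assoc)
    also have "\<dots> = (\<integral>\<^sup>+r. ennreal (1 + C) * (ennreal (max (W r) 0 * q r) * indicator I r) \<partial>lborel)
        + (\<integral>\<^sup>+r. ennreal (2 * (real k)\<^sup>2) * (?Y r * indicator I r) \<partial>lborel)"
      by (rule nn_integral_add) measurable
    also have "\<dots> = ennreal (1 + C) * (\<integral>\<^sup>+r. ennreal (max (W r) 0 * q r) * indicator I r \<partial>lborel)
        + ennreal (2 * (real k)\<^sup>2) * (\<integral>\<^sup>+r. ?Y r * indicator I r \<partial>lborel)"
      by (intro arg_cong2[where f = "(+)"] nn_integral_cmult) measurable
    also have "(\<integral>\<^sup>+r. ?Y r * indicator I r \<partial>lborel)
        = (\<integral>\<^sup>+r. \<integral>\<^sup>+\<tau>. B (r + \<tau>) * indicator {-d..d} \<tau> * indicator I r \<partial>lborel \<partial>lborel)"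
      by (intro nn_integral_cong nn_integral_multc[symmetric]) measurable
    finally show ?thesis .
  qed
  also have "(\<integral>\<^sup>+r. \<integral>\<^sup>+\<tau>. B (r + \<tau>) * indicator {-d..d} \<tau> * indicator I r \<partial>lborel \<partial>lborel)
      = (\<integral>\<^sup>+\<tau>. \<integral>\<^sup>+r. B (r + \<tau>) * indicator {-d..d} \<tau> * indicator I r \<partial>lborel \<partial>lborel)"
    by (rule lborel_pair.Fubini'[symmetric]) (simp add: I_def, measurable)
  also have "\<dots> \<le> (\<integral>\<^sup>+\<tau>. ennreal (K * ((1 + C) * d)) * indicator {-d..d} \<tau> \<partial>lborel)"
  proof (intro nn_integral_mono)
    fix \<tau>
    show "(\<integral>\<^sup>+r. B (r + \<tau>) * indicator {-d..d} \<tau> * indicator I r \<partial>lborel)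
        \<le> ennreal (K * ((1 + C) * d)) * indicator {-d..d} \<tau>"
    proof (cases "\<tau> \<in> {-d..d}")
      case True
      have "(\<integral>\<^sup>+r. B (r + \<tau>) * indicator {-d..d} \<tau> * indicator I r \<partial>lborel)
          \<le> (\<integral>\<^sup>+r. B (\<tau> + 1 * r) * indicator {-p..p} (\<tau> + 1 * r) \<partial>lborel)"
        by (intro nn_integral_mono) (use True d in \<open>auto simp: I_def add.commute split: split_indicator\<close>)
      also have "\<dots> = (\<integral>\<^sup>+s. B s * indicator {-p..p} s \<partial>lborel)"
        by (subst nn_integral_real_affine[of "\<lambda>s. B s * indicator {-p..p} s" 1 \<tau>])
          (auto simp: one_ennreal_def[symmetric])
      also have "\<dots> \<le> ennreal (K * ((1 + C) * d))"
        unfolding B_def by (rule band) (use d C0 in auto)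
      finally show ?thesis using True by simp
    qed simp
  qed
  also have "\<dots> = ennreal (K * ((1 + C) * d)) * ennreal (2 * d)"
    using d by (simp add: nn_integral_cmult emeasure_lborel_Icc_eq)
  also have "\<dots> = ennreal (2 * K * (1 + C) * (d * d))"
    using d C0 K by (subst ennreal_mult[symmetric]) (auto simp: mult_ac)
  also have "ennreal (2 * (real k)\<^sup>2) * \<dots> = ennreal (4 * K * (1 + C) * ((real k)\<^sup>2 * (d * d)))"
    using d C0 K by (subst ennreal_mult[symmetric]) (auto simp: mult_ac)
  also have "\<dots> = ennreal (4 * K * (1 + C))" unfolding kd by simp
  also have "ennreal (1 + C) * (\<integral>\<^sup>+r. ennreal (max (W r) 0 * q r) * indicator I r \<partial>lborel) + ennreal (4 * K * (1 + C))
      \<le> ennreal (1 + C) * ennreal A + ennreal (4 * K * (1 + C))"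
  proof (intro add_right_mono mult_left_mono)
    have "(\<integral>\<^sup>+r. ennreal (max (W r) 0 * q r) * indicator I r \<partial>lborel)
        \<le> (\<integral>\<^sup>+s\<in>{-p..p}. ennreal (max (W s) 0 * q s) \<partial>lborel)"
      by (intro nn_integral_mono) (auto simp: I_def split: split_indicator)
    then show "(\<integral>\<^sup>+r. ennreal (max (W r) 0 * q r) * indicator I r \<partial>lborel) \<le> ennreal A" using A(1) by simp
  qed auto
  also have "\<dots> = ennreal ((1 + C) * A + 4 * K * (1 + C))"
    using C0 A(2) K by (simp add: ennreal_mult ennreal_plus)
  finally show ?thesis by (simp add: add_left_mono mult_left_mono)
qed

text \<open>An elementary replacement for the inequality of Jensen for \<open>x ln (1 + x)\<close>, at the
  price of a linear term.\<close>

lemma ln_young: "0 \<le> a \<Longrightarrow> 0 \<le> b \<Longrightarrow> a * ln (1 + b) \<le> a * ln (1 + a) + (b::real)"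
proof -
  assume ab: "0 \<le> a" "0 \<le> b"
  have "ln ((1 + b) / (1 + a)) \<le> (1 + b) / (1 + a) - 1" using ab by (intro ln_le_minus_one) auto
  then have "ln (1 + b) - ln (1 + a) \<le> (b - a) / (1 + a)" using ab by (simp add: ln_div field_simps)
  then have "a * (ln (1 + b) - ln (1 + a)) \<le> a * ((b - a) / (1 + a))" using ab(1) by (rule mult_left_mono)
  also have "\<dots> \<le> b"
  proof -
    have "a * (b - a) \<le> b * (1 + a)" using ab by (simp add: algebra_simps)
    then show ?thesis using ab by (simp add: field_simps)
  qed
  finally show ?thesis by (simp add: algebra_simps)
qed

text \<open>Integration of \<open>ln_young\<close> with \<open>a = g (s - y)\<close> and \<open>b\<close> the
  convolution, against \<open>\<mu>\<close>.\<close>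

lemma convolution_entropy_bound:
  fixes g \<mu> :: "real \<Rightarrow> real"
  assumes g[measurable]: "g \<in> borel_measurable borel" and g0: "\<And>x. 0 \<le> g x" "\<And>x. g x \<le> B"
    and \<mu>: "mollifier r \<mu>"
  shows "0 \<le> convolution g \<mu> s" "convolution g \<mu> s \<le> B"
    "ennreal (convolution g \<mu> s * (1 + ln (1 + convolution g \<mu> s)))
      \<le> (\<integral>\<^sup>+y. ennreal (g (s - y) * (2 + ln (1 + g (s - y)))) * ennreal (\<mu> y) \<partial>lborel)"
    "convolution g \<mu> \<in> borel_measurable borel"
proof -
  have \<mu>i: "integrable lborel \<mu>" and \<mu>0: "\<And>x. 0 \<le> \<mu> x" and \<mu>1: "(LINT x|lborel. \<mu> x) = 1"
    using \<mu> by (auto simp: mollifier_def)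
  have [measurable]: "\<mu> \<in> borel_measurable borel" using \<mu>i by auto
  have bi: "integrable lborel (\<lambda>y. f (g (s - y)) * \<mu> y)"
    if f: "f \<in> borel_measurable borel" "\<And>x. 0 \<le> x \<Longrightarrow> x \<le> B \<Longrightarrow> \<bar>f x\<bar> \<le> D" for f :: "real \<Rightarrow> real" and D
  proof (rule Bochner_Integration.integrable_bound)
    show "integrable lborel (\<lambda>y. D * \<mu> y)" using \<mu>i by simp
    have [measurable]: "f \<in> borel_measurable borel" by (rule f)
    show "(\<lambda>y. f (g (s - y)) * \<mu> y) \<in> borel_measurable lborel" by measurable
    show "AE y in lborel. norm (f (g (s - y)) * \<mu> y) \<le> norm (D * \<mu> y)"
    proof (rule AE_I2)
      fix y
      have "\<bar>f (g (s - y))\<bar> \<le> \<bar>D\<bar>" using f(2)[OF g0] by (rule order_trans) simp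
      then show "norm (f (g (s - y)) * \<mu> y) \<le> norm (D * \<mu> y)" by (simp add: abs_mult mult_right_mono)
    qed
  qed
  have B0: "0 \<le> B" using g0[of 0] by linarith
  have gi: "integrable lborel (\<lambda>y. g (s - y) * \<mu> y)" using bi[of "\<lambda>x. x" B] by simp
  let ?b = "convolution g \<mu> s"
  show b0: "0 \<le> ?b" unfolding convolution_def by (intro Bochner_Integration.integral_nonneg) (auto simp: g0 \<mu>0)
  have "?b \<le> (LINT y|lborel. B * \<mu> y)"
    unfolding convolution_def by (rule integral_mono[OF gi]) (use \<mu>i g0 \<mu>0 in \<open>auto intro: mult_right_mono\<close>)
  then show "?b \<le> B" using \<mu>1 by simp
  have lnB: "\<bar>ln (1 + x)\<bar> \<le> B" if "0 \<le> x" "x \<le> B" for x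
    using that ln_add_one_self_le_self[of x] ln_ge_zero[of "1 + x"] by linarith
  have li: "integrable lborel (\<lambda>y. g (s - y) * ln (1 + g (s - y)) * \<mu> y)"
  proof (rule bi[of "\<lambda>x. x * ln (1 + x)" "B * B"])
    fix x assume x: "0 \<le> x" "x \<le> B"
    then show "\<bar>x * ln (1 + x)\<bar> \<le> B * B" unfolding abs_mult using lnB[OF x] by (intro mult_mono) auto
  qed measurable
  have "?b * ln (1 + ?b) = (LINT y|lborel. (g (s - y) * \<mu> y) * ln (1 + ?b))"
    unfolding convolution_def using gi by simp
  also have "\<dots> \<le> (LINT y|lborel. g (s - y) * ln (1 + g (s - y)) * \<mu> y + ?b * \<mu> y)"
  proof (rule integral_mono)
    fix y
    have "(g (s - y) * ln (1 + ?b)) * \<mu> y \<le> (g (s - y) * ln (1 + g (s - y)) + ?b) * \<mu> y"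
      by (rule mult_right_mono[OF ln_young[OF g0(1) b0] \<mu>0])
    then show "(g (s - y) * \<mu> y) * ln (1 + ?b) \<le> g (s - y) * ln (1 + g (s - y)) * \<mu> y + ?b * \<mu> y"
      by (simp add: algebra_simps)
  qed (use gi li \<mu>i in auto)
  also have "\<dots> = (LINT y|lborel. g (s - y) * ln (1 + g (s - y)) * \<mu> y) + ?b"
    using li \<mu>i \<mu>1 by simp
  finally have "?b * (1 + ln (1 + ?b)) \<le> (LINT y|lborel. g (s - y) * ln (1 + g (s - y)) * \<mu> y) + 2 * ?b"
    by (simp add: algebra_simps)
  also have "\<dots> = (LINT y|lborel. g (s - y) * (2 + ln (1 + g (s - y))) * \<mu> y)"
  proof -
    have "(\<lambda>y. g (s - y) * (2 + ln (1 + g (s - y))) * \<mu> y)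
        = (\<lambda>y. g (s - y) * ln (1 + g (s - y)) * \<mu> y + 2 * (g (s - y) * \<mu> y))"
      by (simp add: algebra_simps)
    then show ?thesis unfolding convolution_def using gi li by simp
  qed
  finally have "ennreal (?b * (1 + ln (1 + ?b))) \<le> ennreal (LINT y|lborel. g (s - y) * (2 + ln (1 + g (s - y))) * \<mu> y)"
    by (rule ennreal_leI)
  also have "\<dots> = (\<integral>\<^sup>+y. ennreal (g (s - y) * (2 + ln (1 + g (s - y))) * \<mu> y) \<partial>lborel)"
  proof (rule nn_integral_eq_integral[symmetric])
    have "integrable lborel (\<lambda>y. 2 * (g (s - y) * \<mu> y) + g (s - y) * ln (1 + g (s - y)) * \<mu> y)" using gi li by simp
    then show "integrable lborel (\<lambda>y. g (s - y) * (2 + ln (1 + g (s - y))) * \<mu> y)"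
      by (simp add: algebra_simps)
    show "AE y in lborel. 0 \<le> g (s - y) * (2 + ln (1 + g (s - y))) * \<mu> y"
      by (intro AE_I2 mult_nonneg_nonneg add_nonneg_nonneg ln_ge_zero) (auto simp: g0 \<mu>0)
  qed
  also have "\<dots> = (\<integral>\<^sup>+y. ennreal (g (s - y) * (2 + ln (1 + g (s - y)))) * ennreal (\<mu> y) \<partial>lborel)"
    by (intro nn_integral_cong ennreal_mult'') (auto simp: \<mu>0)
  finally show "ennreal (?b * (1 + ln (1 + ?b)))
      \<le> (\<integral>\<^sup>+y. ennreal (g (s - y) * (2 + ln (1 + g (s - y)))) * ennreal (\<mu> y) \<partial>lborel)" .
  show "convolution g \<mu> \<in> borel_measurable borel"
    unfolding convolution_def by measurable
qed

context convex_curve begin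

lemma inflow_boundary_curve: "\<gamma> s \<in> inflow_boundary \<Omega> \<gamma> w \<longleftrightarrow> 0 < w \<bullet> normal s"
  using rng by (auto simp: inflow_boundary_def inward_normal_curve)

definition inflow_datum :: "real^2 \<Rightarrow> (real^2 \<Rightarrow> real) \<Rightarrow> real \<Rightarrow> real" where
  "inflow_datum w b s = (if 0 < w \<bullet> normal s then b (\<gamma> s) else 0)"

lemma mollified_data_curve:
  assumes "s \<in> {0..<L}"
  shows "mollified_data \<Omega> L \<gamma> \<mu> k w b (\<gamma> s) = convolution (inflow_datum w (\<lambda>Z. min (b Z) (real k / 2))) \<mu> s"
proof -
  have "(\<lambda>Z. if Z \<in> inflow_boundary \<Omega> \<gamma> w then min (b Z) (real k / 2) else 0) \<circ> \<gamma>
      = inflow_datum w (\<lambda>Z. min (b Z) (real k / 2))"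
    by (auto simp: inflow_datum_def inflow_boundary_curve)
  then show ?thesis
    using the_inv_into_f_f[OF inj assms] by (simp add: mollified_data_def boundary_convolution_def)
qed

lemma measurable_curve [measurable]: "\<gamma> \<in> borel_measurable borel"
  by (intro borel_measurable_continuous_onI continuous_curve)

lemma measurable_normal [measurable]: "(\<lambda>s. w \<bullet> normal s) \<in> borel_measurable borel"
  by (rule borel_measurable_continuous_onI[OF continuous_normal])

lemma measurable_inflow_datum:
  assumes "set_borel_measurable (arc_length L \<gamma>) (inflow_boundary \<Omega> \<gamma> w) b"
  shows "inflow_datum w b \<in> borel_measurable borel"
proof -
  have "(\<lambda>Z. indicator (inflow_boundary \<Omega> \<gamma> w) Z *\<^sub>R b Z) \<in> borel_measurable borel"
    using assms by (simp add: set_borel_measurable_def arc_length_def)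
  then have "(\<lambda>s. indicator (inflow_boundary \<Omega> \<gamma> w) (\<gamma> s) *\<^sub>R b (\<gamma> s)) \<in> borel_measurable borel"
    using measurable_curve by (rule measurable_compose[rotated])
  also have "(\<lambda>s. indicator (inflow_boundary \<Omega> \<gamma> w) (\<gamma> s) *\<^sub>R b (\<gamma> s)) = inflow_datum w b"
    by (auto simp: fun_eq_iff inflow_datum_def inflow_boundary_curve indicator_def)
  finally show ?thesis .
qed

text \<open>The density \<open>x (1 + ln x)\<close> in the hypothesis on the boundary data is negative for
  small \<open>x\<close>, whence the constant.\<close>

lemma weight_entropy_le:
  assumes "0 \<le> (x::real)"
  shows "x * (2 + ln (1 + x)) \<le> 3 * \<bar>x * (1 + ln x)\<bar> + 3"
proof (cases "1 \<le> x")
  case True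
  have "ln (1 + x) \<le> ln (2 * x)" using True by (intro ln_mono) auto
  also have "\<dots> = ln 2 + ln x" using True by (simp add: ln_mult)
  finally have "2 + ln (1 + x) \<le> 3 * (1 + ln x)" using ln_2_less_1 ln_ge_zero[OF True] by (smt (verit))
  then have "x * (2 + ln (1 + x)) \<le> x * (3 * (1 + ln x))" using assms by (rule mult_left_mono)
  also have "\<dots> = 3 * (x * (1 + ln x))" by (simp only: mult.left_commute)
  also have "\<dots> \<le> 3 * \<bar>x * (1 + ln x)\<bar> + 3" using abs_ge_self[of "x * (1 + ln x)"] by (smt (verit))
  finally show ?thesis .
next
  case False
  have "ln (1 + x) \<le> 1" using ln_add_one_self_le_self[OF assms] False by linarith
  then have "x * (2 + ln (1 + x)) \<le> 1 * 3" using False assms ln_ge_zero[of "1 + x"] by (intro mult_mono) auto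
  then show ?thesis using abs_ge_zero[of "x * (1 + ln x)"] by linarith
qed

text \<open>Mollification near the ends of a period uses the neighbouring periods, so that the data are needed
  on several of them.\<close>

lemma inflow_entropy_periods:
  assumes b: "set_borel_measurable (arc_length L \<gamma>) (inflow_boundary \<Omega> \<gamma> w) b"
    "\<And>Z. Z \<in> inflow_boundary \<Omega> \<gamma> w \<Longrightarrow> 0 \<le> b Z"
    "set_integrable (arc_length L \<gamma>) (inflow_boundary \<Omega> \<gamma> w)
       (\<lambda>Z. (w \<bullet> inward_normal \<Omega> \<gamma> Z) * b Z * (1 + ln (b Z)))"
  shows "\<exists>A\<ge>0. (\<integral>\<^sup>+s\<in>{-(real m * L)..real m * L}. ennreal (max (w \<bullet> normal s) 0 *
      (inflow_datum w b s * (2 + ln (1 + inflow_datum w b s)))) \<partial>lborel) \<le> ennreal A"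
proof -
  let ?W = "\<lambda>s. w \<bullet> normal s" and ?f = "inflow_datum w b"
  note [measurable] = measurable_inflow_datum[OF b(1)]
  have f0: "0 \<le> ?f s" for s using b(2) by (auto simp: inflow_datum_def inflow_boundary_curve)
  define P where "P s = ennreal (max (?W s) 0 * (?f s * (2 + ln (1 + ?f s))))" for s
  have [measurable]: "P \<in> borel_measurable borel" unfolding P_def by measurable
  have Wn: "\<bar>?W s\<bar> \<le> norm w" for s using Cauchy_Schwarz_ineq2[of w "normal s"] by simp
  define G where "G s = indicator (inflow_boundary \<Omega> \<gamma> w) (\<gamma> s) *\<^sub>R
      ((w \<bullet> inward_normal \<Omega> \<gamma> (\<gamma> s)) * b (\<gamma> s) * (1 + ln (b (\<gamma> s))))" for s
  have Geq: "G s = max (?W s) 0 * (?f s * (1 + ln (?f s)))" for s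
    by (auto simp: G_def inflow_datum_def inflow_boundary_curve inward_normal_curve indicator_def)
  have per1: "(\<integral>\<^sup>+s\<in>{0..<L}. P s \<partial>lborel) < \<infinity>"
  proof -
    have "integrable (restrict_space lborel {0..<L}) G"
    proof -
      have "integrable (distr (restrict_space lborel {0..<L}) borel \<gamma>)
        (\<lambda>Z. indicator (inflow_boundary \<Omega> \<gamma> w) Z *\<^sub>R ((w \<bullet> inward_normal \<Omega> \<gamma> Z) * b Z * (1 + ln (b Z))))"
        using b(3) by (simp add: set_integrable_def arc_length_def)
      moreover have "\<gamma> \<in> measurable (restrict_space lborel {0..<L}) borel"
        by (intro measurable_restrict_space1) simp
      ultimately show ?thesis unfolding G_def using integrable_distr by blast
    qed
    then have Gi: "integrable lborel (\<lambda>s. indicator {0..<L} s *\<^sub>R G s)"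
      by (subst (asm) integrable_restrict_space) auto
    have "(\<integral>\<^sup>+s\<in>{0..<L}. P s \<partial>lborel)
        \<le> (\<integral>\<^sup>+s. ennreal (norm (3 * (indicator {0..<L} s *\<^sub>R G s)) + 3 * norm w * indicator {0..<L} s) \<partial>lborel)"
    proof (rule nn_integral_mono)
      fix s
      have "max (?W s) 0 * (?f s * (2 + ln (1 + ?f s))) \<le> max (?W s) 0 * (3 * \<bar>?f s * (1 + ln (?f s))\<bar> + 3)"
        by (intro mult_left_mono weight_entropy_le f0) auto
      also have "\<dots> \<le> 3 * \<bar>G s\<bar> + 3 * norm w"
      proof -
        have "\<bar>G s\<bar> = max (?W s) 0 * \<bar>?f s * (1 + ln (?f s))\<bar>" unfolding Geq by (simp add: abs_mult)
        moreover have "max (?W s) 0 \<le> norm w" using Wn[of s] by auto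
        ultimately show ?thesis by (simp add: distrib_left mult.left_commute)
      qed
      finally show "P s * indicator {0..<L} s
          \<le> ennreal (norm (3 * (indicator {0..<L} s *\<^sub>R G s)) + 3 * norm w * indicator {0..<L} s)"
        unfolding P_def by (simp add: abs_mult ennreal_leI del: ennreal_plus split: split_indicator)
    qed
    also have "\<dots> < \<infinity>"
    proof -
      have "integrable lborel (\<lambda>s. norm (3 * (indicator {0..<L} s *\<^sub>R G s)) + 3 * norm w * indicator {0..<L} s)"
        using Gi by (intro Bochner_Integration.integrable_add integrable_norm integrable_mult_right)
          (use L0 in \<open>auto intro!: integrable_real_indicator\<close>)
      then show ?thesis by (subst nn_integral_eq_integral) auto
    qed
    finally show ?thesis .
  qed
  have Pper: "P (s + of_int n * L) = P s" for n s
  proof -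
    have "P (s + L) = P s" for s by (simp add: P_def inflow_datum_def periodic_normal per)
    then show ?thesis by (rule periodic_int)
  qed
  have shift: "(\<integral>\<^sup>+s. P s * indicator {of_int n * L..<of_int n * L + L} s \<partial>lborel) = (\<integral>\<^sup>+s\<in>{0..<L}. P s \<partial>lborel)" for n
  proof -
    have "(\<integral>\<^sup>+s. P s * indicator {of_int n * L..<of_int n * L + L} s \<partial>lborel)
        = (\<integral>\<^sup>+s. P (of_int n * L + 1 * s) * indicator {of_int n * L..<of_int n * L + L} (of_int n * L + 1 * s) \<partial>lborel)"
      by (subst nn_integral_real_affine[where c = 1 and t = "of_int n * L"]) (auto simp: one_ennreal_def[symmetric])
    also have "\<dots> = (\<integral>\<^sup>+s\<in>{0..<L}. P s \<partial>lborel)"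
      using Pper[of _ n] by (intro nn_integral_cong) (auto simp: add.commute split: split_indicator)
    finally show ?thesis .
  qed
  let ?p = "real m * L"
  have "(\<integral>\<^sup>+s\<in>{-?p..?p}. P s \<partial>lborel)
      \<le> (\<integral>\<^sup>+s. (\<Sum>n\<in>{-int m..int m}. P s * indicator {of_int n * L..<of_int n * L + L} s) \<partial>lborel)"
  proof (rule nn_integral_mono)
    fix s
    show "P s * indicator {-?p..?p} s \<le> (\<Sum>n\<in>{-int m..int m}. P s * indicator {of_int n * L..<of_int n * L + L} s)"
    proof (cases "s \<in> {-?p..?p}")
      case True
      define n where "n = \<lfloor>s / L\<rfloor>"
      have "of_int n * L \<le> (s / L) * L" using L0 by (intro mult_right_mono) (auto simp: n_def)
      moreover have "(s / L) * L < (of_int n + 1) * L" using L0 unfolding n_def by (intro mult_strict_right_mono) linarith+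
      ultimately have n1: "s \<in> {of_int n * L..<of_int n * L + L}" using L0 by (simp add: algebra_simps)
      have "- real m \<le> s / L" "s / L \<le> real m" using True L0 by (auto simp: field_simps)
      then have "n \<in> {-int m..int m}" unfolding n_def by (auto simp: le_floor_iff floor_le_iff)
      then have "P s * indicator {of_int n * L..<of_int n * L + L} s
          \<le> (\<Sum>n\<in>{-int m..int m}. P s * indicator {of_int n * L..<of_int n * L + L} s)"
        by (intro member_le_sum) auto
      then show ?thesis using n1 True by simp
    qed simp
  qed
  also have "\<dots> = (\<Sum>n\<in>{-int m..int m}. (\<integral>\<^sup>+s\<in>{0..<L}. P s \<partial>lborel))"
    by (subst nn_integral_sum) (auto simp: shift)
  also have "\<dots> < \<infinity>" using per1 by (simp add: ennreal_mult_less_top of_nat_less_top)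
  finally have "(\<integral>\<^sup>+s\<in>{-?p..?p}. P s \<partial>lborel) < \<infinity>" .
  then obtain A where "0 \<le> A" "(\<integral>\<^sup>+s\<in>{-?p..?p}. P s \<partial>lborel) = ennreal A"
    by (metis less_top_ennreal infinity_ennreal_def)
  then show ?thesis unfolding P_def by auto
qed

text \<open>The bound on mass and entropy of the ingoing data, uniform in the truncation and in the
  mollifier.\<close>

theorem mollified_inflow_entropy_bound:
  assumes w: "w \<noteq> 0"
    and b: "set_borel_measurable (arc_length L \<gamma>) (inflow_boundary \<Omega> \<gamma> w) b"
    "\<And>Z. Z \<in> inflow_boundary \<Omega> \<gamma> w \<Longrightarrow> 0 \<le> b Z"
    "set_integrable (arc_length L \<gamma>) (inflow_boundary \<Omega> \<gamma> w)
       (\<lambda>Z. (w \<bullet> inward_normal \<Omega> \<gamma> Z) * b Z * (1 + ln (b Z)))"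
  shows "\<exists>M\<ge>0. \<forall>k\<ge>1. \<forall>\<mu>. mollifier (1 / real k) \<mu> \<longrightarrow>
    (let h = convolution (inflow_datum w (\<lambda>Z. min (b Z) (real k / 2))) \<mu> in
      h \<in> borel_measurable borel \<and> (\<forall>s. 0 \<le> h s \<and> h s \<le> real k / 2) \<and>
      (\<integral>\<^sup>+s\<in>{0..L}. ennreal (max (w \<bullet> normal s) 0 * (h s * (1 + ln (1 + h s)))) \<partial>lborel) \<le> ennreal M)"
proof -
  let ?W = "\<lambda>s. w \<bullet> normal s" and ?f = "inflow_datum w b"
  note fm = measurable_inflow_datum[OF b(1)]
  have f0: "0 \<le> ?f s" for s using b(2) by (auto simp: inflow_datum_def inflow_boundary_curve)
  (* So many periods that the shifts by at most 1 in the convolution stay inside. *)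
  obtain m :: nat where m: "L + 2 < real m * L" using reals_Archimedean3[OF L0] by blast
  define p where "p = real m * L"
  obtain A where A: "0 \<le> A" "(\<integral>\<^sup>+s\<in>{-p..p}. ennreal (max (?W s) 0 * (?f s * (2 + ln (1 + ?f s)))) \<partial>lborel) \<le> ennreal A"
    using inflow_entropy_periods[OF b, of m] unfolding p_def by blast
  obtain K where K: "0 < K" "\<And>c. 0 < c \<Longrightarrow> (\<integral>\<^sup>+s\<in>{-p..p}. ennreal (if \<bar>?W s\<bar> < c then \<bar>curvature s * (w \<bullet> \<gamma>' s)\<bar> else 0) \<partial>lborel)
    \<le> ennreal (K * c)" using grazing_band_estimate[OF w p_def] by blast
  let ?W' = "\<lambda>s. - curvature s * (w \<bullet> \<gamma>' s)"
  have cW': "continuous_on X ?W'" for X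
    by (intro continuous_on_mult continuous_on_minus continuous_curvature continuous_on_inner continuous_on_const continuous_curve)
  have "bounded (?W' ` {0..L})" by (intro compact_imp_bounded compact_continuous_image cW') auto
  then obtain C where C: "\<And>s. s \<in> {0..L} \<Longrightarrow> \<bar>?W' s\<bar> \<le> C" unfolding bounded_iff by fastforce
  have W'per: "?W' (s + L) = ?W' s" for s
  proof -
    have "((\<lambda>x. ?W (x + L)) has_real_derivative ?W' (s + L)) (at s)"
      using normal_component_derivative(1)[of w "s + L"] unfolding DERIV_shift .
    then show ?thesis unfolding periodic_normal using normal_component_derivative(1)[of w s] by (rule DERIV_unique)
  qed
  have C': "\<bar>?W' s\<bar> \<le> C" for s
  proof -
    define n where "n = - \<lfloor>s / L\<rfloor>"
    have "of_int \<lfloor>s / L\<rfloor> * L \<le> (s / L) * L" using L0 by (intro mult_right_mono) auto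
    moreover have "(s / L) * L < (of_int \<lfloor>s / L\<rfloor> + 1) * L" using L0 by (intro mult_strict_right_mono) linarith+
    ultimately have "s + of_int n * L \<in> {0..L}" using L0 by (simp add: n_def algebra_simps)
    then have "\<bar>?W' (s + of_int n * L)\<bar> \<le> C" by (rule C)
    moreover have "?W' (s + of_int n * L) = ?W' s" by (rule periodic_int[of ?W', OF W'per])
    ultimately show ?thesis by simp
  qed
  have C0: "0 \<le> C" using C'[of 0] by linarith
  define M where "M = (1 + C) * A + 4 * K * (1 + C)"
  have M0: "0 \<le> M" using C0 A K by (simp add: M_def)
  have "let h = convolution (inflow_datum w (\<lambda>Z. min (b Z) (real k / 2))) \<mu> in
      h \<in> borel_measurable borel \<and> (\<forall>s. 0 \<le> h s \<and> h s \<le> real k / 2) \<and>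
      (\<integral>\<^sup>+s\<in>{0..L}. ennreal (max (?W s) 0 * (h s * (1 + ln (1 + h s)))) \<partial>lborel) \<le> ennreal M"
    if k: "1 \<le> k" and \<mu>: "mollifier (1 / real k) \<mu>" for k \<mu>
  proof -
    define g where "g = inflow_datum w (\<lambda>Z. min (b Z) (real k / 2))"
    have geq: "g s = min (?f s) (real k / 2)" for s by (simp add: g_def inflow_datum_def)
    have gm[measurable]: "g \<in> borel_measurable borel"
      using fm unfolding geq[abs_def, folded fun_eq_iff] by (simp add: geq[abs_def])
    have g0: "0 \<le> g s" "g s \<le> real k / 2" for s using f0[of s] by (auto simp: geq)
    define h where "h = convolution g \<mu>"
    note conv = convolution_entropy_bound[OF gm g0 \<mu>, folded h_def]
    have hm[measurable]: "h \<in> borel_measurable borel" by (rule conv(4))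
    define q where "q s = g s * (2 + ln (1 + g s))" for s
    have qm[measurable]: "q \<in> borel_measurable borel" unfolding q_def by measurable
    have ln0: "0 \<le> ln (1 + g s)" for s using g0[of s] by (intro ln_ge_zero) simp
    have q0: "0 \<le> q s" for s unfolding q_def using g0[of s] ln0[of s] by (intro mult_nonneg_nonneg) auto
    have qk: "q s \<le> 2 * (real k)\<^sup>2" for s
    proof -
      have "ln (1 + g s) \<le> g s" using g0[of s] by (intro ln_add_one_self_le_self) simp
      then have "2 + ln (1 + g s) \<le> 4 * real k" using g0(2)[of s] k by (auto simp: of_nat_le_iff[symmetric] simp del: of_nat_le_iff) 
      then have "q s \<le> (real k / 2) * (4 * real k)" unfolding q_def using g0[of s] ln0[of s] by (intro mult_mono) auto
      then show ?thesis by (simp add: power2_eq_square)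
    qed
    have qf: "q s \<le> ?f s * (2 + ln (1 + ?f s))" for s
    proof -
      have "g s \<le> ?f s" by (simp add: geq)
      then show ?thesis unfolding q_def using g0[of s] ln0[of s] f0[of s] by (intro mult_mono add_left_mono ln_mono) auto
    qed
    have qW: "q s = 0" if "?W s \<le> 0" for s using that by (simp add: q_def g_def inflow_datum_def)
    have qA: "(\<integral>\<^sup>+s\<in>{-p..p}. ennreal (max (?W s) 0 * q s) \<partial>lborel) \<le> ennreal A"
    proof (rule order_trans[OF _ A(2)], intro nn_integral_mono mult_right_mono ennreal_leI mult_left_mono qf)
    qed auto
    have band: "(\<integral>\<^sup>+s\<in>{-p..p}. ennreal (if \<bar>?W s\<bar> < c then \<bar>?W' s\<bar> else 0) \<partial>lborel) \<le> ennreal (K * c)" if "0 < c" for c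
      using K(2)[OF that] by (simp only: mult_minus_left abs_minus_cancel)
    have shifted: "(\<integral>\<^sup>+s\<in>{0..L}. ennreal (max (?W s) 0 * q (s - y)) \<partial>lborel) \<le> ennreal M" if "\<bar>y\<bar> \<le> 1 / real k" for y
      unfolding M_def
      by (rule shifted_weight_bound[OF normal_component_derivative(1) cW' C' _ L0 band K(1) k qm q0 qk qW qA A(1) that])
        (use m in \<open>auto simp: p_def\<close>)
    have \<mu>': "\<And>x. 0 \<le> \<mu> x" "integrable lborel \<mu>" "(LINT x|lborel. \<mu> x) = 1" "\<And>x. 1 / real k < norm x \<Longrightarrow> \<mu> x = 0"
      using \<mu> by (auto simp: mollifier_def)
    have [measurable]: "\<mu> \<in> borel_measurable borel" using \<mu>'(2) by auto
    have "(\<integral>\<^sup>+s\<in>{0..L}. ennreal (max (?W s) 0 * (h s * (1 + ln (1 + h s)))) \<partial>lborel)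
        \<le> (\<integral>\<^sup>+s. \<integral>\<^sup>+y. (ennreal (max (?W s) 0 * q (s - y)) * indicator {0..L} s) * ennreal (\<mu> y) \<partial>lborel \<partial>lborel)"
    proof (rule nn_integral_mono)
      fix s
      have "ennreal (max (?W s) 0 * (h s * (1 + ln (1 + h s)))) = ennreal (max (?W s) 0) * ennreal (h s * (1 + ln (1 + h s)))"
        by (rule ennreal_mult') simp
      also have "\<dots> \<le> ennreal (max (?W s) 0) * (\<integral>\<^sup>+y. ennreal (q (s - y)) * ennreal (\<mu> y) \<partial>lborel)"
        using conv(3)[of s] by (intro mult_left_mono) (auto simp: q_def)
      also have "\<dots> = (\<integral>\<^sup>+y. ennreal (max (?W s) 0 * q (s - y)) * ennreal (\<mu> y) \<partial>lborel)"
        by (subst nn_integral_cmult[symmetric]) (auto simp: ennreal_mult' mult.assoc)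
      finally show "ennreal (max (?W s) 0 * (h s * (1 + ln (1 + h s)))) * indicator {0..L} s
          \<le> (\<integral>\<^sup>+y. (ennreal (max (?W s) 0 * q (s - y)) * indicator {0..L} s) * ennreal (\<mu> y) \<partial>lborel)"
        by (auto split: split_indicator)
    qed
    also have "\<dots> = (\<integral>\<^sup>+y. \<integral>\<^sup>+s. (ennreal (max (?W s) 0 * q (s - y)) * indicator {0..L} s) * ennreal (\<mu> y) \<partial>lborel \<partial>lborel)"
      by (rule lborel_pair.Fubini'[symmetric]) measurable
    also have "\<dots> = (\<integral>\<^sup>+y. (\<integral>\<^sup>+s\<in>{0..L}. ennreal (max (?W s) 0 * q (s - y)) \<partial>lborel) * ennreal (\<mu> y) \<partial>lborel)"
      by (intro nn_integral_cong nn_integral_multc) measurable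
    also have "\<dots> \<le> (\<integral>\<^sup>+y. ennreal M * ennreal (\<mu> y) \<partial>lborel)"
    proof (rule nn_integral_mono)
      fix y
      show "(\<integral>\<^sup>+s\<in>{0..L}. ennreal (max (?W s) 0 * q (s - y)) \<partial>lborel) * ennreal (\<mu> y) \<le> ennreal M * ennreal (\<mu> y)"
        using shifted[of y] \<mu>'(4)[of y] by (cases "\<bar>y\<bar> \<le> 1 / real k") (auto intro: mult_right_mono)
    qed
    also have "\<dots> = ennreal M * (\<integral>\<^sup>+y. ennreal (\<mu> y) \<partial>lborel)" by (rule nn_integral_cmult) measurable
    also have "(\<integral>\<^sup>+y. ennreal (\<mu> y) \<partial>lborel) = 1"
      using nn_integral_eq_integral[OF \<mu>'(2)] \<mu>'(1,3) by simp
    finally show ?thesis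
      unfolding Let_def g_def[symmetric] h_def[symmetric] using hm conv(1,2) by simp
  qed
  then show ?thesis using M0 by blast
qed
end

section \<open>Solutions along characteristics\<close>

lemma set_integrable_bounded_Icc:
  fixes g :: "real \<Rightarrow> real"
  assumes "g \<in> borel_measurable borel" "\<And>x. \<bar>g x\<bar> \<le> K"
  shows "set_integrable lborel {a..b} g"
  using continuous_times_bounded_set_integrable[OF _ assms, of a b "\<lambda>_. 1"] by simp

text \<open>The base point \<open>a\<close> lies before the support of \<open>g\<close>, which makes the
  formula valid on the whole line.\<close>

lemma bounded_primitive_from:
  fixes g :: "real \<Rightarrow> real"
  assumes g: "g \<in> borel_measurable borel" "\<And>x. \<bar>g x\<bar> \<le> K" and z: "\<And>x. x < a \<Longrightarrow> g x = 0"
  shows "bounded_primitive (\<lambda>t. c + (LINT s:{a..t}|lborel. g s)) g"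
  unfolding bounded_primitive_def
proof (intro conjI allI impI exI)
  fix s t :: real assume st: "s \<le> t"
  have I: "(LINT s:{a..t}|lborel. g s) = integral {a..t} g" for t
    by (rule set_borel_integral_eq_integral(2)[OF set_integrable_bounded_Icc[OF g]])
  have gi: "g integrable_on {x..y}" for x y by (rule bounded_borel_integrable_on[OF g])
  have z0: "integral {x..y} g = 0" if "y \<le> a" for x y
  proof -
    have "integral {x..y} g = integral {x..y} (\<lambda>_. 0)"
      by (rule integral_spike[of "{a}"]) (use that z in auto)
    then show ?thesis by simp
  qed
  have "integral {a..t} g - integral {a..s} g = integral {s..t} g"
  proof (cases "a \<le> s")
    case True
    then show ?thesis using Henstock_Kurzweil_Integration.integral_combine[OF True st gi] by simp
  next
    case False
    then have s0: "integral {a..s} g = 0" by simp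
    show ?thesis
    proof (cases "a \<le> t")
      case True
      have "integral {s..a} g + integral {a..t} g = integral {s..t} g"
        by (rule Henstock_Kurzweil_Integration.integral_combine[OF _ True gi]) (use False in auto)
      then show ?thesis using s0 z0[of a s] by simp
    next
      case 2: False
      then show ?thesis using s0 z0[of t s] by simp
    qed
  qed
  then show "c + (LINT s:{a..t}|lborel. g s) - (c + (LINT s:{a..s}|lborel. g s)) = integral {s..t} g"
    unfolding I by simp
qed (use g in auto)

context convex_curve begin

lemma measurable_fibre [measurable]: "fibre w y \<in> sets borel"
  using open_fibre by auto

lemma domain_borel [measurable]: "\<Omega> \<in> sets borel" using opn by simp

lemma fibre_bound:
  assumes w: "w \<noteq> 0"
  shows "\<exists>R0. \<forall>R\<ge>R0. \<forall>y. \<forall>t\<in>fibre w y. \<bar>t\<bar> < R \<and> \<bar>y\<bar> < R"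
proof -
  obtain B where B: "\<And>z. z \<in> \<Omega> \<Longrightarrow> norm z \<le> B" using bdd by (auto simp: bounded_iff)
  have "\<bar>t\<bar> < B / norm w + 1 \<and> \<bar>y\<bar> < B / norm w + 1" if "t \<in> fibre w y" for y t
  proof -
    have nw: "0 < norm w" using w by simp
    have zB: "norm (char_point w y t) \<le> B" using B that by (simp add: fibre_def)
    have "(y\<^sup>2 + t\<^sup>2) * (norm w)\<^sup>2 \<le> B\<^sup>2"
      unfolding norm_char_point[symmetric] using zB by (intro power_mono) auto
    then have "y\<^sup>2 + t\<^sup>2 \<le> (B / norm w)\<^sup>2" using nw by (simp add: power_divide pos_le_divide_eq)
    then have "t\<^sup>2 \<le> (B / norm w)\<^sup>2" "y\<^sup>2 \<le> (B / norm w)\<^sup>2"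
      using zero_le_power2[of y] zero_le_power2[of t] by linarith+
    moreover have "0 \<le> B / norm w" using zB norm_ge_zero[of "char_point w y t"] nw by (intro divide_nonneg_pos) linarith+
    ultimately have "\<bar>t\<bar> \<le> B / norm w" "\<bar>y\<bar> \<le> B / norm w" by (simp_all add: power2_le_iff_abs_le)
    then show ?thesis by linarith
  qed
  then show ?thesis by (intro exI[of _ "B / norm w + 1"]) force
qed
end

text \<open>The function \<open>F\<close> and the source \<open>G\<close> are extended by 0 outside
  \<open>\<Omega>\<close>. The bound \<open>R\<close> makes it possible to integrate along all characteristics
  from \<open>-R\<close> to \<open>R\<close>, without reference to the points where they enter and
  leave.\<close>

locale characteristic = convex_curve +
  fixes w :: "real^2" and R :: real and F G :: "real^2 \<Rightarrow> real" and K :: real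
  assumes w: "w \<noteq> 0" and R: "\<And>y t. t \<in> fibre w y \<Longrightarrow> \<bar>t\<bar> < R \<and> \<bar>y\<bar> < R" and R0: "0 < R"
    and Fm [measurable]: "F \<in> borel_measurable borel" and Fnn: "\<And>z. 0 \<le> F z"
    and F0: "\<And>z. z \<notin> \<Omega> \<Longrightarrow> F z = 0" and Fint: "integrable lborel F"
    and Gm [measurable]: "G \<in> borel_measurable borel" and GK: "\<And>z. \<bar>G z\<bar> \<le> K"
    and G0: "\<And>z. z \<notin> \<Omega> \<Longrightarrow> G z = 0"
begin

definition gained :: "real \<Rightarrow> real \<Rightarrow> real" where
  "gained y t = (LINT s:{-R..t}|lborel. G (char_point w y s))"

lemma G_line:
  "(\<lambda>s. G (char_point w y s)) \<in> borel_measurable borel" "t \<notin> fibre w y \<Longrightarrow> G (char_point w y t) = 0"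
  "t \<le> -R \<or> R \<le> t \<or> R \<le> \<bar>y\<bar> \<Longrightarrow> G (char_point w y t) = 0"
proof -
  show "(\<lambda>s. G (char_point w y s)) \<in> borel_measurable borel" by measurable
  show *: "t \<notin> fibre w y \<Longrightarrow> G (char_point w y t) = 0" by (simp add: fibre_def G0)
  show "t \<le> -R \<or> R \<le> t \<or> R \<le> \<bar>y\<bar> \<Longrightarrow> G (char_point w y t) = 0"
    using * R[of t y] by (cases "t \<in> fibre w y") auto
qed

lemma primitive: "bounded_primitive (\<lambda>t. c + gained y t) (\<lambda>s. G (char_point w y s))"
  unfolding gained_def by (rule bounded_primitive_from[OF G_line(1) GK]) (simp add: G_line(3))

lemma measurable_gained [measurable]:
  "(\<lambda>p. gained (fst p) (snd p)) \<in> borel_measurable (lborel \<Otimes>\<^sub>M lborel)"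
  "(\<lambda>y. gained y t) \<in> borel_measurable borel"
proof -
  have [measurable]: "(\<lambda>q::(real \<times> real) \<times> real. G (char_point w (fst (fst q)) (snd q))) \<in> borel_measurable ((lborel \<Otimes>\<^sub>M lborel) \<Otimes>\<^sub>M lborel)"
  proof -
    have m: "(\<lambda>q::(real \<times> real) \<times> real. (fst (fst q), snd q))
        \<in> measurable ((lborel \<Otimes>\<^sub>M lborel) \<Otimes>\<^sub>M lborel) (lborel \<Otimes>\<^sub>M (lborel :: real measure))"
      by measurable
    have "(\<lambda>q::(real \<times> real) \<times> real. char_point w (fst (fst q)) (snd q)) \<in> borel_measurable ((lborel \<Otimes>\<^sub>M lborel) \<Otimes>\<^sub>M lborel)"
      using measurable_compose[OF m measurable_char_point(1)[of w]] by simp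
    then show ?thesis using Gm by (rule measurable_compose)
  qed
  show 1: "(\<lambda>p. gained (fst p) (snd p)) \<in> borel_measurable (lborel \<Otimes>\<^sub>M lborel)"
    unfolding gained_def set_lebesgue_integral_def indicator_def of_bool_def atLeastAtMost_iff
    by (rule lborel.borel_measurable_lebesgue_integral) measurable
  have "(\<lambda>y. (y, t)) \<in> measurable lborel (lborel \<Otimes>\<^sub>M lborel)" by measurable
  then have "(\<lambda>y. gained y t) \<in> borel_measurable lborel" using measurable_compose[OF _ 1, of "\<lambda>y. (y, t)"] by simp
  then show "(\<lambda>y. gained y t) \<in> borel_measurable borel" by simp
qed

lemma gained_eq_backward_integral:
  assumes t: "t \<in> fibre w y"
  shows "(LINT s:{0..t - entry w y}|lborel. G (char_point w y (t - s))) = gained y t"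
proof -
  let ?g = "\<lambda>s. G (char_point w y s)"
  define a where "a = entry w y"
  have at: "a < t" using entry_time_char_point(2)[OF w t] by (simp add: a_def)
  have aR: "- R \<le> a"
  proof -
    obtain c where c: "entry w y < c" "fibre w y = {entry w y<..<c}" using fibre_interval[OF w, of y] t by blast
    show ?thesis
    proof (rule ccontr)
      assume "\<not> - R \<le> a"
      then have "min (-R) ((a + c) / 2) \<in> fibre w y" using c by (auto simp: a_def min_def)
      from R[OF this] show False by linarith
    qed
  qed
  have gi: "set_integrable lborel {x..z} ?g" for x z by (rule set_integrable_bounded_Icc[OF G_line(1) GK])
  have "(LINT s:{0..t - a}|lborel. ?g (t - s)) = (LINT s:{a..t}|lborel. ?g s)"
  proof -
    have "(LINT s:{a..t}|lborel. ?g s) = \<bar>-1\<bar> *\<^sub>R (\<integral>s. indicator {a..t} (t + (-1) * s) *\<^sub>R ?g (t + (-1) * s) \<partial>lborel)"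
      unfolding set_lebesgue_integral_def by (rule lborel_integral_real_affine) simp
    also have "\<dots> = (LINT s:{0..t - a}|lborel. ?g (t - s))"
      unfolding set_lebesgue_integral_def
      by (simp, intro Bochner_Integration.integral_cong refl) (auto simp: indicator_def)
    finally show ?thesis by simp
  qed
  also have "\<dots> = integral {a..t} ?g" by (rule set_borel_integral_eq_integral(2)[OF gi])
  also have "\<dots> = gained y t - gained y a"
    using primitive[of 0 y] at by (simp add: bounded_primitive_def)
  also have "gained y a = 0"
  proof -
    have "gained y a = integral {-R..a} ?g"
      unfolding gained_def by (rule set_borel_integral_eq_integral(2)[OF gi])
    also have "\<dots> = integral {-R..a} (\<lambda>_. 0)"
    proof (rule Henstock_Kurzweil_Integration.integral_cong)
      fix s assume "s \<in> {-R..a}"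
      then have "s \<notin> fibre w y" using entry_time_char_point(2)[OF w, of s y] by (force simp: a_def)
      then show "?g s = 0" by (rule G_line(2))
    qed
    finally show ?thesis by simp
  qed
  finally show ?thesis by (simp add: a_def)
qed

text \<open>The equation may be stated for other representatives \<open>F'\<close> and \<open>G'\<close> of the density and of
  the source: by Fubini they agree with \<open>F\<close> and \<open>G\<close> almost everywhere on almost every line.\<close>

lemma mild_on_characteristics:
  assumes mild: "AE z in lborel. z \<in> \<Omega> \<longrightarrow>
      set_integrable lborel {0..entry_time \<Omega> w z} (\<lambda>s. G' (z - s *\<^sub>R w)) \<and>
      F' z = b (z - entry_time \<Omega> w z *\<^sub>R w) + (LINT s:{0..entry_time \<Omega> w z}|lborel. G' (z - s *\<^sub>R w))"
    and eq: "AE z in lborel. z \<in> \<Omega> \<longrightarrow> F' z = F z \<and> G' z = G z"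
  shows "AE y in lborel. AE t in lborel. t \<in> fibre w y \<longrightarrow>
    F (char_point w y t) = b (char_point w y (entry w y)) + gained y t"
  using AE_char[OF w mild] AE_char[OF w eq]
proof eventually_elim
  case (elim y)
  obtain N where N: "N \<in> sets lborel" "emeasure lborel N = 0"
    "{t. \<not> (char_point w y t \<in> \<Omega> \<longrightarrow> F' (char_point w y t) = F (char_point w y t)
      \<and> G' (char_point w y t) = G (char_point w y t))} \<subseteq> N"
    using elim(2) by (auto elim!: AE_E)
  have N': "AE t in lborel. t \<notin> N" by (rule AE_not_in) (use N in \<open>auto simp: null_sets_def\<close>)
  have [measurable]: "N \<in> sets borel" using N by simp
  show ?case
    using elim(1) N'
  proof eventually_elim
    case (elim t)
    show ?case
    proof
      assume t: "t \<in> fibre w y"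
      let ?a = "t - entry w y"
      have sub: "char_point w y t - s *\<^sub>R w = char_point w y (t - s)" for s
        by (simp add: char_point_def algebra_simps)
      have si: "set_integrable lborel {0..?a} (\<lambda>s. G' (char_point w y (t - s)))"
        and F': "F' (char_point w y t) = b (char_point w y (entry w y))
          + (LINT s:{0..?a}|lborel. G' (char_point w y (t - s)))"
        using elim(1) t entry_time_char_point(1)[OF w t] by (simp_all add: sub fibre_def)
      have "AE s in lborel. t + (-1) * s \<notin> N"
        by (rule AE_borel_affine[OF _ _ N']) simp_all
      moreover have "AE s in lborel. s \<noteq> ?a" by (rule AE_lborel_singleton)
      ultimately have "AE s in lborel. indicator {0..?a} s *\<^sub>R G' (char_point w y (t - s))
          = indicator {0..?a} s *\<^sub>R G (char_point w y (t - s))"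
      proof eventually_elim
        case (elim s)
        show ?case
        proof (cases "s \<in> {0..?a}")
          case True
          obtain c where c: "fibre w y = {entry w y<..<c}" using fibre_interval[OF w, of y] t by blast
          have "t - s \<in> fibre w y" using True elim(2) t unfolding c by auto
          then show ?thesis using elim(1) N(3) by (auto simp: fibre_def)
        qed simp
      qed
      then have "(LINT s:{0..?a}|lborel. G' (char_point w y (t - s))) = (LINT s:{0..?a}|lborel. G (char_point w y (t - s)))"
        unfolding set_lebesgue_integral_def
      proof (rule integral_cong_AE[rotated 2])
        show "(\<lambda>s. indicator {0..?a} s *\<^sub>R G' (char_point w y (t - s))) \<in> borel_measurable lborel"
          using si by (auto simp: set_integrable_def)
        have "(\<lambda>s. char_point w y (t - s)) \<in> borel_measurable borel"
          by (intro borel_measurable_continuous_onI continuous_intros)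
        then show "(\<lambda>s. indicator {0..?a} s *\<^sub>R G (char_point w y (t - s))) \<in> borel_measurable lborel"
          by measurable
      qed
      then have "F' (char_point w y t) = b (char_point w y (entry w y)) + gained y t"
        using F' gained_eq_backward_integral[OF t] by simp
      moreover have "F' (char_point w y t) = F (char_point w y t)"
        using elim(2) N(3) t by (auto simp: fibre_def)
      ultimately show "F (char_point w y t) = b (char_point w y (entry w y)) + gained y t" by simp
    qed
  qed
qed

text \<open>The entry value \<open>\<beta>\<close> is obtained as the mean over the fibre of the difference
  between \<open>F\<close> and the accumulated source, which is measurable by Fubini. The resulting profile is
  continuous and agrees with \<open>F \<ge> 0\<close> almost everywhere on the fibre, so that it is
  non-negative there; outside the fibre it is constant.\<close>

lemma entry_profile_exists:
  assumes mild: "AE y in lborel. AE t in lborel. t \<in> fibre w y \<longrightarrow>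
    F (char_point w y t) = b0 y + gained y t"
  obtains \<beta> where "\<beta> \<in> borel_measurable borel" "\<And>y. fibre w y = {} \<Longrightarrow> \<beta> y = 0"
    "AE y in lborel. fibre w y \<noteq> {} \<longrightarrow> \<beta> y = b0 y"
    "AE y in lborel. (AE t in lborel. t \<in> fibre w y \<longrightarrow> F (char_point w y t) = \<beta> y + gained y t)
      \<and> (\<forall>t. 0 \<le> \<beta> y + gained y t)"
proof -
  have [measurable]: "(\<lambda>p. F (char_point w (fst p) (snd p))) \<in> borel_measurable (lborel \<Otimes>\<^sub>M lborel)"
    by (rule measurable_compose[OF measurable_char_point(1) Fm])
  have ind: "indicator (fibre w y) t = (indicator \<Omega> (char_point w y t) :: real)" for y t
    by (simp add: fibre_def indicator_def)
  have [measurable]: "(\<lambda>p. indicator \<Omega> (char_point w (fst p) (snd p)) :: real) \<in> borel_measurable (lborel \<Otimes>\<^sub>M lborel)"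
    by (rule measurable_compose[OF measurable_char_point(1)]) measurable
  (* For an empty fibre the quotient is 0 / 0 = 0. *)
  define N where "N y = (\<integral>t. indicator (fibre w y) t * (F (char_point w y t) - gained y t) \<partial>lborel)" for y
  define \<beta> where "\<beta> y = N y / measure lborel (fibre w y)" for y
  have Nm: "N \<in> borel_measurable lborel"
    unfolding N_def ind
    by (rule lborel.borel_measurable_lebesgue_integral) (simp add: case_prod_unfold)
  have "(\<lambda>y. measure lborel (fibre w y)) \<in> borel_measurable lborel"
  proof -
    have "measure lborel (fibre w y) = (\<integral>t. indicator \<Omega> (char_point w y t) \<partial>lborel)" for y
      by (simp add: ind[symmetric])
    then show ?thesis
      by (simp only:) (rule lborel.borel_measurable_lebesgue_integral, simp add: case_prod_unfold)
  qed
  then have \<beta>m: "\<beta> \<in> borel_measurable borel" unfolding \<beta>_def using Nm by simp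
  have \<beta>0: "\<beta> y = 0" if "fibre w y = {}" for y unfolding \<beta>_def N_def that by simp
  have \<beta>b: "AE y in lborel. fibre w y \<noteq> {} \<longrightarrow> \<beta> y = b0 y"
    using mild
  proof eventually_elim
    case (elim y)
    show ?case
    proof
      assume ne: "fibre w y \<noteq> {}"
      obtain c where c: "entry w y < c" "fibre w y = {entry w y<..<c}" using fibre_interval[OF w ne] .
      have [measurable]: "gained y \<in> borel_measurable borel"
        using bounded_primitive_continuous[OF primitive[of 0 y]] by (auto intro: borel_measurable_continuous_onI)
      have "N y = (\<integral>t. indicator (fibre w y) t * b0 y \<partial>lborel)"
        unfolding N_def
      proof (rule integral_cong_AE)
        show "AE t in lborel. indicator (fibre w y) t * (F (char_point w y t) - gained y t) = indicator (fibre w y) t * b0 y"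
          using elim by eventually_elim (auto simp: indicator_def)
      qed measurable
      then show "\<beta> y = b0 y" unfolding \<beta>_def using c by simp
    qed
  qed
  have *: "AE y in lborel. (AE t in lborel. t \<in> fibre w y \<longrightarrow> F (char_point w y t) = \<beta> y + gained y t)
      \<and> (\<forall>t. 0 \<le> \<beta> y + gained y t)"
    using mild \<beta>b
  proof eventually_elim
    case (elim y)
    show ?case
    proof (cases "fibre w y = {}")
      case True
      have "gained y t = 0" for t
        unfolding gained_def set_lebesgue_integral_def using True G_line(2)[of _ y] by simp
      then show ?thesis using True \<beta>0[OF True] by simp
    next
      case False
      then have b: "\<beta> y = b0 y" using elim by simp
      have AE1: "AE t in lborel. t \<in> fibre w y \<longrightarrow> F (char_point w y t) = \<beta> y + gained y t"
        using elim(1) b by simp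
      obtain c where c: "entry w y < c" "fibre w y = {entry w y<..<c}" using fibre_interval[OF w False] .
      define a where "a = entry w y"
      let ?f = "\<lambda>t. \<beta> y + gained y t"
      have cont: "continuous_on UNIV ?f" by (rule bounded_primitive_continuous[OF primitive])
      have cl: "closed {t. 0 \<le> ?f t}" using cont by (intro closed_Collect_le) auto
      (* A negative value would persist on an open set, which is not a null set. *)
      have in_: "0 \<le> ?f t" if t: "t \<in> {a<..<c}" for t
      proof (rule ccontr)
        assume "\<not> 0 \<le> ?f t"
        then have op: "open ({a<..<c} \<inter> - {t. 0 \<le> ?f t})" "t \<in> {a<..<c} \<inter> - {t. 0 \<le> ?f t}"
          using cl t by (auto simp: open_Compl)
        have "AE t in lborel. t \<notin> {a<..<c} \<inter> - {t. 0 \<le> ?f t}"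
          using AE1 by eventually_elim (use Fnn c(2) in \<open>auto simp: a_def\<close>, metis)
        then have "{a<..<c} \<inter> - {t. 0 \<le> ?f t} \<in> null_sets lborel"
          using op(1) by (subst (asm) AE_iff_null_sets[symmetric]) auto
        then have "{a<..<c} \<inter> - {t. 0 \<le> ?f t} \<in> null_sets lebesgue" by (rule null_sets_completionI)
        then have "negligible ({a<..<c} \<inter> - {t. 0 \<le> ?f t})" by (simp add: negligible_iff_null_sets)
        then show False using op open_not_negligible by blast
      qed
      have cl_in: "0 \<le> ?f t" if t: "t \<in> {a..c}" for t
      proof -
        have "closure {a<..<c} \<subseteq> {t. 0 \<le> ?f t}" by (intro closure_minimal cl) (use in_ in auto)
        then show ?thesis using t c(1) by (simp add: a_def subset_iff)
      qed
      have flat: "?f t = ?f s" if st: "s \<le> t" "t \<le> a \<or> c \<le> s" for s t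
      proof -
        have "?f t - ?f s = integral {s..t} (\<lambda>s. G (char_point w y s))"
          using primitive[of "\<beta> y" y] st by (simp add: bounded_primitive_def)
        also have "\<dots> = integral {s..t} (\<lambda>_. 0)"
          by (rule Henstock_Kurzweil_Integration.integral_cong) (use st c(2) G_line(2)[of _ y] in \<open>auto simp: a_def\<close>)
        finally show ?thesis by simp
      qed
      have "0 \<le> ?f t" for t
      proof -
        consider "t \<le> a" | "t \<in> {a..c}" | "c \<le> t" by fastforce
        then show ?thesis
        proof cases
          case 1 then show ?thesis using flat[of t a] cl_in[of a] c(1) by (simp add: a_def)
        next
          case 2 then show ?thesis by (rule cl_in)
        next
          case 3 then show ?thesis using flat[of c t] cl_in[of c] c(1) by (simp add: a_def)
        qed
      qed
      then show ?thesis using AE1 by simp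
    qed
  qed
  show ?thesis by (rule that[OF \<beta>m \<beta>0 \<beta>b *])
qed
end

lemma integrable_bounded_support:
  fixes f :: "real \<Rightarrow> real"
  assumes "f \<in> borel_measurable borel" "AE y in lborel. \<bar>f y\<bar> \<le> B" "\<And>y. R \<le> \<bar>y\<bar> \<Longrightarrow> f y = 0"
  shows "integrable lborel f"
proof (rule integrableI_bounded_set[where A = "{-R..R}" and B = B])
  show "AE x\<in>{-R..R} in lborel. norm (f x) \<le> B" using assms(2) by eventually_elim simp
  show "AE x in lborel. x \<notin> {-R..R} \<longrightarrow> f x = 0" using assms(3) by (intro AE_I2) (auto simp: abs_if)
  show "emeasure lborel {-R..R} < \<infinity>" by (simp add: emeasure_lborel_Icc_eq)
qed (use assms(1) in auto)

text \<open>The integral of a test function along a characteristic. For \<open>\<omega> < 0\<close> the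
  characteristic runs backwards through the values of the linear form.\<close>

lemma bounded_primitive_affine:
  fixes \<rho> :: "real \<Rightarrow> real"
  assumes p: "bounded_primitive \<psi> \<rho>"
  shows "bounded_primitive (\<lambda>t. \<omega> * \<psi> (\<alpha> + \<omega> * t)) (\<lambda>t. \<omega>\<^sup>2 * \<rho> (\<alpha> + \<omega> * t))"
  unfolding bounded_primitive_def
proof (intro conjI allI impI)
  obtain K where K: "\<And>x. \<bar>\<rho> x\<bar> \<le> K" using p by (auto simp: bounded_primitive_def)
  have [measurable]: "\<rho> \<in> borel_measurable borel" using p by (simp add: bounded_primitive_def)
  show m: "(\<lambda>t. \<omega>\<^sup>2 * \<rho> (\<alpha> + \<omega> * t)) \<in> borel_measurable borel" by measurable
  have b: "\<bar>\<omega>\<^sup>2 * \<rho> (\<alpha> + \<omega> * t)\<bar> \<le> \<omega>\<^sup>2 * K" for t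
    using K by (simp add: abs_mult mult_left_mono)
  then show "\<exists>K. \<forall>t. \<bar>\<omega>\<^sup>2 * \<rho> (\<alpha> + \<omega> * t)\<bar> \<le> K" by blast
  fix s t :: real assume st: "s \<le> t"
  have I: "(LINT x:{a..b}|lborel. \<rho> x) = integral {a..b} \<rho>" for a b
    by (rule set_borel_integral_eq_integral(2)[OF set_integrable_bounded_Icc[OF _ K]]) simp
  have I': "(LINT x:{s..t}|lborel. \<omega>\<^sup>2 * \<rho> (\<alpha> + \<omega> * x)) = integral {s..t} (\<lambda>t. \<omega>\<^sup>2 * \<rho> (\<alpha> + \<omega> * t))"
    by (rule set_borel_integral_eq_integral(2)[OF set_integrable_bounded_Icc[OF m b]])
  have aff: "(LINT x:{a..b}|lborel. \<rho> x) = \<bar>\<omega>\<bar> * (LINT x:{s..t}|lborel. \<rho> (\<alpha> + \<omega> * x))"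
    if "\<omega> \<noteq> 0" "\<And>x. \<alpha> + \<omega> * x \<in> {a..b} \<longleftrightarrow> x \<in> {s..t}" for a b
  proof -
    have "(LINT x:{a..b}|lborel. \<rho> x) = \<bar>\<omega>\<bar> *\<^sub>R (\<integral>x. indicator {a..b} (\<alpha> + \<omega> * x) *\<^sub>R \<rho> (\<alpha> + \<omega> * x) \<partial>lborel)"
      unfolding set_lebesgue_integral_def by (rule lborel_integral_real_affine[OF that(1)])
    also have "\<dots> = \<bar>\<omega>\<bar> * (LINT x:{s..t}|lborel. \<rho> (\<alpha> + \<omega> * x))"
      unfolding set_lebesgue_integral_def indicator_def using that(2) by simp
    finally show ?thesis .
  qed
  have "\<omega> * \<psi> (\<alpha> + \<omega> * t) - \<omega> * \<psi> (\<alpha> + \<omega> * s) = \<omega>\<^sup>2 * (LINT x:{s..t}|lborel. \<rho> (\<alpha> + \<omega> * x))"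
  proof (cases "\<omega> = 0")
    case nz: False
    show ?thesis
    proof (cases "0 < \<omega>")
      case True
      have "\<psi> (\<alpha> + \<omega> * t) - \<psi> (\<alpha> + \<omega> * s) = integral {\<alpha> + \<omega> * s..\<alpha> + \<omega> * t} \<rho>"
        using p st True by (auto simp: bounded_primitive_def)
      also have "\<dots> = \<bar>\<omega>\<bar> * (LINT x:{s..t}|lborel. \<rho> (\<alpha> + \<omega> * x))"
        unfolding I[symmetric] by (rule aff) (use True in auto)
      finally show ?thesis using True by (simp add: right_diff_distrib[symmetric] power2_eq_square)
    next
      case False
      then have neg: "\<omega> < 0" using nz by simp
      have "\<psi> (\<alpha> + \<omega> * s) - \<psi> (\<alpha> + \<omega> * t) = integral {\<alpha> + \<omega> * t..\<alpha> + \<omega> * s} \<rho>"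
        using p st neg by (auto simp: bounded_primitive_def)
      also have "\<dots> = \<bar>\<omega>\<bar> * (LINT x:{s..t}|lborel. \<rho> (\<alpha> + \<omega> * x))"
        unfolding I[symmetric] by (rule aff) (use neg in auto)
      finally have "\<psi> (\<alpha> + \<omega> * t) - \<psi> (\<alpha> + \<omega> * s) = \<omega> * (LINT x:{s..t}|lborel. \<rho> (\<alpha> + \<omega> * x))"
        using neg by simp
      then show ?thesis by (simp add: right_diff_distrib[symmetric] power2_eq_square)
    qed
  qed simp
  then show "\<omega> * \<psi> (\<alpha> + \<omega> * t) - \<omega> * \<psi> (\<alpha> + \<omega> * s) = integral {s..t} (\<lambda>t. \<omega>\<^sup>2 * \<rho> (\<alpha> + \<omega> * t))"
    unfolding I'[symmetric] by simp
qed

text \<open>The profile \<open>t \<mapsto> \<beta> y + gained y t\<close> is the representative of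
  \<open>F\<close> on the characteristic with label \<open>y\<close>.\<close>

locale characteristic_solution = characteristic +
  fixes \<beta> :: "real \<Rightarrow> real" and B :: real
  assumes \<beta>m [measurable]: "\<beta> \<in> borel_measurable borel" and \<beta>0: "\<And>y. fibre w y = {} \<Longrightarrow> \<beta> y = 0"
    and sol: "AE y in lborel. (AE t in lborel. t \<in> fibre w y \<longrightarrow> F (char_point w y t) = \<beta> y + gained y t)
      \<and> (\<forall>t. 0 \<le> \<beta> y + gained y t)"
    and \<beta>B: "AE y in lborel. \<beta> y \<le> B"
begin

text \<open>The value of the profile where the characteristic leaves the domain; it is constant from there
  on.\<close>

definition exit :: "real \<Rightarrow> real" where "exit y = \<beta> y + gained y R"

lemma K0: "0 \<le> K" using GK[of 0] by linarith

lemma gained_start: "gained y (-R) = 0"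
proof -
  have "gained y (-R) = integral {-R..-R} (\<lambda>s. G (char_point w y s))"
    unfolding gained_def by (rule set_borel_integral_eq_integral(2)[OF set_integrable_bounded_Icc[OF G_line(1) GK]])
  then show ?thesis by simp
qed

lemma measurable_exit [measurable]: "exit \<in> borel_measurable borel"
  unfolding exit_def by measurable

lemma fibre_empty: "R \<le> \<bar>y\<bar> \<Longrightarrow> fibre w y = {}"
  using R[of _ y] by force

lemma gained_empty: "fibre w y = {} \<Longrightarrow> gained y t = 0"
  unfolding gained_def set_lebesgue_integral_def using G_line(2)[of _ y] by simp

lemma exit_empty: "R \<le> \<bar>y\<bar> \<Longrightarrow> \<beta> y = 0" "R \<le> \<bar>y\<bar> \<Longrightarrow> exit y = 0"
  using \<beta>0 fibre_empty gained_empty by (auto simp: exit_def)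

lemma profile_bounds:
  "AE y in lborel. 0 \<le> \<beta> y \<and> 0 \<le> exit y \<and> \<beta> y \<le> B + 2 * R * K \<and> exit y \<le> B + 2 * R * K"
  using sol \<beta>B
proof eventually_elim
  case (elim y)
  have "\<bar>(0 + gained y R) - (0 + gained y (-R))\<bar> \<le> K * \<bar>R - (-R)\<bar>"
    by (rule bounded_primitive_lipschitz[OF primitive GK])
  then have "\<bar>gained y R\<bar> \<le> 2 * R * K" using R0 by (simp add: gained_start mult_ac)
  moreover have "0 \<le> \<beta> y" "0 \<le> exit y"
    using elim(1) gained_start[of y] by (metis add.right_neutral, simp add: exit_def)
  moreover have "0 \<le> 2 * R * K" using R0 K0 by simp
  ultimately show ?case using elim(2) by (auto simp: exit_def)
qed

lemma integrable_\<beta>: "integrable lborel \<beta>" and integrable_exit: "integrable lborel exit"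
proof -
  show "integrable lborel \<beta>"
    by (rule integrable_bounded_support[where R = R and B = "B + 2 * R * K", OF _ eventually_mono[OF profile_bounds]])
      (auto simp: exit_empty)
  show "integrable lborel exit"
    by (rule integrable_bounded_support[where R = R and B = "B + 2 * R * K", OF _ eventually_mono[OF profile_bounds]])
      (auto simp: exit_empty)
qed

lemma domain_finite: "emeasure lborel \<Omega> < \<infinity>"
  using emeasure_bounded_finite[OF bdd] .

lemma integrable_bounded_times_G:
  assumes "h \<in> borel_measurable borel" "\<And>z. z \<in> \<Omega> \<Longrightarrow> \<bar>h z\<bar> \<le> D"
  shows "integrable lborel (\<lambda>z. h z * G z)"
proof (rule integrableI_bounded_set[where A = \<Omega> and B = "D * K"])
  show "(\<lambda>z. h z * G z) \<in> borel_measurable lborel" using assms(1) by measurable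
  show "AE z\<in>\<Omega> in lborel. norm (h z * G z) \<le> D * K"
  proof (intro AE_I2 impI)
    fix z assume z: "z \<in> \<Omega>"
    show "norm (h z * G z) \<le> D * K"
      using assms(2)[OF z] GK[of z] order_trans[OF abs_ge_zero assms(2)[OF z]]
      by (auto simp: abs_mult intro!: mult_mono)
  qed
qed (use G0 domain_finite in auto)

lemma line_integral_Icc:
  assumes "AE t in lborel. h t = indicator {-R..R} t *\<^sub>R g t" "set_integrable lborel {-R..R} g" "h \<in> borel_measurable lborel"
  shows "(\<integral>t. h t \<partial>lborel) = integral {-R..R} (g :: real \<Rightarrow> real)" "integrable lborel h"
proof -
  have gm: "(\<lambda>t. indicator {-R..R} t *\<^sub>R g t) \<in> borel_measurable lborel"
    using assms(2) by (auto simp: set_integrable_def)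
  have "(\<integral>t. h t \<partial>lborel) = (\<integral>t. indicator {-R..R} t *\<^sub>R g t \<partial>lborel)"
    by (rule integral_cong_AE[OF assms(3) gm assms(1)])
  then show "(\<integral>t. h t \<partial>lborel) = integral {-R..R} g"
    using set_borel_integral_eq_integral(2)[OF assms(2)] by (simp add: set_lebesgue_integral_def)
  show "integrable lborel h"
    using integrable_cong_AE[OF assms(3) gm assms(1)] assms(2) by (simp add: set_integrable_def)
qed

text \<open>Renormalization: integrate the chain rule along each characteristic, then over the
  characteristics. With the identity for \<open>\<Phi>\<close> it is the balance of mass, with an entropy
  density the balance of entropy.\<close>

lemma balance:
  assumes d: "\<And>x. 0 \<le> x \<Longrightarrow> (\<Phi> has_real_derivative \<Phi>' x) (at x within {0..})"
    and lip: "\<Lambda>-lipschitz_on {0..} \<Phi>'" and bnd: "\<And>x. 0 \<le> x \<Longrightarrow> \<bar>\<Phi>' x\<bar> \<le> D"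
    and m [measurable]: "\<Phi> \<in> borel_measurable borel" "\<Phi>' \<in> borel_measurable borel" and z: "\<Phi> 0 = 0"
  shows "integrable lborel (\<lambda>y. \<Phi> (\<beta> y))" "integrable lborel (\<lambda>y. \<Phi> (exit y))"
    "integrable lborel (\<lambda>z. \<Phi>' (F z) * G z)"
    "(norm w)\<^sup>2 * ((\<integral>y. \<Phi> (exit y) \<partial>lborel) - (\<integral>y. \<Phi> (\<beta> y) \<partial>lborel)) = (\<integral>z. \<Phi>' (F z) * G z \<partial>lborel)"
proof -
  have cont: "continuous_on {0..} \<Phi>" using d by (intro DERIV_continuous_on) auto
  define c where "c = B + 2 * R * K"
  have "bounded (\<Phi> ` {0..c})"
    by (intro compact_imp_bounded compact_continuous_image continuous_on_subset[OF cont]) auto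
  then obtain C where C: "\<And>x. x \<in> {0..c} \<Longrightarrow> \<bar>\<Phi> x\<bar> \<le> C" unfolding bounded_iff by fastforce
  show i1: "integrable lborel (\<lambda>y. \<Phi> (\<beta> y))"
    by (rule integrable_bounded_support[where R = R and B = C, OF _ eventually_mono[OF profile_bounds]])
      (use C exit_empty z in \<open>auto simp: c_def\<close>)
  show i2: "integrable lborel (\<lambda>y. \<Phi> (exit y))"
    by (rule integrable_bounded_support[where R = R and B = C, OF _ eventually_mono[OF profile_bounds]])
      (use C exit_empty z in \<open>auto simp: c_def\<close>)
  show i3: "integrable lborel (\<lambda>z. \<Phi>' (F z) * G z)"
    by (rule integrable_bounded_times_G[of _ D]) (use bnd Fnn in auto)
  have "AE y in lborel. \<Phi> (exit y) - \<Phi> (\<beta> y) = (\<integral>t. \<Phi>' (F (char_point w y t)) * G (char_point w y t) \<partial>lborel)"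
    using sol
  proof eventually_elim
    case (elim y)
    let ?f = "\<lambda>t. \<beta> y + gained y t" and ?g = "\<lambda>t. G (char_point w y t)"
    have "\<Phi> (?f R) - \<Phi> (?f (-R)) = integral {-R..R} (\<lambda>t. \<Phi>' (?f t) * ?g t)"
      "set_integrable lborel {-R..R} (\<lambda>t. \<Phi>' (?f t) * ?g t)"
      using bounded_primitive_chain[OF primitive, of "-R" R "{0..}" "\<beta> y" y \<Phi> \<Phi>' \<Lambda>] R0 elim d lip by auto
    moreover have "(\<integral>t. \<Phi>' (F (char_point w y t)) * ?g t \<partial>lborel) = integral {-R..R} (\<lambda>t. \<Phi>' (?f t) * ?g t)"
    proof (rule line_integral_Icc(1))
      have "AE t in lborel. t \<in> fibre w y \<longrightarrow> F (char_point w y t) = ?f t" using elim by simp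
      then show "AE t in lborel. \<Phi>' (F (char_point w y t)) * ?g t = indicator {-R..R} t *\<^sub>R (\<Phi>' (?f t) * ?g t)"
      proof eventually_elim
        case (elim t)
        then show ?case using R[of t y] G_line(2)[of t y] by (cases "t \<in> fibre w y") (auto simp: indicator_def abs_less_iff)
      qed
      show "(\<lambda>t. \<Phi>' (F (char_point w y t)) * ?g t) \<in> borel_measurable lborel" by measurable
    qed fact
    ultimately show ?case by (simp add: exit_def gained_start)
  qed
  then have "(\<integral>y. \<Phi> (exit y) - \<Phi> (\<beta> y) \<partial>lborel)
      = (\<integral>y. \<integral>t. \<Phi>' (F (char_point w y t)) * G (char_point w y t) \<partial>lborel \<partial>lborel)"
    by (rule integral_cong_AE[rotated 2]) (use integral_char(2)[OF w i3] in \<open>auto\<close>)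
  then show "(norm w)\<^sup>2 * ((\<integral>y. \<Phi> (exit y) \<partial>lborel) - (\<integral>y. \<Phi> (\<beta> y) \<partial>lborel)) = (\<integral>z. \<Phi>' (F z) * G z \<partial>lborel)"
    unfolding integral_char(1)[OF w i3] using i1 i2 by simp
qed

text \<open>The equation tested with \<open>(w \<bullet> n) \<psi> (z \<bullet> n)\<close>, where
  \<open>\<psi>\<close> is the primitive of \<open>\<rho>\<close>. It is an inequality because the profile is
  also integrated over its constant and non-negative parts outside the domain.\<close>

lemma momentum_inequality:
  fixes n :: "real^2" and \<rho> :: "real \<Rightarrow> real"
  assumes \<rho> [measurable]: "\<rho> \<in> borel_measurable borel" and \<rho>01: "\<And>c. 0 \<le> \<rho> c" "\<And>c. \<rho> c \<le> 1"
    and supp: "\<And>c. S < \<bar>c\<bar> \<Longrightarrow> \<rho> c = 0"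
    and \<psi>: "\<And>c. \<psi> c = (LINT s:{-S..c}|lborel. \<rho> s)"
  shows "(w \<bullet> n)\<^sup>2 * (\<integral>z. \<rho> (z \<bullet> n) * F z \<partial>lborel) + (\<integral>z. (w \<bullet> n) * \<psi> (z \<bullet> n) * G z \<partial>lborel)
    \<le> \<bar>w \<bullet> n\<bar> * (\<integral>c. \<rho> c \<partial>lborel) * ((norm w)\<^sup>2 * ((\<integral>y. exit y \<partial>lborel) + (\<integral>y. \<beta> y \<partial>lborel)))"
    and "integrable lborel (\<lambda>z. (w \<bullet> n) * \<psi> (z \<bullet> n) * G z)" "integrable lborel (\<lambda>z. \<rho> (z \<bullet> n) * F z)"
proof -
  define m where "m = (\<integral>c. \<rho> c \<partial>lborel)"
  let ?\<omega> = "w \<bullet> n"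
  have \<rho>b: "\<bar>\<rho> c\<bar> \<le> 1" for c using \<rho>01[of c] by simp
  have prim: "bounded_primitive \<psi> \<rho>"
    using bounded_primitive_from[OF \<rho> \<rho>b, of "-S" 0] supp unfolding \<psi>[abs_def] by auto
  have \<rho>i: "integrable lborel \<rho>"
    by (rule integrable_bounded_support[OF \<rho>, of 1 "\<bar>S\<bar> + 1"]) (use \<rho>b supp in auto)
  have \<psi>0: "0 \<le> \<psi> c" "\<psi> c \<le> m" for c
  proof -
    show "0 \<le> \<psi> c" unfolding \<psi> set_lebesgue_integral_def by (intro Bochner_Integration.integral_nonneg) (simp add: \<rho>01)
    have "set_integrable lborel {-S..c} \<rho>" by (rule set_integrable_bounded_Icc[OF \<rho> \<rho>b])
    then show "\<psi> c \<le> m" unfolding \<psi> m_def set_lebesgue_integral_def set_integrable_def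
      by (rule integral_mono[OF _ \<rho>i]) (simp add: \<rho>01 indicator_def)
  qed
  have [measurable]: "\<psi> \<in> borel_measurable borel"
    using bounded_primitive_continuous[OF prim] by (intro borel_measurable_continuous_onI)
  show iG: "integrable lborel (\<lambda>z. ?\<omega> * \<psi> (z \<bullet> n) * G z)"
    by (rule integrable_bounded_times_G[of _ "\<bar>?\<omega>\<bar> * m"]) (use \<psi>0 in \<open>auto simp: abs_mult intro!: mult_left_mono\<close>)
  show iF: "integrable lborel (\<lambda>z. \<rho> (z \<bullet> n) * F z)"
  proof (rule Bochner_Integration.integrable_bound[OF Fint])
    show "AE z in lborel. norm (\<rho> (z \<bullet> n) * F z) \<le> norm (F z)"
      using \<rho>01 Fnn by (intro AE_I2) (simp add: abs_mult mult_left_le_one_le)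
  qed measurable
  have key: "AE y in lborel. ?\<omega>\<^sup>2 * (\<integral>t. \<rho> (char_point w y t \<bullet> n) * F (char_point w y t) \<partial>lborel)
      + (\<integral>t. ?\<omega> * \<psi> (char_point w y t \<bullet> n) * G (char_point w y t) \<partial>lborel) \<le> \<bar>?\<omega>\<bar> * m * (exit y + \<beta> y)"
    using sol profile_bounds
  proof eventually_elim
    case (elim y)
    let ?f = "\<lambda>t. \<beta> y + gained y t" and ?g = "\<lambda>t. G (char_point w y t)"
    let ?\<phi> = "\<lambda>t. ?\<omega> * \<psi> (char_point w y t \<bullet> n)" and ?\<phi>' = "\<lambda>t. ?\<omega>\<^sup>2 * \<rho> (char_point w y t \<bullet> n)"
    have cp: "char_point w y t \<bullet> n = y * (perp w \<bullet> n) + ?\<omega> * t" for t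
      by (simp add: char_point_def inner_add_left)
    have p: "bounded_primitive ?\<phi> ?\<phi>'" unfolding cp by (rule bounded_primitive_affine[OF prim])
    have RR: "-R \<le> R" using R0 by simp
    have \<phi>'m: "?\<phi>' \<in> borel_measurable borel" by measurable
    have \<phi>'b: "\<bar>?\<phi>' t\<bar> \<le> ?\<omega>\<^sup>2" for t using \<rho>b[of "char_point w y t \<bullet> n"] by (simp add: abs_mult mult_left_le)
    have s1: "set_integrable lborel {-R..R} (\<lambda>t. ?f t * ?\<phi>' t)"
      by (rule continuous_times_bounded_set_integrable[OF bounded_primitive_continuous[OF primitive] \<phi>'m \<phi>'b])
    have s2: "set_integrable lborel {-R..R} (\<lambda>t. ?\<phi> t * ?g t)"
      by (rule continuous_times_bounded_set_integrable[OF bounded_primitive_continuous[OF p] G_line(1) GK])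
    have "?\<phi> R * ?f R - ?\<phi> (-R) * ?f (-R) = integral {-R..R} (\<lambda>t. ?\<phi>' t * ?f t + ?\<phi> t * ?g t)"
      by (rule bounded_primitive_product(1)[OF primitive p RR])
    also have "\<dots> = integral {-R..R} (\<lambda>t. ?f t * ?\<phi>' t) + integral {-R..R} (\<lambda>t. ?\<phi> t * ?g t)"
      using set_borel_integral_eq_integral(1)[OF s1] set_borel_integral_eq_integral(1)[OF s2]
      by (subst Henstock_Kurzweil_Integration.integral_add[symmetric]) (auto simp: mult.commute)
    also have "integral {-R..R} (\<lambda>t. ?\<phi> t * ?g t) = (\<integral>t. ?\<phi> t * ?g t \<partial>lborel)"
    proof (rule line_integral_Icc(1)[OF _ s2, symmetric])
      show "AE t in lborel. ?\<phi> t * ?g t = indicator {-R..R} t *\<^sub>R (?\<phi> t * ?g t)"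
      proof (rule AE_I2)
        fix t show "?\<phi> t * ?g t = indicator {-R..R} t *\<^sub>R (?\<phi> t * ?g t)"
          using G_line(3)[of t y] by (cases "t \<in> {-R..R}") auto
      qed
    qed measurable
    also have "integral {-R..R} (\<lambda>t. ?f t * ?\<phi>' t) = (LINT t:{-R..R}|lborel. ?f t * ?\<phi>' t)"
      by (rule set_borel_integral_eq_integral(2)[OF s1, symmetric])
    finally have eq: "?\<phi> R * exit y - ?\<phi> (-R) * \<beta> y
        = (LINT t:{-R..R}|lborel. ?f t * ?\<phi>' t) + (\<integral>t. ?\<phi> t * ?g t \<partial>lborel)"
      by (simp add: exit_def gained_start)
    have le: "?\<omega>\<^sup>2 * (\<integral>t. \<rho> (char_point w y t \<bullet> n) * F (char_point w y t) \<partial>lborel) \<le> (LINT t:{-R..R}|lborel. ?f t * ?\<phi>' t)"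
    proof -
      have "?\<omega>\<^sup>2 * (\<integral>t. \<rho> (char_point w y t \<bullet> n) * F (char_point w y t) \<partial>lborel)
          = (\<integral>t. ?\<phi>' t * F (char_point w y t) \<partial>lborel)" by (simp add: mult.assoc)
      also have "\<dots> \<le> (\<integral>t. indicator {-R..R} t *\<^sub>R (?f t * ?\<phi>' t) \<partial>lborel)"
      proof (rule integral_mono_AE')
        show "integrable lborel (\<lambda>t. indicator {-R..R} t *\<^sub>R (?f t * ?\<phi>' t))" using s1 by (simp add: set_integrable_def)
        have f0: "0 \<le> ?f t" for t using elim(1) by simp
        have "AE t in lborel. t \<in> fibre w y \<longrightarrow> F (char_point w y t) = ?f t" using elim by simp
        then show "AE t in lborel. ?\<phi>' t * F (char_point w y t) \<le> indicator {-R..R} t *\<^sub>R (?f t * ?\<phi>' t)"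
        proof eventually_elim
          case (elim t)
          have "0 \<le> ?f t * ?\<phi>' t" using f0[of t] \<rho>01 by simp
          then show ?case using elim R[of t y] F0[of "char_point w y t"]
            by (cases "t \<in> fibre w y") (auto simp: fibre_def mult.commute abs_less_iff indicator_def)
        qed
        show "AE t in lborel. 0 \<le> indicator {-R..R} t *\<^sub>R (?f t * ?\<phi>' t)" using elim(1) \<rho>01 by simp
      qed
      finally show ?thesis by (simp add: set_lebesgue_integral_def)
    qed
    have "?\<phi> R * exit y \<le> \<bar>?\<omega>\<bar> * m * exit y"
    proof (rule mult_right_mono)
      have "?\<phi> R \<le> \<bar>?\<omega>\<bar> * \<psi> (char_point w y R \<bullet> n)" using \<psi>0 by (intro mult_right_mono) auto
      also have "\<dots> \<le> \<bar>?\<omega>\<bar> * m" using \<psi>0 by (intro mult_left_mono) auto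
      finally show "?\<phi> R \<le> \<bar>?\<omega>\<bar> * m" .
    qed (use elim in auto)
    moreover have "- ?\<phi> (-R) * \<beta> y \<le> \<bar>?\<omega>\<bar> * m * \<beta> y"
    proof (rule mult_right_mono)
      have "- ?\<phi> (-R) = (- ?\<omega>) * \<psi> (char_point w y (-R) \<bullet> n)" by simp
      also have "\<dots> \<le> \<bar>?\<omega>\<bar> * \<psi> (char_point w y (-R) \<bullet> n)" using \<psi>0 by (intro mult_right_mono) auto
      also have "\<dots> \<le> \<bar>?\<omega>\<bar> * m" using \<psi>0 by (intro mult_left_mono) auto
      finally show "- ?\<phi> (-R) \<le> \<bar>?\<omega>\<bar> * m" .
    qed (use elim in auto)
    ultimately show ?case using eq le by (simp add: distrib_left)
  qed
  have "?\<omega>\<^sup>2 * (\<integral>y. \<integral>t. \<rho> (char_point w y t \<bullet> n) * F (char_point w y t) \<partial>lborel \<partial>lborel)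
      + (\<integral>y. \<integral>t. ?\<omega> * \<psi> (char_point w y t \<bullet> n) * G (char_point w y t) \<partial>lborel \<partial>lborel)
      \<le> \<bar>?\<omega>\<bar> * m * ((\<integral>y. exit y \<partial>lborel) + (\<integral>y. \<beta> y \<partial>lborel))"
  proof -
    note i1 = integral_char(2)[OF w iF] and i2 = integral_char(2)[OF w iG]
    have "(\<integral>y. ?\<omega>\<^sup>2 * (\<integral>t. \<rho> (char_point w y t \<bullet> n) * F (char_point w y t) \<partial>lborel)
      + (\<integral>t. ?\<omega> * \<psi> (char_point w y t \<bullet> n) * G (char_point w y t) \<partial>lborel) \<partial>lborel)
      \<le> (\<integral>y. \<bar>?\<omega>\<bar> * m * (exit y + \<beta> y) \<partial>lborel)"
      by (rule integral_mono_AE[OF _ _ key])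
        (intro Bochner_Integration.integrable_add integrable_mult_right i1 i2 integrable_\<beta> integrable_exit)+
    then show ?thesis using i1 i2 integrable_\<beta> integrable_exit by simp
  qed
  then have "(norm w)\<^sup>2 * (?\<omega>\<^sup>2 * (\<integral>y. \<integral>t. \<rho> (char_point w y t \<bullet> n) * F (char_point w y t) \<partial>lborel \<partial>lborel)
      + (\<integral>y. \<integral>t. ?\<omega> * \<psi> (char_point w y t \<bullet> n) * G (char_point w y t) \<partial>lborel \<partial>lborel))
      \<le> (norm w)\<^sup>2 * (\<bar>?\<omega>\<bar> * m * ((\<integral>y. exit y \<partial>lborel) + (\<integral>y. \<beta> y \<partial>lborel)))"
    by (rule mult_left_mono) simp
  then show "?\<omega>\<^sup>2 * (\<integral>z. \<rho> (z \<bullet> n) * F z \<partial>lborel) + (\<integral>z. ?\<omega> * \<psi> (z \<bullet> n) * G z \<partial>lborel)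
    \<le> \<bar>?\<omega>\<bar> * (\<integral>c. \<rho> c \<partial>lborel) * ((norm w)\<^sup>2 * ((\<integral>y. exit y \<partial>lborel) + (\<integral>y. \<beta> y \<partial>lborel)))"
    unfolding integral_char(1)[OF w iF] integral_char(1)[OF w iG] m_def[symmetric] by (simp add: algebra_simps)
qed

text \<open>The gain is non-negative, so the profile times the exponential of the accumulated frequency does
  not decrease.\<close>

lemma profile_le_exit:
  assumes \<nu> [measurable]: "\<nu> \<in> borel_measurable borel" and \<nu>0: "\<And>z. 0 \<le> \<nu> z" "\<And>z. \<nu> z \<le> D"
    and loss: "\<And>z. - (F z * \<nu> z) \<le> G z"
    and N: "AE y in lborel. (\<integral>\<^sup>+t. ennreal (\<nu> (char_point w y t)) \<partial>lborel) \<le> ennreal N" and N0: "0 \<le> N"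
  shows "AE y in lborel. \<forall>t\<le>R. \<beta> y + gained y t \<le> exp N * exit y"
  using sol N
proof eventually_elim
  case (elim y)
  let ?f = "\<lambda>t. \<beta> y + gained y t" and ?g = "\<lambda>t. G (char_point w y t)"
  define r where "r t = indicator {-R..} t * \<nu> (char_point w y t)" for t
  define A where "A t = 0 + (LINT s:{-R..t}|lborel. r s)" for t
  have [measurable]: "r \<in> borel_measurable borel" unfolding r_def by measurable
  have D0: "0 \<le> D" using \<nu>0[of 0] by linarith
  have rb: "0 \<le> r t" "\<bar>r t\<bar> \<le> D" for t using \<nu>0[of "char_point w y t"] D0 by (auto simp: r_def indicator_def)
  have pA: "bounded_primitive A r"
    unfolding A_def[abs_def] by (rule bounded_primitive_from[OF _ rb(2)]) (auto simp: r_def)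
  have A01: "A t \<in> {0..N}" for t
  proof -
    have "0 \<le> A t" unfolding A_def set_lebesgue_integral_def
      by (simp, intro Bochner_Integration.integral_nonneg) (simp add: rb)
    moreover have "ennreal (A t) \<le> ennreal N"
    proof -
      have "set_integrable lborel {-R..t} r" by (rule set_integrable_bounded_Icc[OF _ rb(2)]) simp
      then have "ennreal (A t) = (\<integral>\<^sup>+s. ennreal (indicator {-R..t} s *\<^sub>R r s) \<partial>lborel)"
        unfolding A_def set_lebesgue_integral_def set_integrable_def
        by (subst nn_integral_eq_integral) (auto simp: rb)
      also have "\<dots> \<le> (\<integral>\<^sup>+t. ennreal (\<nu> (char_point w y t)) \<partial>lborel)"
        by (intro nn_integral_mono ennreal_leI) (use \<nu>0 in \<open>auto simp: r_def indicator_def\<close>)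
      finally show ?thesis using elim(2) by (rule order_trans)
    qed
    ultimately show ?thesis using N0 by simp
  qed
  have cA: "continuous_on X A" for X by (rule bounded_primitive_continuous[OF pA])
  have lipexp: "(exp N)-lipschitz_on {0..N} exp"
  proof (rule lipschitz_onI)
    fix a b :: real assume ab: "a \<in> {0..N}" "b \<in> {0..N}"
    have "norm (exp b - exp a) \<le> exp N * norm (b - a)"
      by (rule field_differentiable_bound[of "{0..N}" exp exp]) (use ab in \<open>auto intro: DERIV_exp has_field_derivative_at_within\<close>)
    then show "dist (exp a) (exp b) \<le> exp N * dist a b" by (simp add: dist_real_def abs_minus_commute)
  qed simp
  have pE: "bounded_primitive (\<lambda>t. exp (A t)) (\<lambda>t. exp (A t) * r t)"
    unfolding bounded_primitive_def
  proof (intro conjI allI impI exI)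
    have [measurable]: "A \<in> borel_measurable borel" using cA by (rule borel_measurable_continuous_onI)
    show "(\<lambda>t. exp (A t) * r t) \<in> borel_measurable borel" by measurable
    show "\<bar>exp (A t) * r t\<bar> \<le> exp N * D" for t
      using A01[of t] rb[of t] by (auto simp: abs_mult intro!: mult_mono)
    show "exp (A t) - exp (A s) = integral {s..t} (\<lambda>t. exp (A t) * r t)" if "s \<le> t" for s t
      by (rule bounded_primitive_chain(1)[OF pA that, of "{0..N}" exp exp, OF _ _ _ lipexp])
        (use A01 in \<open>auto intro: DERIV_exp has_field_derivative_at_within\<close>)
  qed
  show ?case
  proof (intro allI impI)
    fix t assume t: "t \<le> R"
    have "exp (A R) * ?f R - exp (A t) * ?f t = integral {t..R} (\<lambda>s. exp (A s) * r s * ?f s + exp (A s) * ?g s)"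
      and int: "(\<lambda>s. exp (A s) * r s * ?f s + exp (A s) * ?g s) integrable_on {t..R}"
      using bounded_primitive_product[OF primitive pE t] by auto
    moreover have "0 \<le> integral {t..R} (\<lambda>s. exp (A s) * r s * ?f s + exp (A s) * ?g s)"
    proof -
      let ?h = "\<lambda>s. exp (A s) * r s * ?f s + exp (A s) * ?g s"
      have AE1: "AE s in lborel. s \<in> fibre w y \<longrightarrow> F (char_point w y s) = ?f s" using elim by simp
      have f0: "0 \<le> ?f s" for s using elim by simp
      have pos: "AE s in lborel. 0 \<le> ?h s"
        using AE1
      proof eventually_elim
        case (elim s)
        show ?case
        proof (cases "s \<in> fibre w y")
          case True
          then have "r s = \<nu> (char_point w y s)" using R[OF True] by (auto simp: r_def indicator_def)
          then have "0 \<le> r s * ?f s + ?g s" using loss[of "char_point w y s"] elim True by (simp add: mult.commute)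
          then have "0 \<le> exp (A s) * (r s * ?f s + ?g s)" by (intro mult_nonneg_nonneg) auto
          then show ?thesis by (simp add: distrib_left mult.assoc)
        next
          case False
          then show ?thesis using G_line(2)[OF False] f0[of s] rb[of s] by simp
        qed
      qed
      have si: "set_integrable lborel {t..R} ?h"
      proof -
        have [measurable]: "A \<in> borel_measurable borel" using cA by (rule borel_measurable_continuous_onI)
        have 1: "set_integrable lborel {t..R} (\<lambda>s. (exp (A s) * ?f s) * r s)"
          by (rule continuous_times_bounded_set_integrable[OF _ _ rb(2)])
            (auto intro!: continuous_on_mult continuous_on_exp cA bounded_primitive_continuous[OF primitive])
        have 2: "set_integrable lborel {t..R} (\<lambda>s. exp (A s) * ?g s)"
          by (rule continuous_times_bounded_set_integrable[OF _ G_line(1) GK]) (auto intro!: continuous_on_exp cA)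
        show ?thesis using set_integral_add(1)[OF 1 2] by (simp add: mult_ac)
      qed
      have "integral {t..R} ?h = (LINT s:{t..R}|lborel. ?h s)"
        by (rule set_borel_integral_eq_integral(2)[OF si, symmetric])
      also have "0 \<le> \<dots>" unfolding set_lebesgue_integral_def
        by (rule integral_nonneg_AE) (use pos in eventually_elim, simp add: indicator_def)
      finally show ?thesis .
    qed
    ultimately have "exp (A t) * ?f t \<le> exp (A R) * exit y" by (simp add: exit_def)
    moreover have "?f t \<le> exp (A t) * ?f t"
    proof -
      have "1 * ?f t \<le> exp (A t) * ?f t" by (rule mult_right_mono) (use A01[of t] elim in auto)
      then show ?thesis by simp
    qed
    moreover have "exp (A R) * exit y \<le> exp N * exit y"
      by (rule mult_right_mono) (use A01[of R] elim in \<open>auto simp: exit_def\<close>)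
    ultimately show "?f t \<le> exp N * exit y" by linarith
  qed
qed

lemma tail_le_exit_tail:
  assumes D: "AE y in lborel. \<forall>t\<le>R. \<beta> y + gained y t \<le> D * exit y" and D1: "1 \<le> D"
  shows "(\<integral>z. (if D * c < F z then F z else 0) \<partial>lborel)
    \<le> (norm w)\<^sup>2 * (2 * R * D) * (\<integral>y. (if c < exit y then exit y else 0) \<partial>lborel)"
proof -
  let ?h = "\<lambda>z. if D * c < F z then F z else 0" and ?e = "\<lambda>y. if c < exit y then exit y else 0"
  have i: "integrable lborel ?h"
    by (rule Bochner_Integration.integrable_bound[OF Fint]) (auto simp: Fnn)
  have ie: "integrable lborel ?e"
    by (rule Bochner_Integration.integrable_bound[OF integrable_exit]) auto
  have "AE y in lborel. (\<integral>t. ?h (char_point w y t) \<partial>lborel) \<le> 2 * R * D * ?e y"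
    using D sol integral_char(3)[OF w i] profile_bounds
  proof eventually_elim
    case (elim y)
    have "AE t in lborel. t \<in> fibre w y \<longrightarrow> F (char_point w y t) = \<beta> y + gained y t" using elim by simp
    then have le: "AE t in lborel. ?h (char_point w y t) \<le> indicator {-R..R} t * (D * ?e y)"
    proof eventually_elim
      case (elim t)
      show ?case
      proof (cases "t \<in> fibre w y")
        case True
        then have tR: "t \<in> {-R..R}" using R[OF True] by (auto simp: abs_less_iff)
        have Fle: "F (char_point w y t) \<le> D * exit y" using elim True \<open>\<forall>t\<le>R. _\<close> tR by auto
        show ?thesis
        proof (cases "c < exit y")
          case True
          then show ?thesis using Fle tR D1 \<open>_ \<and> 0 \<le> exit y \<and> _\<close> by auto
        next
          case False
          then have "D * exit y \<le> D * c" using D1 by (intro mult_left_mono) auto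
          then show ?thesis using Fle False by simp
        qed
      next
        case False
        then show ?thesis using F0[of "char_point w y t"] D1 \<open>_ \<and> 0 \<le> exit y \<and> _\<close> by (auto simp: fibre_def)
      qed
    qed
    have "(\<integral>t. ?h (char_point w y t) \<partial>lborel) \<le> (\<integral>t. indicator {-R..R} t * (D * ?e y) \<partial>lborel)"
      by (rule integral_mono_AE[OF elim(3) _ le]) (simp add: emeasure_lborel_Icc_eq)
    also have "\<dots> = 2 * R * D * ?e y" using R0 by simp
    finally show ?case .
  qed
  then have "(\<integral>y. \<integral>t. ?h (char_point w y t) \<partial>lborel \<partial>lborel) \<le> (\<integral>y. 2 * R * D * ?e y \<partial>lborel)"
    by (rule integral_mono_AE[OF integral_char(2)[OF w i], rotated]) (intro integrable_mult_right ie)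
  also have "\<dots> = 2 * R * D * (\<integral>y. ?e y \<partial>lborel)" by simp
  finally show ?thesis unfolding integral_char(1)[OF w i] mult.assoc[of "(norm w)\<^sup>2"] by (intro mult_left_mono) auto
qed
end

section \<open>Collision invariants and entropy production\<close>

text \<open>The argument \<open>T\<close> stands for the truncated densities at a point.\<close>

definition collision :: "('i::finite \<Rightarrow> 'i \<Rightarrow> 'i \<Rightarrow> 'i \<Rightarrow> real) \<Rightarrow> ('i \<Rightarrow> real) \<Rightarrow> 'i \<Rightarrow> real" where
  "collision \<Gamma> T i = (\<Sum>j\<in>UNIV. \<Sum>l\<in>UNIV. \<Sum>m\<in>UNIV. \<Gamma> i j l m * (T l * T m - T i * T j))"

text \<open>The two exchanges \<open>i \<leftrightarrow> j\<close> and \<open>(i, j) \<leftrightarrow> (l,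
  m)\<close>, under which the coefficients are symmetric, produce the four terms.\<close>

lemma collision_weak_form:
  assumes "discrete_velocity_model v \<Gamma>"
  shows "4 * (\<Sum>i\<in>UNIV. \<phi> i * collision \<Gamma> T i)
    = (\<Sum>i\<in>UNIV. \<Sum>j\<in>UNIV. \<Sum>l\<in>UNIV. \<Sum>m\<in>UNIV.
        \<Gamma> i j l m * (\<phi> i + \<phi> j - \<phi> l - \<phi> m) * (T l * T m - T i * T j))"
proof -
  have sym: "\<Gamma> j i l m = \<Gamma> i j l m" "\<Gamma> l m i j = \<Gamma> i j l m" for i j l m
    using assms by (metis discrete_velocity_model_def)+
  define S where "S \<psi> = (\<Sum>i\<in>UNIV. \<Sum>j\<in>UNIV. \<Sum>l\<in>UNIV. \<Sum>m\<in>UNIV. \<Gamma> i j l m * \<psi> i j l m * (T l * T m - T i * T j))"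
    for \<psi> :: "'a \<Rightarrow> 'a \<Rightarrow> 'a \<Rightarrow> 'a \<Rightarrow> real"
  have "S (\<lambda>i j l m. \<phi> j) = (\<Sum>j\<in>UNIV. \<Sum>i\<in>UNIV. \<Sum>l\<in>UNIV. \<Sum>m\<in>UNIV. \<Gamma> i j l m * \<phi> j * (T l * T m - T i * T j))"
    unfolding S_def by (rule sum.swap)
  also have "\<dots> = S (\<lambda>i j l m. \<phi> i)" unfolding S_def by (simp add: sym mult.commute)
  finally have s1: "S (\<lambda>i j l m. \<phi> j) = S (\<lambda>i j l m. \<phi> i)" .
  have swap: "(\<Sum>i\<in>UNIV. \<Sum>j\<in>UNIV. \<Sum>l\<in>UNIV. \<Sum>m\<in>UNIV. G i j l m)
      = (\<Sum>i\<in>UNIV. \<Sum>j\<in>UNIV. \<Sum>l\<in>UNIV. \<Sum>m\<in>UNIV. G l m i j)" for G :: "'a \<Rightarrow> 'a \<Rightarrow> 'a \<Rightarrow> 'a \<Rightarrow> real"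
  proof -
    have c: "(\<Sum>i\<in>UNIV. \<Sum>j\<in>UNIV. g i j) = (\<Sum>p\<in>UNIV. g (fst p) (snd p))"
      for g :: "'a \<Rightarrow> 'a \<Rightarrow> real"
      by (simp only: sum.cartesian_product case_prod_unfold UNIV_Times_UNIV)
    have "(\<Sum>i\<in>UNIV. \<Sum>j\<in>UNIV. \<Sum>l\<in>UNIV. \<Sum>m\<in>UNIV. G i j l m)
      = (\<Sum>p\<in>UNIV. \<Sum>q\<in>UNIV. G (fst p) (snd p) (fst q) (snd q))"
      by (simp only: c)
    also have "\<dots> = (\<Sum>q\<in>UNIV. \<Sum>p\<in>UNIV. G (fst p) (snd p) (fst q) (snd q))"
      by (rule sum.swap)
    also have "\<dots> = (\<Sum>i\<in>UNIV. \<Sum>j\<in>UNIV. \<Sum>l\<in>UNIV. \<Sum>m\<in>UNIV. G l m i j)"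
      by (simp only: c)
    finally show ?thesis .
  qed
  have sw: "S \<psi> = - S (\<lambda>i j l m. \<psi> l m i j)" for \<psi>
  proof -
    have "S \<psi> = (\<Sum>i\<in>UNIV. \<Sum>j\<in>UNIV. \<Sum>l\<in>UNIV. \<Sum>m\<in>UNIV. \<Gamma> l m i j * \<psi> l m i j * (T i * T j - T l * T m))"
      unfolding S_def by (rule swap)
    also have "\<dots> = - S (\<lambda>i j l m. \<psi> l m i j)"
      unfolding S_def sum_negf[symmetric] by (simp add: sym algebra_simps)
    finally show ?thesis .
  qed
  have "(\<Sum>i\<in>UNIV. \<phi> i * collision \<Gamma> T i) = S (\<lambda>i j l m. \<phi> i)"
    unfolding S_def collision_def sum_distrib_left by (simp add: mult_ac)
  then have "4 * (\<Sum>i\<in>UNIV. \<phi> i * collision \<Gamma> T i)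
    = S (\<lambda>i j l m. \<phi> i) + S (\<lambda>i j l m. \<phi> j) - S (\<lambda>i j l m. \<phi> l) - S (\<lambda>i j l m. \<phi> m)"
    using s1 sw[of "\<lambda>i j l m. \<phi> i"] sw[of "\<lambda>i j l m. \<phi> j"] by simp
  also have "\<dots> = S (\<lambda>i j l m. \<phi> i + \<phi> j - \<phi> l - \<phi> m)"
    unfolding S_def by (simp add: sum.distrib[symmetric] sum_subtractf[symmetric] algebra_simps)
  finally show ?thesis unfolding S_def .
qed

lemma collision_invariant:
  assumes "discrete_velocity_model v \<Gamma>"
    and "\<And>i j l m. \<Gamma> i j l m \<noteq> 0 \<Longrightarrow> \<phi> i + \<phi> j = \<phi> l + \<phi> m"
  shows "(\<Sum>i\<in>UNIV. \<phi> i * collision \<Gamma> T i) = 0"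
proof -
  have "\<Gamma> i j l m * (\<phi> i + \<phi> j - \<phi> l - \<phi> m) = 0" for i j l m
    using assms(2)[of i j l m] by (cases "\<Gamma> i j l m = 0") auto
  then have "4 * (\<Sum>i\<in>UNIV. \<phi> i * collision \<Gamma> T i) = 0"
    unfolding collision_weak_form[OF assms(1)] by (simp only: mult_zero_left sum.neutral_const)
  then show ?thesis by simp
qed

lemma collision_mass: "discrete_velocity_model v \<Gamma> \<Longrightarrow> (\<Sum>i\<in>UNIV. collision \<Gamma> T i) = 0"
  using collision_invariant[of v \<Gamma> "\<lambda>_. 1"] by simp

lemma collision_momentum:
  assumes "discrete_velocity_model v \<Gamma>"
  shows "(\<Sum>i\<in>UNIV. (v i \<bullet> n) * collision \<Gamma> T i) = 0"
proof (rule collision_invariant[OF assms])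
  fix i j l m assume "\<Gamma> i j l m \<noteq> 0"
  then have "v i + v j = v l + v m" using assms by (auto simp: discrete_velocity_model_def)
  then show "v i \<bullet> n + v j \<bullet> n = v l \<bullet> n + v m \<bullet> n" by (simp add: inner_add_left[symmetric])
qed

text \<open>For \<open>\<delta> = 0\<close> each term is the product of a difference of logarithms with the
  opposite difference of their arguments. The shift by \<open>\<delta>\<close> keeps the logarithm finite at
  0; it changes the second factor by at most \<open>2 k \<delta>\<close>.\<close>

lemma collision_entropy:
  fixes v :: "'i::finite \<Rightarrow> real^2"
  assumes \<Gamma>: "discrete_velocity_model v \<Gamma>" and T: "\<And>i. 0 \<le> T i" "\<And>i. T i \<le> k"
    and d: "0 < \<delta>" "\<delta> \<le> 1"
  shows "(\<Sum>i\<in>UNIV. ln (T i + \<delta>) * collision \<Gamma> T i)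
    \<le> (\<Sum>i\<in>UNIV. \<Sum>j\<in>UNIV. \<Sum>l\<in>UNIV. \<Sum>m\<in>UNIV. \<Gamma> i j l m) * (2 * k * \<delta> * (k + 1 - ln \<delta>))"
proof -
  have G0: "0 \<le> \<Gamma> i j l m" for i j l m using \<Gamma> by (auto simp: discrete_velocity_model_def)
  have k0: "0 \<le> k" using T order_trans by blast
  let ?S = "\<lambda>i. T i + \<delta>"
  have S: "0 < ?S i" for i using T(1)[of i] d by linarith
  have lnS: "\<bar>ln (?S i)\<bar> \<le> k + 1 - ln \<delta>" for i
  proof -
    have "ln (?S i) \<le> ?S i - 1" using S[of i] by (rule ln_le_minus_one)
    moreover have "ln \<delta> \<le> ln (?S i)" using T(1)[of i] d S[of i] by simp
    moreover have "ln \<delta> \<le> 0" using d by simp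
    ultimately show ?thesis using T(2)[of i] d k0 by linarith
  qed
  have lnd: "0 \<le> k + 1 - ln \<delta>" using lnS[of undefined] by linarith
  have pw: "(ln (?S i) + ln (?S j) - ln (?S l) - ln (?S m)) * (T l * T m - T i * T j)
      \<le> 4 * (2 * k * \<delta> * (k + 1 - ln \<delta>))" (is "?L * _ \<le> _") for i j l m
  proof -
    define A where "A = ?S i * ?S j"
    define B where "B = ?S l * ?S m"
    have AB: "0 < A" "0 < B" using S by (simp_all add: A_def B_def)
    have L: "?L = ln A - ln B" using S[of i] S[of j] S[of l] S[of m]
      by (simp add: A_def B_def ln_mult)
    have le0: "(ln A - ln B) * (B - A) \<le> 0"
      using AB by (cases "A \<le> B") (auto simp: mult_nonpos_nonneg mult_nonneg_nonpos)
    have T2: "T l * T m - T i * T j = (B - A) - \<delta> * (T l + T m - T i - T j)"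
      by (simp add: A_def B_def algebra_simps)
    have "\<bar>T l + T m - T i - T j\<bar> \<le> 2 * k" using T[of i] T[of j] T[of l] T[of m] by linarith
    moreover have "\<bar>?L\<bar> \<le> 4 * (k + 1 - ln \<delta>)"
      using lnS[of i] lnS[of j] lnS[of l] lnS[of m] by (smt (verit))
    ultimately have "\<bar>?L * (\<delta> * (T l + T m - T i - T j))\<bar> \<le> (4 * (k + 1 - ln \<delta>)) * (\<delta> * (2 * k))"
      unfolding abs_mult using d lnd by (intro mult_mono) auto
    then have "- (?L * (\<delta> * (T l + T m - T i - T j))) \<le> 4 * (2 * k * \<delta> * (k + 1 - ln \<delta>))"
      by (simp add: mult_ac)
    then show ?thesis using le0 unfolding T2 L by (simp add: right_diff_distrib)
  qed
  have "4 * (\<Sum>i\<in>UNIV. ln (?S i) * collision \<Gamma> T i)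
    \<le> (\<Sum>i\<in>UNIV. \<Sum>j\<in>UNIV. \<Sum>l\<in>UNIV. \<Sum>m\<in>UNIV. \<Gamma> i j l m * (4 * (2 * k * \<delta> * (k + 1 - ln \<delta>))))"
    unfolding collision_weak_form[OF \<Gamma>] mult.assoc[of "\<Gamma> _ _ _ _"]
    by (intro sum_mono mult_left_mono pw G0)
  also have "\<dots> = 4 * ((\<Sum>i\<in>UNIV. \<Sum>j\<in>UNIV. \<Sum>l\<in>UNIV. \<Sum>m\<in>UNIV. \<Gamma> i j l m) * (2 * k * \<delta> * (k + 1 - ln \<delta>)))"
    unfolding sum_distrib_right[symmetric] by simp
  finally show ?thesis by (simp only: mult_le_cancel_left_pos zero_less_numeral)
qed

section \<open>The entropy of the truncated model\<close>

lemma trunc_bounds: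
  assumes "0 \<le> x" "1 \<le> k"
  shows "0 \<le> trunc k x" "trunc k x \<le> real k" "trunc k x \<le> x"
proof -
  have p: "0 < 1 + x / real k" using assms by (simp add: add_pos_nonneg)
  show "0 \<le> trunc k x" unfolding trunc_def using assms p by simp
  show "trunc k x \<le> real k" unfolding trunc_def using assms p by (simp add: divide_le_eq distrib_left)
  show "trunc k x \<le> x" unfolding trunc_def using assms p
    by (simp add: divide_le_eq mult_le_cancel_left1)
qed

lemma trunc_mono:
  assumes "0 \<le> x" "x \<le> y" "1 \<le> k"
  shows "trunc k x \<le> trunc k y"
proof -
  have "0 < 1 + x / real k" "0 < 1 + y / real k" using assms by (simp_all add: add_pos_nonneg)
  moreover have "x * (1 + y / r) \<le> y * (1 + x / r)" for r
    using assms(2) by (simp only: distrib_left mult_1_right times_divide_eq_right mult.commute[of y x] add_right_mono)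
  moreover have "x / p \<le> y / q" if "0 < p" "0 < q" "x * q \<le> y * p" for p q
    using that by (simp add: pos_divide_le_eq pos_le_divide_eq)
  ultimately show ?thesis unfolding trunc_def by blast
qed

text \<open>The primitive of \<open>ln (trunc k x + \<delta>)\<close> that vanishes at 0, in closed
  form.\<close>

definition entropy :: "nat \<Rightarrow> real \<Rightarrow> real \<Rightarrow> real" where
  "entropy k \<delta> x = ((\<delta> + (1 + \<delta> / real k) * x) * ln (\<delta> + (1 + \<delta> / real k) * x) - \<delta> * ln \<delta>) / (1 + \<delta> / real k)
    - (real k + x) * ln (1 + x / real k)"

lemma entropy_derivative:
  assumes x: "0 \<le> x" and k: "1 \<le> k" and d: "0 < \<delta>"
  shows "(entropy k \<delta> has_real_derivative ln (trunc k x + \<delta>)) (at x)"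
proof -
  define c where "c = 1 + \<delta> / real k"
  have c: "0 < c" using d k by (simp add: c_def add_pos_nonneg)
  have p: "0 < \<delta> + c * x" "0 < 1 + x / real k" using x d c k by (simp_all add: add_pos_nonneg)
  have aff: "((\<lambda>x. a + b * x) has_real_derivative b) (at x)" for a b by (auto intro!: derivative_eq_intros)
  have xlnx: "((\<lambda>x. (a + b * x) * ln (p + q * x)) has_real_derivative
      b * ln (p + q * x) + 1 / (p + q * x) * q * (a + b * x)) (at x)" if "0 < p + q * x" for a b p q
    by (rule DERIV_mult[OF aff DERIV_chain2[OF DERIV_ln_divide[OF that] aff]])
  have "((\<lambda>x. ((\<delta> + c * x) * ln (\<delta> + c * x) - \<delta> * ln \<delta>) / c - (real k + 1 * x) * ln (1 + (1 / real k) * x))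
      has_real_derivative (c * ln (\<delta> + c * x) + 1 / (\<delta> + c * x) * c * (\<delta> + c * x) - 0) / c
        - (1 * ln (1 + (1 / real k) * x) + 1 / (1 + (1 / real k) * x) * (1 / real k) * (real k + 1 * x))) (at x)"
    by (rule DERIV_diff[OF DERIV_cdivide[OF DERIV_diff[OF xlnx DERIV_const]] xlnx]) (use p in simp_all)
  then have D: "((\<lambda>x. ((\<delta> + c * x) * ln (\<delta> + c * x) - \<delta> * ln \<delta>) / c - (real k + x) * ln (1 + x / real k))
      has_real_derivative (c * ln (\<delta> + c * x) + (\<delta> + c * x) * (c / (\<delta> + c * x))) / c
        - (ln (1 + x / real k) + (real k + x) * ((1 / real k) / (1 + x / real k)))) (at x)"
    by (simp add: mult.commute)
  have "(c * l + q * (c / q)) / c = l + 1" if "0 < q" for l q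
    using c that by (simp add: add_divide_distrib)
  then have e1: "(c * ln (\<delta> + c * x) + (\<delta> + c * x) * (c / (\<delta> + c * x))) / c = ln (\<delta> + c * x) + 1"
    using p(1) by blast
  have "(K * q) * ((1 / K) / q) = 1" if "0 < q" "0 < K" for q K :: real using that by simp
  then have "(real k * (1 + x / real k)) * ((1 / real k) / (1 + x / real k)) = 1" using p(2) k by simp
  moreover have "real k * (1 + x / real k) = real k + x" using k by (simp add: distrib_left)
  ultimately have e2: "(real k + x) * ((1 / real k) / (1 + x / real k)) = 1" by (simp only:)
  have e3: "ln (trunc k x + \<delta>) = ln (\<delta> + c * x) - ln (1 + x / real k)"
  proof -
    have "\<delta> + c * x = \<delta> * (1 + x / real k) + x" by (simp add: c_def algebra_simps)
    moreover have "(\<delta> * q + x) / q = \<delta> + x / q" if "0 < q" for q using that by (simp add: add_divide_distrib)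
    ultimately have "(\<delta> + c * x) / (1 + x / real k) = \<delta> + x / (1 + x / real k)" using p(2) by metis
    then have "trunc k x + \<delta> = (\<delta> + c * x) / (1 + x / real k)"
      by (simp only: trunc_def add.commute)
    then show ?thesis by (simp only: ln_divide_pos[OF p])
  qed
  show ?thesis unfolding entropy_def[abs_def] c_def[symmetric]
    by (rule DERIV_cong[OF D], unfold e1 e2 e3) simp
qed

lemma entropy_zero: "entropy k \<delta> 0 = 0" by (simp add: entropy_def)

lemma measurable_entropy: "entropy k \<delta> \<in> borel_measurable borel"
  unfolding entropy_def[abs_def] by measurable

lemma entropy_increment:
  assumes "0 \<le> x" "x \<le> y" "1 \<le> k" "0 < \<delta>"
    and "\<And>z. x \<le> z \<Longrightarrow> z \<le> y \<Longrightarrow> m \<le> ln (trunc k z + \<delta>)"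
  shows "m * (y - x) \<le> entropy k \<delta> y - entropy k \<delta> x"
proof (cases "x = y")
  case False
  then have "\<exists>z>x. z < y \<and> entropy k \<delta> y - entropy k \<delta> x = (y - x) * ln (trunc k z + \<delta>)"
    using assms by (intro MVT2 entropy_derivative) auto
  then obtain z where z: "x < z" "z < y" "entropy k \<delta> y - entropy k \<delta> x = (y - x) * ln (trunc k z + \<delta>)" by auto
  then show ?thesis using assms(5)[of z] assms(2) by (simp add: mult.commute mult_left_mono)
qed simp

lemma entropy_upper:
  assumes x: "0 \<le> x" and k: "1 \<le> k" and d: "0 < \<delta>" "\<delta> \<le> 1"
  shows "entropy k \<delta> x \<le> x * ln (1 + x)"
proof (cases "x = 0")
  case False
  then have "\<exists>z>0. z < x \<and> entropy k \<delta> x - entropy k \<delta> 0 = (x - 0) * ln (trunc k z + \<delta>)"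
    using assms by (intro MVT2 entropy_derivative) auto
  then obtain z where z: "0 < z" "z < x" "entropy k \<delta> x = x * ln (trunc k z + \<delta>)" by (auto simp: entropy_zero)
  have "ln (trunc k z + \<delta>) \<le> ln (1 + x)"
    using trunc_bounds[of z k] z d k by (intro ln_mono) auto
  then show ?thesis using z(3) x by (simp add: mult_left_mono)
qed (simp add: entropy_zero)

text \<open>Near 0 the closed form is estimated with \<open>y ln y \<ge> y - 1\<close>; from 2 on the
  derivative is non-negative.\<close>

lemma entropy_lower:
  assumes x: "0 \<le> x" and k: "4 \<le> k" and d: "0 < \<delta>" "\<delta> \<le> 1"
  shows "-2 \<le> entropy k \<delta> x"
proof -
  have xlnx: "y - 1 \<le> y * ln y" if "0 < y" for y :: real
  proof -
    have "ln (1 / y) \<le> 1 / y - 1" using that by (intro ln_le_minus_one) simp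
    then have "1 - 1 / y \<le> ln y" using that by (simp add: ln_div)
    then have "y * (1 - 1 / y) \<le> y * ln y" using that by (intro mult_left_mono) auto
    then show ?thesis using that by (simp add: right_diff_distrib)
  qed
  have small: "-2 \<le> entropy k \<delta> x" if x2: "0 \<le> x" "x \<le> 2" for x
  proof -
    define c where "c = 1 + \<delta> / real k"
    have c: "1 \<le> c" using d k by (simp add: c_def)
    have "\<delta> + c * x - 1 \<le> (\<delta> + c * x) * ln (\<delta> + c * x)"
      using x2 d c by (intro xlnx) (simp add: add_pos_nonneg)
    moreover have "0 \<le> - (\<delta> * ln \<delta>)" using d by (simp add: mult_nonneg_nonpos)
    ultimately have "c * x - 1 \<le> (\<delta> + c * x) * ln (\<delta> + c * x) - \<delta> * ln \<delta>" using d by linarith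
    then have "(c * x - 1) / c \<le> ((\<delta> + c * x) * ln (\<delta> + c * x) - \<delta> * ln \<delta>) / c" using c by (intro divide_right_mono) auto
    moreover have "x - 1 \<le> (c * x - 1) / c" using c by (simp add: field_simps)
    moreover have "(real k + x) * ln (1 + x / real k) \<le> x + 1"
    proof -
      have "(real k + x) * ln (1 + x / real k) \<le> (real k + x) * (x / real k)"
        using x2 k by (intro mult_left_mono ln_add_one_self_le_self) auto
      also have "\<dots> = x + x * x / real k" using k by (simp add: field_simps)
      also have "x * x / real k \<le> 1"
      proof -
        have "x * x \<le> 2 * 2" using x2 by (intro mult_mono) auto
        also have "\<dots> \<le> real k" using k by simp
        finally show ?thesis using k by simp
      qed
      finally show ?thesis by simp
    qed
    ultimately show ?thesis unfolding entropy_def c_def[symmetric] by linarith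
  qed
  show ?thesis
  proof (cases "x \<le> 2")
    case True then show ?thesis using small x by simp
  next
    case False
    have "0 * (x - 2) \<le> entropy k \<delta> x - entropy k \<delta> 2"
    proof (rule entropy_increment)
      fix z assume "(2::real) \<le> z"
      then have "trunc k 2 \<le> trunc k z" using k by (intro trunc_mono) auto
      moreover have "1 \<le> trunc k 2" unfolding trunc_def using k by (simp add: field_simps)
      ultimately show "0 \<le> ln (trunc k z + \<delta>)" using d by (intro ln_ge_zero) linarith
    qed (use False k d in auto)
    then show ?thesis using small[of 2] by simp
  qed
qed

text \<open>The truncated density is at least \<open>M / 2\<close> above \<open>M\<close>, provided that
  \<open>k\<close> is at least \<open>M\<close>. For a fixed \<open>k\<close> the growth is only linear with
  the factor \<open>ln k\<close>.\<close>

lemma entropy_superlinear: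
  assumes M: "4 \<le> M" "M \<le> real k" and x: "2 * M < x" and d: "0 < \<delta>" "\<delta> \<le> 1"
  shows "(x / 2) * ln (M / 2) \<le> entropy k \<delta> x + 2"
proof -
  have k: "4 \<le> k" using M by linarith
  have ln0: "0 \<le> ln (M / 2)" using M by (intro ln_ge_zero) simp
  have "ln (M / 2) * (x - M) \<le> entropy k \<delta> x - entropy k \<delta> M"
  proof (rule entropy_increment)
    fix z assume z: "M \<le> z"
    have "M / 2 \<le> trunc k M"
      unfolding trunc_def using M by (intro divide_left_mono) (auto simp: divide_le_eq_1 add_pos_nonneg)
    also have "\<dots> \<le> trunc k z" using z M k by (intro trunc_mono) auto
    finally show "ln (M / 2) \<le> ln (trunc k z + \<delta>)" using M d by (intro ln_mono) auto
  qed (use M x k d in auto)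
  moreover have "ln (M / 2) * (x / 2) \<le> ln (M / 2) * (x - M)" using x ln0 by (intro mult_left_mono) auto
  moreover have "-2 \<le> entropy k \<delta> M" using M k d by (intro entropy_lower) auto
  ultimately show ?thesis by (simp add: mult.commute)
qed

lemma trunc_increment:
  assumes "0 \<le> x" "x \<le> y" "1 \<le> k"
  shows "trunc k y - trunc k x \<le> y - x"
proof -
  define p where "p = 1 + x / real k"
  define q where "q = 1 + y / real k"
  have pq: "1 \<le> p" "1 \<le> q" using assms by (simp_all add: p_def q_def)
  have "y * p - x * q = y - x" by (simp add: p_def q_def algebra_simps)
  moreover have "trunc k y - trunc k x = (y * p - x * q) / (q * p)"
    unfolding trunc_def p_def[symmetric] q_def[symmetric] using pq by (intro diff_frac_eq) auto
  moreover have "(y - x) / (q * p) \<le> y - x"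
  proof -
    have "1 * 1 \<le> q * p" using pq by (intro mult_mono) auto
    then show ?thesis using assms(2) by (simp add: divide_le_eq mult_le_cancel_left1)
  qed
  ultimately show ?thesis by (simp only:)
qed

lemma entropy_lipschitz:
  assumes k: "1 \<le> k" and d: "0 < \<delta>"
  shows "(1 / \<delta>)-lipschitz_on {0..} (\<lambda>x. ln (trunc k x + \<delta>))"
proof (rule lipschitz_onI)
  have *: "\<bar>ln (trunc k y + \<delta>) - ln (trunc k x + \<delta>)\<bar> \<le> 1 / \<delta> * (y - x)" if xy: "0 \<le> x" "x \<le> y" for x y
  proof -
    define a where "a = trunc k y + \<delta>"
    define b where "b = trunc k x + \<delta>"
    have ab: "\<delta> \<le> b" "b \<le> a" "a - b \<le> y - x"
      using trunc_bounds(1)[of x k] trunc_mono[OF xy k] trunc_increment[OF xy k] xy k by (auto simp: a_def b_def)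
    have "ln (a / b) \<le> a / b - 1" using ab d by (intro ln_le_minus_one divide_pos_pos) linarith+
    also have "a / b - 1 = (a - b) / b" using ab d by (simp add: diff_divide_distrib)
    also have "\<dots> \<le> (y - x) / \<delta>" using ab d by (intro frac_le) auto
    finally have "ln a - ln b \<le> (y - x) / \<delta>" using ab d by (simp add: ln_divide_pos)
    moreover have "ln b \<le> ln a" using ab d by (intro ln_mono) auto
    ultimately show ?thesis unfolding a_def[symmetric] b_def[symmetric] by simp
  qed
  fix x y :: real assume "x \<in> {0..}" "y \<in> {0..}"
  then show "dist (ln (trunc k x + \<delta>)) (ln (trunc k y + \<delta>)) \<le> 1 / \<delta> * dist x y"
    using *[of x y] *[of y x] by (cases "x \<le> y") (auto simp: dist_real_def abs_minus_commute)
qed (use d in simp)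

lemma ln_trunc_bounded:
  assumes "0 \<le> x" "1 \<le> k" "0 < \<delta>" "\<delta> \<le> 1"
  shows "\<bar>ln (trunc k x + \<delta>)\<bar> \<le> real k - ln \<delta> + 1"
proof -
  note t = trunc_bounds[OF assms(1,2)]
  have p: "0 < trunc k x + \<delta>" using t assms by linarith
  have "ln (trunc k x + \<delta>) \<le> trunc k x + \<delta> - 1" by (rule ln_le_minus_one[OF p])
  moreover have "ln \<delta> \<le> ln (trunc k x + \<delta>)" using t assms p by simp
  moreover have "ln \<delta> \<le> 0" using assms by simp
  moreover have "\<bar>L\<bar> \<le> K - l + 1" if "L \<le> T + d - 1" "l \<le> L" "l \<le> 0" "T \<le> K" "d \<le> 1" "0 \<le> K"
    for L l T d K :: real using that by linarith
  ultimately show ?thesis using t(2) assms(4) of_nat_0_le_iff by blast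
qed

text \<open>The product \<open>\<delta> ln \<delta>\<close> tends to 0; the witness is a square, so that
  \<open>- ln e \<le> 1 / e\<close> can be applied to its root.\<close>

lemma small_regularization:
  assumes a: "0 \<le> (a::real)" and c: "0 \<le> c"
  shows "\<exists>\<delta>>0. \<delta> \<le> 1 \<and> c * (\<delta> * (a - ln \<delta>)) \<le> 1"
proof -
  define e where "e = min 1 (1 / ((c + 1) * (a + 2)))"
  have e: "0 < e" "e \<le> 1" "e \<le> 1 / ((c + 1) * (a + 2))" using a c by (auto simp: e_def intro!: divide_pos_pos mult_pos_pos)
  have "ln (1 / e) \<le> 1 / e - 1" using e by (intro ln_le_minus_one) simp
  then have "- ln e \<le> 1 / e" using e by (simp add: ln_div)
  then have l: "- ln (e\<^sup>2) \<le> 2 / e" using e by (simp add: ln_realpow)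
  have "e\<^sup>2 * (a - ln (e\<^sup>2)) \<le> e\<^sup>2 * (a + 2 / e)" using l by (intro mult_left_mono) auto
  also have "\<dots> = e * (e * a + 2)" using e by (simp add: power2_eq_square field_simps)
  also have "\<dots> \<le> e * (a + 2)" using e a by (intro mult_left_mono) (auto simp: mult_left_le_one_le)
  finally have "c * (e\<^sup>2 * (a - ln (e\<^sup>2))) \<le> c * (e * (a + 2))" using c by (rule mult_left_mono)
  also have "\<dots> \<le> (c + 1) * ((1 / ((c + 1) * (a + 2))) * (a + 2))"
    using e a c by (intro mult_mono mult_right_mono) auto
  also have "\<dots> = 1" using a c by simp
  finally show ?thesis using e by (intro exI[of _ "e\<^sup>2"]) (auto simp: power_le_one)
qed

section \<open>Bounds that do not depend on the truncation\<close>

lemma collision_bound: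
  fixes v :: "'i::finite \<Rightarrow> real^2"
  assumes "discrete_velocity_model v \<Gamma>" "\<And>i. 0 \<le> T i" "\<And>i. T i \<le> k"
  shows "\<bar>collision \<Gamma> T i\<bar> \<le> (\<Sum>i\<in>UNIV. \<Sum>j\<in>UNIV. \<Sum>l\<in>UNIV. \<Sum>m\<in>UNIV. \<Gamma> i j l m) * (k * k)"
proof -
  have G0: "0 \<le> \<Gamma> i j l m" for i j l m using assms(1) by (auto simp: discrete_velocity_model_def)
  have k0: "0 \<le> k" using assms(2,3) order_trans by blast
  have d: "\<bar>T l * T m - T i * T j\<bar> \<le> k * k" for i j l m
  proof -
    have "T a * T b \<in> {0..k * k}" for a b using assms(2,3) k0 by (auto intro!: mult_mono)
    from this[of l m] this[of i j] show ?thesis by (auto simp: abs_le_iff)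
  qed
  have "\<bar>collision \<Gamma> T i\<bar> \<le> (\<Sum>j\<in>UNIV. \<Sum>l\<in>UNIV. \<Sum>m\<in>UNIV. \<Gamma> i j l m * (k * k))"
    unfolding collision_def
    by (intro order_trans[OF sum_abs] sum_mono) (auto simp: abs_mult G0 intro!: mult_left_mono d)
  also have "\<dots> \<le> (\<Sum>i\<in>UNIV. \<Sum>j\<in>UNIV. \<Sum>l\<in>UNIV. \<Sum>m\<in>UNIV. \<Gamma> i j l m * (k * k))"
    using G0 k0 by (intro member_le_sum[of i UNIV "\<lambda>i. \<Sum>j\<in>UNIV. \<Sum>l\<in>UNIV. \<Sum>m\<in>UNIV. \<Gamma> i j l m * (k * k)"])
      (auto intro!: sum_nonneg mult_nonneg_nonneg)
  finally show ?thesis by (simp only: sum_distrib_right)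
qed

lemma sum_swap_integral:
  fixes f :: "'i::finite \<Rightarrow> 'a \<Rightarrow> real"
  assumes "\<And>i. integrable M (f i)"
  shows "(\<Sum>i\<in>UNIV. \<integral>z. f i z \<partial>M) = (\<integral>z. (\<Sum>i\<in>UNIV. f i z) \<partial>M)"
  using assms by (intro Bochner_Integration.integral_sum[symmetric]) auto

text \<open>It dominates both the mass and the entropy density, for every truncation.\<close>

definition entropy_weight :: "real \<Rightarrow> real" where "entropy_weight x = x * (1 + ln (1 + x))"

lemma collinear_perp:
  assumes "w \<noteq> 0" "x \<bullet> perp w = 0" shows "collinear {0, w, x}"
proof -
  have "x = ((x \<bullet> w) / (norm w)\<^sup>2) *\<^sub>R w"
    using char_point_surj[OF assms(1), of x] assms(2) by (simp add: char_point_def)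
  then show ?thesis using collinear_lemma by blast
qed

definition collision_total :: "('i::finite \<Rightarrow> 'i \<Rightarrow> 'i \<Rightarrow> 'i \<Rightarrow> real) \<Rightarrow> real" where
  "collision_total \<Gamma> = (\<Sum>i\<in>UNIV. \<Sum>j\<in>UNIV. \<Sum>l\<in>UNIV. \<Sum>m\<in>UNIV. \<Gamma> i j l m)"

text \<open>One truncation level \<open>k\<close>. The numbers \<open>R\<close> and \<open>M\<close> do not
  depend on it in the application, and all final bounds depend on \<open>k\<close> through the range of
  admissible levels only.\<close>

locale approximate_solution = convex_curve +
  fixes v :: "'i::finite \<Rightarrow> real^2" and \<Gamma> :: "'i \<Rightarrow> 'i \<Rightarrow> 'i \<Rightarrow> 'i \<Rightarrow> real" and k :: nat
    and F :: "'i \<Rightarrow> real^2 \<Rightarrow> real" and R :: real and \<beta> :: "'i \<Rightarrow> real \<Rightarrow> real" and M :: real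
  assumes model: "discrete_velocity_model v \<Gamma>"
    and noncollinear: "\<And>i j. interacting \<Gamma> i j \<Longrightarrow> \<not> collinear {0, v i, v j}"
    and k1: "1 \<le> k"
    and CS: "\<And>i. characteristic_solution \<Omega> L \<gamma> \<gamma>' \<gamma>'' (v i) R (F i) (\<lambda>z. collision \<Gamma> (\<lambda>j. trunc k (F j z)) i)
      (collision_total \<Gamma> * (real k * real k)) (\<beta> i) (real k / 2)"
    and inflow: "\<And>i. integrable lborel (\<lambda>y. entropy_weight (\<beta> i y))"
      "\<And>i. (norm (v i))\<^sup>2 * (\<integral>y. entropy_weight (\<beta> i y) \<partial>lborel) \<le> M"
begin

abbreviation source :: "'i \<Rightarrow> real^2 \<Rightarrow> real" where
  "source i z \<equiv> collision \<Gamma> (\<lambda>j. trunc k (F j z)) i"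

abbreviation outflow :: "'i \<Rightarrow> real \<Rightarrow> real" where
  "outflow i \<equiv> characteristic_solution.exit (v i) R (source i) (\<beta> i)"

definition speed2 :: real where "speed2 = (\<Sum>i\<in>UNIV. (norm (v i))\<^sup>2)"

definition mass :: real where "mass = real CARD('i) * M"

lemma species_characteristic: "characteristic \<Omega> L \<gamma> \<gamma>' \<gamma>'' (v i) R (F i) (source i) (collision_total \<Gamma> * (real k * real k))"
  using CS[of i] by (rule characteristic_solution.axioms(1))

lemma v_nonzero: "v i \<noteq> 0" and R_pos: "0 < R" and F_nonneg: "0 \<le> F i z"
  and F_meas [measurable]: "F i \<in> borel_measurable borel" and F_int: "integrable lborel (F i)"
  and F_outside: "z \<notin> \<Omega> \<Longrightarrow> F i z = 0"
  using characteristic.w[OF species_characteristic] characteristic.R0[OF species_characteristic] characteristic.Fnn[OF species_characteristic]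
    characteristic.Fm[OF species_characteristic] characteristic.Fint[OF species_characteristic] characteristic.F0[OF species_characteristic] by auto

lemma trunc_F: "0 \<le> trunc k (F i z)" "trunc k (F i z) \<le> real k" "trunc k (F i z) \<le> F i z"
  using trunc_bounds[OF F_nonneg k1] by auto

lemma \<beta>_nonneg: "AE y in lborel. 0 \<le> \<beta> i y" and outflow_nonneg: "AE y in lborel. 0 \<le> outflow i y"
  using characteristic_solution.profile_bounds[OF CS[of i]] by (auto elim: eventually_mono)

lemma M_nonneg: "0 \<le> M"
proof -
  have "0 \<le> (\<integral>y. entropy_weight (\<beta> i y) \<partial>lborel)" for i
    by (rule integral_nonneg_AE) (use \<beta>_nonneg[of i] in eventually_elim, auto simp: entropy_weight_def intro!: mult_nonneg_nonneg add_nonneg_nonneg)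
  then have "0 \<le> (norm (v i))\<^sup>2 * (\<integral>y. entropy_weight (\<beta> i y) \<partial>lborel)" for i by simp
  then show ?thesis using inflow(2) order_trans by blast
qed

lemma inflow_mass: "(\<Sum>i\<in>UNIV. (norm (v i))\<^sup>2 * (\<integral>y. \<beta> i y \<partial>lborel)) \<le> mass"
proof -
  have "(norm (v i))\<^sup>2 * (\<integral>y. \<beta> i y \<partial>lborel) \<le> M" for i
  proof -
    have "(\<integral>y. \<beta> i y \<partial>lborel) \<le> (\<integral>y. entropy_weight (\<beta> i y) \<partial>lborel)"
    proof (rule integral_mono_AE[OF characteristic_solution.integrable_\<beta>[OF CS] inflow(1)])
      show "AE y in lborel. \<beta> i y \<le> entropy_weight (\<beta> i y)"
        using \<beta>_nonneg[of i] by eventually_elim (simp add: entropy_weight_def mult_le_cancel_left1)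
    qed
    then have "(norm (v i))\<^sup>2 * (\<integral>y. \<beta> i y \<partial>lborel) \<le> (norm (v i))\<^sup>2 * (\<integral>y. entropy_weight (\<beta> i y) \<partial>lborel)"
      by (rule mult_left_mono) simp
    then show ?thesis using inflow(2)[of i] by linarith
  qed
  then have "(\<Sum>i\<in>UNIV. (norm (v i))\<^sup>2 * (\<integral>y. \<beta> i y \<partial>lborel)) \<le> (\<Sum>i\<in>(UNIV::'i set). M)" by (intro sum_mono)
  then show ?thesis by (simp add: mass_def)
qed

lemma outflow_mass:
  "(\<Sum>i\<in>UNIV. (norm (v i))\<^sup>2 * (\<integral>y. outflow i y \<partial>lborel)) = (\<Sum>i\<in>UNIV. (norm (v i))\<^sup>2 * (\<integral>y. \<beta> i y \<partial>lborel))"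
proof -
  have b: "integrable lborel (\<lambda>z. 1 * source i z)"
    "(norm (v i))\<^sup>2 * ((\<integral>y. outflow i y \<partial>lborel) - (\<integral>y. \<beta> i y \<partial>lborel)) = (\<integral>z. 1 * source i z \<partial>lborel)" for i
  proof -
    have d: "((\<lambda>x. x) has_real_derivative 1) (at x within {0..})" for x :: real by (rule DERIV_ident)
    have l: "0-lipschitz_on {0..} (\<lambda>x::real. 1::real)" by (rule lipschitz_onI) auto
    show "integrable lborel (\<lambda>z. 1 * source i z)"
      by (rule characteristic_solution.balance(3)[OF CS d l, of 1]) auto
    show "(norm (v i))\<^sup>2 * ((\<integral>y. outflow i y \<partial>lborel) - (\<integral>y. \<beta> i y \<partial>lborel)) = (\<integral>z. 1 * source i z \<partial>lborel)"
      by (rule characteristic_solution.balance(4)[OF CS d l, of 1]) auto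
  qed
  have "(\<Sum>i\<in>UNIV. (norm (v i))\<^sup>2 * ((\<integral>y. outflow i y \<partial>lborel) - (\<integral>y. \<beta> i y \<partial>lborel)))
      = (\<integral>z. (\<Sum>i\<in>UNIV. 1 * source i z) \<partial>lborel)"
    unfolding b(2) by (rule sum_swap_integral[OF b(1)])
  also have "\<dots> = 0" by (simp add: collision_mass[OF model])
  finally show ?thesis by (simp add: right_diff_distrib sum_subtractf)
qed

lemma flux_mass:
  "(\<Sum>i\<in>UNIV. (norm (v i))\<^sup>2 * ((\<integral>y. outflow i y \<partial>lborel) + (\<integral>y. \<beta> i y \<partial>lborel))) \<le> 2 * mass"
  using outflow_mass inflow_mass by (simp add: distrib_left sum.distrib)

text \<open>The regularization \<open>\<delta>\<close> is chosen after \<open>k\<close>, so small that the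
  error in the entropy production is at most 1 in total.\<close>

lemma outflow_entropy:
  "\<exists>\<delta>. 0 < \<delta> \<and> \<delta> \<le> 1 \<and> (\<forall>i. integrable lborel (\<lambda>y. entropy k \<delta> (outflow i y))) \<and>
    (\<Sum>i\<in>UNIV. (norm (v i))\<^sup>2 * (\<integral>y. entropy k \<delta> (outflow i y) \<partial>lborel)) \<le> mass + 1"
proof -
  define c where "c = measure lborel \<Omega> * (collision_total \<Gamma> * (2 * real k))"
  have G0: "0 \<le> \<Gamma> i j l m" for i j l m using model by (auto simp: discrete_velocity_model_def)
  have c0: "0 \<le> c" unfolding c_def collision_total_def by (intro mult_nonneg_nonneg sum_nonneg G0) auto
  obtain \<delta> where \<delta>: "0 < \<delta>" "\<delta> \<le> 1" "c * (\<delta> * (real k + 1 - ln \<delta>)) \<le> 1"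
    using small_regularization[of "real k + 1" c] c0 by auto
  let ?H = "entropy k \<delta>" and ?H' = "\<lambda>x. ln (trunc k x + \<delta>)"
  have d: "(?H has_real_derivative ?H' x) (at x within {0..})" if "0 \<le> x" for x
    using entropy_derivative[OF that k1 \<delta>(1)] by (rule has_field_derivative_at_within)
  have H'm: "?H' \<in> borel_measurable borel" unfolding trunc_def by measurable
  have H'b: "\<bar>?H' x\<bar> \<le> real k - ln \<delta> + 1" if "0 \<le> x" for x by (rule ln_trunc_bounded[OF that k1 \<delta>(1,2)])
  have bal: "integrable lborel (\<lambda>y. ?H (\<beta> i y))" "integrable lborel (\<lambda>y. ?H (outflow i y))"
    "integrable lborel (\<lambda>z. ?H' (F i z) * source i z)"
    "(norm (v i))\<^sup>2 * ((\<integral>y. ?H (outflow i y) \<partial>lborel) - (\<integral>y. ?H (\<beta> i y) \<partial>lborel))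
      = (\<integral>z. ?H' (F i z) * source i z \<partial>lborel)" for i
    using characteristic_solution.balance[where \<Phi> = ?H and \<Phi>' = ?H',
        OF CS[of i] d entropy_lipschitz[OF k1 \<delta>(1)] H'b measurable_entropy H'm entropy_zero] by blast+
  have in_le: "(norm (v i))\<^sup>2 * (\<integral>y. ?H (\<beta> i y) \<partial>lborel) \<le> M" for i
  proof -
    have "(\<integral>y. ?H (\<beta> i y) \<partial>lborel) \<le> (\<integral>y. entropy_weight (\<beta> i y) \<partial>lborel)"
    proof (rule integral_mono_AE[OF bal(1) inflow(1)])
      show "AE y in lborel. ?H (\<beta> i y) \<le> entropy_weight (\<beta> i y)"
        using \<beta>_nonneg[of i]
      proof eventually_elim
        case (elim y)
        then show ?case using entropy_upper[OF elim k1 \<delta>(1,2)] by (simp add: entropy_weight_def distrib_left)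
      qed
    qed
    then have "(norm (v i))\<^sup>2 * (\<integral>y. ?H (\<beta> i y) \<partial>lborel) \<le> (norm (v i))\<^sup>2 * (\<integral>y. entropy_weight (\<beta> i y) \<partial>lborel)"
      by (rule mult_left_mono) simp
    then show ?thesis using inflow(2)[of i] by linarith
  qed
  have "(\<Sum>i\<in>UNIV. (norm (v i))\<^sup>2 * ((\<integral>y. ?H (outflow i y) \<partial>lborel) - (\<integral>y. ?H (\<beta> i y) \<partial>lborel)))
      = (\<integral>z. (\<Sum>i\<in>UNIV. ?H' (F i z) * source i z) \<partial>lborel)"
    unfolding bal(4) by (rule sum_swap_integral[OF bal(3)])
  also have "\<dots> \<le> (\<integral>z. indicator \<Omega> z * (collision_total \<Gamma> * (2 * real k * \<delta> * (real k + 1 - ln \<delta>))) \<partial>lborel)"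
  proof (rule integral_mono)
    show "integrable lborel (\<lambda>z. \<Sum>i\<in>UNIV. ?H' (F i z) * source i z)"
      using bal(3) by (intro Bochner_Integration.integrable_sum)
    show "integrable lborel (\<lambda>z. indicator \<Omega> z * (collision_total \<Gamma> * (2 * real k * \<delta> * (real k + 1 - ln \<delta>))))"
      using characteristic_solution.domain_finite[OF CS] by (intro integrable_mult_left) (auto intro!: integrable_real_indicator)
    fix z
    show "(\<Sum>i\<in>UNIV. ?H' (F i z) * source i z) \<le> indicator \<Omega> z * (collision_total \<Gamma> * (2 * real k * \<delta> * (real k + 1 - ln \<delta>)))"
    proof (cases "z \<in> \<Omega>")
      case True
      then show ?thesis
        using collision_entropy[OF model, of "\<lambda>j. trunc k (F j z)" "real k" \<delta>] trunc_F \<delta>(1,2)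
        by (simp add: collision_total_def)
    next
      case False
      then have "source i z = 0" for i by (simp add: collision_def F_outside trunc_def)
      then show ?thesis using False by simp
    qed
  qed
  also have "\<dots> = c * (\<delta> * (real k + 1 - ln \<delta>))" by (simp add: c_def mult_ac)
  finally have "(\<Sum>i\<in>UNIV. (norm (v i))\<^sup>2 * (\<integral>y. ?H (outflow i y) \<partial>lborel))
      \<le> (\<Sum>i\<in>UNIV. (norm (v i))\<^sup>2 * (\<integral>y. ?H (\<beta> i y) \<partial>lborel)) + 1"
    using \<delta>(3) by (simp add: right_diff_distrib sum_subtractf)
  also have "(\<Sum>i\<in>UNIV. (norm (v i))\<^sup>2 * (\<integral>y. ?H (\<beta> i y) \<partial>lborel)) \<le> (\<Sum>i\<in>(UNIV::'i set). M)"
    by (intro sum_mono in_le)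
  finally have "(\<Sum>i\<in>UNIV. (norm (v i))\<^sup>2 * (\<integral>y. ?H (outflow i y) \<partial>lborel)) \<le> mass + 1" by (simp add: mass_def)
  then show ?thesis using \<delta>(1,2) bal(2) by blast
qed

text \<open>On \<open>{-R..R}\<close>, which carries the outflow, the entropy density plus 2 is non-negative.
  The bound on the sum over all species therefore bounds each of them.\<close>

lemma outflow_tail:
  assumes c: "4 \<le> c" "c \<le> real k"
  shows "(norm (v i))\<^sup>2 * (\<integral>y. (if 2 * c < outflow i y then outflow i y else 0) \<partial>lborel)
    \<le> 2 * (mass + 1 + 4 * R * speed2) / ln (c / 2)"
proof -
  obtain \<delta> where \<delta>: "0 < \<delta>" "\<delta> \<le> 1" "\<And>i. integrable lborel (\<lambda>y. entropy k \<delta> (outflow i y))"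
    "(\<Sum>i\<in>UNIV. (norm (v i))\<^sup>2 * (\<integral>y. entropy k \<delta> (outflow i y) \<partial>lborel)) \<le> mass + 1"
    using outflow_entropy by blast
  let ?I = "\<lambda>y. indicator {-R..R} y * (2::real)"
  have k4: "4 \<le> k" using c by linarith
  have ln0: "0 < ln (c / 2)" using c by (intro ln_gt_zero) simp
  have Ii: "integrable lborel ?I" "(\<integral>y. ?I y \<partial>lborel) = 4 * R"
    using R_pos by (auto intro!: integrable_mult_left integrable_real_indicator simp: emeasure_lborel_Icc_eq)
  have Z: "outflow j y = 0" if "y \<notin> {-R..R}" for j y
    using characteristic_solution.exit_empty(2)[OF CS, of y j] that by (auto simp: abs_if split: if_splits)
  have low: "AE y in lborel. 0 \<le> entropy k \<delta> (outflow j y) + ?I y" for j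
    using outflow_nonneg[of j]
  proof eventually_elim
    case (elim y)
    then show ?case using Z[of y j] entropy_lower[OF elim k4 \<delta>(1,2)]
      by (cases "y \<in> {-R..R}") (auto simp: entropy_zero)
  qed
  let ?a = "\<lambda>j. (norm (v j))\<^sup>2 * (\<integral>y. entropy k \<delta> (outflow j y) + ?I y \<partial>lborel)"
  have a0: "0 \<le> ?a j" for j using low by (intro mult_nonneg_nonneg integral_nonneg_AE) auto
  have "?a i \<le> (\<Sum>j\<in>UNIV. ?a j)" by (rule member_le_sum) (use a0 in auto)
  also have "\<dots> = (\<Sum>j\<in>UNIV. (norm (v j))\<^sup>2 * (\<integral>y. entropy k \<delta> (outflow j y) \<partial>lborel)) + 4 * R * speed2"
    using \<delta>(3) Ii by (simp add: distrib_left sum.distrib speed2_def sum_distrib_left mult.commute)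
  also have "\<dots> \<le> mass + 1 + 4 * R * speed2" using \<delta>(4) by simp
  finally have ai: "?a i \<le> mass + 1 + 4 * R * speed2" .
  let ?t = "\<lambda>y. if 2 * c < outflow i y then outflow i y else 0"
  have ti: "integrable lborel ?t"
    by (rule Bochner_Integration.integrable_bound[OF characteristic_solution.integrable_exit[OF CS]])
      (use characteristic_solution.measurable_exit[OF CS, of i] in \<open>auto\<close>)
  have "(\<integral>y. (ln (c / 2) / 2) * ?t y \<partial>lborel) \<le> (\<integral>y. entropy k \<delta> (outflow i y) + ?I y \<partial>lborel)"
  proof (rule integral_mono_AE)
    show "AE y in lborel. (ln (c / 2) / 2) * ?t y \<le> entropy k \<delta> (outflow i y) + ?I y"
      using low[of i]
    proof eventually_elim
      case (elim y)
      show ?case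
      proof (cases "2 * c < outflow i y")
        case True
        then have "y \<in> {-R..R}" using Z[of y i] c by (cases "y \<in> {-R..R}") auto
        then show ?thesis using entropy_superlinear[OF c True \<delta>(1,2)] True by (simp add: mult.commute)
      qed (use elim in simp)
    qed
  qed (use ti \<delta>(3) Ii in auto)
  then have "(norm (v i))\<^sup>2 * ((ln (c / 2) / 2) * (\<integral>y. ?t y \<partial>lborel)) \<le> ?a i"
    by (intro mult_left_mono) auto
  then have "(norm (v i))\<^sup>2 * ((ln (c / 2) / 2) * (\<integral>y. ?t y \<partial>lborel)) \<le> mass + 1 + 4 * R * speed2"
    using ai by linarith
  then have "((norm (v i))\<^sup>2 * (\<integral>y. ?t y \<partial>lborel)) * ln (c / 2) \<le> 2 * (mass + 1 + 4 * R * speed2)"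
    by (simp add: mult_ac)
  then show ?thesis using ln0 by (simp only: pos_le_divide_eq)
qed
end

text \<open>For interacting \<open>i\<close> and \<open>j\<close> the denominator is positive. If it vanishes,
  so does the numerator, and the quotient is 0.\<close>

definition damping :: "('i::finite \<Rightarrow> real^2) \<Rightarrow> ('i \<Rightarrow> 'i \<Rightarrow> 'i \<Rightarrow> 'i \<Rightarrow> real) \<Rightarrow> real" where
  "damping v \<Gamma> = (\<Sum>i\<in>UNIV. \<Sum>j\<in>UNIV. (\<Sum>l\<in>UNIV. \<Sum>m\<in>UNIV. \<Gamma> i j l m) / (v j \<bullet> perp (v i))\<^sup>2)"

context approximate_solution begin

text \<open>The density of the flux, in the direction normal to \<open>v i\<close>, of the momentum component
  normal to \<open>v i\<close>.\<close>

definition transverse_momentum :: "'i \<Rightarrow> real^2 \<Rightarrow> real" where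
  "transverse_momentum i z = (\<Sum>j\<in>UNIV. (v j \<bullet> perp (v i))\<^sup>2 * F j z)"

lemma mass_nonneg: "0 \<le> mass" using M_nonneg by (simp add: mass_def)

lemma speed2_nonneg: "0 \<le> speed2" by (simp add: speed2_def sum_nonneg)

lemma inner_le_speed2: "\<bar>v j \<bullet> perp (v i)\<bar> \<le> speed2"
proof -
  have le: "(norm (v j))\<^sup>2 \<le> speed2" for j
    unfolding speed2_def by (rule member_le_sum) auto
  have "\<bar>v j \<bullet> perp (v i)\<bar> \<le> norm (v j) * norm (v i)"
    using Cauchy_Schwarz_ineq2[of "v j" "perp (v i)"] by simp
  also have "\<dots> \<le> ((norm (v j))\<^sup>2 + (norm (v i))\<^sup>2) / 2"
    using sum_squares_bound[of "norm (v j)" "norm (v i)"] by simp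
  also have "\<dots> \<le> speed2" using le[of i] le[of j] by simp
  finally show ?thesis .
qed

text \<open>Conservation of momentum cancels the sources in the sum over the species.\<close>

lemma transverse_momentum_test:
  assumes \<rho> [measurable]: "\<rho> \<in> borel_measurable borel" and \<rho>01: "\<And>c. 0 \<le> \<rho> c" "\<And>c. \<rho> c \<le> 1"
    and supp: "\<And>c. S < \<bar>c\<bar> \<Longrightarrow> \<rho> c = 0"
  shows "(\<integral>z. \<rho> (z \<bullet> perp (v i)) * transverse_momentum i z \<partial>lborel) \<le> 2 * speed2 * mass * (\<integral>c. \<rho> c \<partial>lborel)"
    and "integrable lborel (\<lambda>z. \<rho> (z \<bullet> perp (v i)) * transverse_momentum i z)"
proof -
  let ?n = "perp (v i)"
  define \<psi> where "\<psi> c = (LINT s:{-S..c}|lborel. \<rho> s)" for c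
  note mom = characteristic_solution.momentum_inequality[where n = "perp (v i)", OF CS \<rho> \<rho>01 supp \<psi>_def]
  have eq: "\<rho> (z \<bullet> ?n) * transverse_momentum i z = (\<Sum>j\<in>UNIV. (v j \<bullet> ?n)\<^sup>2 * (\<rho> (z \<bullet> ?n) * F j z))" for z
    by (simp add: transverse_momentum_def sum_distrib_left mult.left_commute)
  show "integrable lborel (\<lambda>z. \<rho> (z \<bullet> ?n) * transverse_momentum i z)"
    unfolding eq by (intro Bochner_Integration.integrable_sum integrable_mult_right mom(3))
  have m0: "0 \<le> (\<integral>c. \<rho> c \<partial>lborel)" using \<rho>01 by (intro Bochner_Integration.integral_nonneg) auto
  have fl0: "0 \<le> (\<integral>y. outflow j y \<partial>lborel) + (\<integral>y. \<beta> j y \<partial>lborel)" for j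
    using \<beta>_nonneg outflow_nonneg by (intro add_nonneg_nonneg integral_nonneg_AE)
  have "(\<integral>z. \<rho> (z \<bullet> ?n) * transverse_momentum i z \<partial>lborel) = (\<Sum>j\<in>UNIV. (v j \<bullet> ?n)\<^sup>2 * (\<integral>z. \<rho> (z \<bullet> ?n) * F j z \<partial>lborel))"
    unfolding eq by (subst Bochner_Integration.integral_sum) (auto intro: integrable_mult_right mom(3))
  also have "\<dots> = (\<Sum>j\<in>UNIV. (v j \<bullet> ?n)\<^sup>2 * (\<integral>z. \<rho> (z \<bullet> ?n) * F j z \<partial>lborel))
      + (\<Sum>j\<in>UNIV. \<integral>z. (v j \<bullet> ?n) * \<psi> (z \<bullet> ?n) * source j z \<partial>lborel)"
  proof -
    have "(\<Sum>j\<in>UNIV. \<integral>z. (v j \<bullet> ?n) * \<psi> (z \<bullet> ?n) * source j z \<partial>lborel)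
        = (\<integral>z. (\<Sum>j\<in>UNIV. (v j \<bullet> ?n) * \<psi> (z \<bullet> ?n) * source j z) \<partial>lborel)"
      by (rule sum_swap_integral[OF mom(2)])
    also have "\<dots> = (\<integral>z. \<psi> (z \<bullet> ?n) * (\<Sum>j\<in>UNIV. (v j \<bullet> ?n) * source j z) \<partial>lborel)"
      by (simp add: sum_distrib_left mult_ac)
    also have "\<dots> = 0" by (simp add: collision_momentum[OF model])
    finally show ?thesis by simp
  qed
  also have "\<dots> = (\<Sum>j\<in>UNIV. (v j \<bullet> ?n)\<^sup>2 * (\<integral>z. \<rho> (z \<bullet> ?n) * F j z \<partial>lborel)
      + (\<integral>z. (v j \<bullet> ?n) * \<psi> (z \<bullet> ?n) * source j z \<partial>lborel))" by (simp add: sum.distrib)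
  also have "\<dots> \<le> (\<Sum>j\<in>UNIV. speed2 * (\<integral>c. \<rho> c \<partial>lborel) * ((norm (v j))\<^sup>2 * ((\<integral>y. outflow j y \<partial>lborel) + (\<integral>y. \<beta> j y \<partial>lborel))))"
  proof (rule sum_mono)
    fix j
    have "\<bar>v j \<bullet> ?n\<bar> * (\<integral>c. \<rho> c \<partial>lborel) * ((norm (v j))\<^sup>2 * ((\<integral>y. outflow j y \<partial>lborel) + (\<integral>y. \<beta> j y \<partial>lborel)))
      \<le> speed2 * (\<integral>c. \<rho> c \<partial>lborel) * ((norm (v j))\<^sup>2 * ((\<integral>y. outflow j y \<partial>lborel) + (\<integral>y. \<beta> j y \<partial>lborel)))"
      using m0 fl0[of j] by (intro mult_right_mono inner_le_speed2) auto
    then show "(v j \<bullet> ?n)\<^sup>2 * (\<integral>z. \<rho> (z \<bullet> ?n) * F j z \<partial>lborel)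
      + (\<integral>z. (v j \<bullet> ?n) * \<psi> (z \<bullet> ?n) * source j z \<partial>lborel)
      \<le> speed2 * (\<integral>c. \<rho> c \<partial>lborel) * ((norm (v j))\<^sup>2 * ((\<integral>y. outflow j y \<partial>lborel) + (\<integral>y. \<beta> j y \<partial>lborel)))"
      using mom(1)[of j] by linarith
  qed
  also have "\<dots> = speed2 * (\<integral>c. \<rho> c \<partial>lborel) * (\<Sum>j\<in>UNIV. (norm (v j))\<^sup>2 * ((\<integral>y. outflow j y \<partial>lborel) + (\<integral>y. \<beta> j y \<partial>lborel)))"
    by (simp only: sum_distrib_left)
  also have "\<dots> \<le> speed2 * (\<integral>c. \<rho> c \<partial>lborel) * (2 * mass)"
    using flux_mass m0 speed2_nonneg by (intro mult_left_mono) auto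
  finally show "(\<integral>z. \<rho> (z \<bullet> ?n) * transverse_momentum i z \<partial>lborel) \<le> 2 * speed2 * mass * (\<integral>c. \<rho> c \<partial>lborel)"
    by (simp add: mult_ac)
qed

lemma transverse_momentum_nonneg: "0 \<le> transverse_momentum i z"
  unfolding transverse_momentum_def by (intro sum_nonneg mult_nonneg_nonneg F_nonneg) auto

lemma transverse_momentum_meas [measurable]: "transverse_momentum i \<in> borel_measurable borel"
  unfolding transverse_momentum_def[abs_def] by measurable

text \<open>Tested with the indicator of a set of lines, the integrated flux is at most a constant times the
  measure of the set. Hence the lines with a larger flux form a null set.\<close>

lemma line_momentum_bound:
  "AE y in lborel. (\<integral>\<^sup>+t. ennreal (transverse_momentum i (char_point (v i) y t)) \<partial>lborel) \<le> ennreal (2 * speed2 * mass + 1)"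
proof -
  let ?w = "v i" and ?f = "transverse_momentum i"
  define C where "C = 2 * speed2 * mass"
  have C0: "0 \<le> C" using speed2_nonneg mass_nonneg by (simp add: C_def)
  define n2 where "n2 = (norm ?w)\<^sup>2"
  have n2: "0 < n2" using v_nonzero[of i] by (simp add: n2_def)
  define g where "g y = (\<integral>\<^sup>+t. ennreal (?f (char_point ?w y t)) \<partial>lborel)" for y
  have gm [measurable]: "g \<in> borel_measurable borel"
  proof -
    have "(\<lambda>p. ennreal (?f (char_point ?w (fst p) (snd p)))) \<in> borel_measurable (lborel \<Otimes>\<^sub>M lborel)"
      using measurable_compose[OF measurable_char_point(1) transverse_momentum_meas] by measurable
    from lborel.borel_measurable_nn_integral_fst[OF this] show ?thesis unfolding g_def[abs_def] by simp
  qed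
  have g0: "g y = 0" if "R < \<bar>y\<bar>" for y
  proof -
    have "char_point ?w y t \<notin> \<Omega>" for t
      using characteristic.R[OF species_characteristic, of t i y] that by (auto simp: fibre_def)
    then have "?f (char_point ?w y t) = 0" for t by (simp add: transverse_momentum_def F_outside)
    then show ?thesis by (simp add: g_def)
  qed
  (* The set has total flux at most C times its measure; the excess 1 forces the measure to be 0. *)
  define A where "A = {y\<in>{-R..R}. ennreal (C + 1) < g y}"
  have Am [measurable]: "A \<in> sets borel" unfolding A_def by measurable
  have Afin: "emeasure lborel A < \<infinity>"
  proof -
    have "emeasure lborel A \<le> emeasure lborel {-R..R}" by (rule emeasure_mono) (auto simp: A_def)
    also have "\<dots> < \<infinity>" by (simp add: emeasure_lborel_Icc_eq)
    finally show ?thesis .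
  qed
  define \<rho> where "\<rho> c = (indicator A (c / n2) :: real)" for c
  have \<rho>m [measurable]: "\<rho> \<in> borel_measurable borel" unfolding \<rho>_def[abs_def] by measurable
  have \<rho>01: "0 \<le> \<rho> c" "\<rho> c \<le> 1" for c by (auto simp: \<rho>_def indicator_def)
  have supp: "\<rho> c = 0" if "R * n2 < \<bar>c\<bar>" for c
  proof -
    have "R < \<bar>c / n2\<bar>" using that n2 by (simp add: abs_divide pos_less_divide_eq)
    then show ?thesis by (auto simp: \<rho>_def A_def indicator_def abs_if split: if_splits)
  qed
  have \<rho>int: "(\<integral>c. \<rho> c \<partial>lborel) = n2 * measure lborel A"
  proof -
    have "(\<integral>c. \<rho> c \<partial>lborel) = \<bar>n2\<bar> *\<^sub>R (\<integral>y. \<rho> (0 + n2 * y) \<partial>lborel)"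
      by (rule lborel_integral_real_affine) (use n2 in simp)
    then show ?thesis using n2 by (simp add: \<rho>_def)
  qed
  have "ennreal n2 * (ennreal (C + 1) * emeasure lborel A) \<le> ennreal n2 * (\<integral>\<^sup>+y. indicator A y * g y \<partial>lborel)"
  proof (rule mult_left_mono)
    have "ennreal (C + 1) * emeasure lborel A = (\<integral>\<^sup>+y. ennreal (C + 1) * indicator A y \<partial>lborel)"
      by (simp add: nn_integral_cmult)
    also have "\<dots> \<le> (\<integral>\<^sup>+y. indicator A y * g y \<partial>lborel)"
      by (intro nn_integral_mono) (auto simp: A_def indicator_def)
    finally show "ennreal (C + 1) * emeasure lborel A \<le> (\<integral>\<^sup>+y. indicator A y * g y \<partial>lborel)" .
  qed simp
  also have "(\<integral>\<^sup>+y. indicator A y * g y \<partial>lborel)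
      = (\<integral>\<^sup>+y. \<integral>\<^sup>+t. ennreal (\<rho> (char_point ?w y t \<bullet> perp ?w) * ?f (char_point ?w y t)) \<partial>lborel \<partial>lborel)"
  proof (intro nn_integral_cong)
    fix y
    have "\<rho> (char_point ?w y t \<bullet> perp ?w) = indicator A y" for t
      using n2 by (simp add: \<rho>_def char_point_inner n2_def)
    then show "indicator A y * g y = (\<integral>\<^sup>+t. ennreal (\<rho> (char_point ?w y t \<bullet> perp ?w) * ?f (char_point ?w y t)) \<partial>lborel)"
      by (cases "y \<in> A") (simp_all add: g_def)
  qed
  also have "ennreal n2 * \<dots> = (\<integral>\<^sup>+z. ennreal (\<rho> (z \<bullet> perp ?w) * ?f z) \<partial>lborel)"
    unfolding n2_def by (rule nn_integral_char[OF v_nonzero, symmetric]) measurable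
  also have "\<dots> = ennreal (\<integral>z. \<rho> (z \<bullet> perp ?w) * ?f z \<partial>lborel)"
    by (rule nn_integral_eq_integral[OF transverse_momentum_test(2)[OF \<rho>m \<rho>01 supp]])
      (auto intro!: AE_I2 mult_nonneg_nonneg \<rho>01 transverse_momentum_nonneg)
  also have "\<dots> \<le> ennreal (C * (n2 * measure lborel A))"
    using transverse_momentum_test(1)[where i = i, OF \<rho>m \<rho>01 supp] by (intro ennreal_leI) (simp add: C_def \<rho>int)
  finally have "ennreal n2 * (ennreal (C + 1) * emeasure lborel A) \<le> ennreal (C * (n2 * measure lborel A))" .
  moreover have "emeasure lborel A = ennreal (measure lborel A)"
    using Afin by (intro emeasure_eq_ennreal_measure) auto
  ultimately have "ennreal (n2 * ((C + 1) * measure lborel A)) \<le> ennreal (C * (n2 * measure lborel A))"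
    using n2 C0 by (simp add: ennreal_mult)
  then have "n2 * ((C + 1) * measure lborel A) \<le> C * (n2 * measure lborel A)"
    using n2 C0 by (subst (asm) ennreal_le_iff) auto
  then have "n2 * measure lborel A \<le> 0" by (simp add: algebra_simps)
  then have "measure lborel A = 0" using n2 measure_nonneg[of lborel A] by (simp add: mult_le_0_iff)
  then have "A \<in> null_sets lborel"
    using \<open>emeasure lborel A = ennreal (measure lborel A)\<close> by (intro null_setsI) auto
  then have "AE y in lborel. y \<notin> A" by (rule AE_not_in)
  then show ?thesis
  proof eventually_elim
    case (elim y)
    then show ?case using g0[of y] unfolding g_def[symmetric] C_def[symmetric] A_def
      by (cases "R < \<bar>y\<bar>") (auto simp: not_less abs_le_iff)
  qed
qed

text \<open>The loss term of the equation is \<open>trunc k (F i z) * frequency i z\<close>.\<close>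

definition frequency :: "'i \<Rightarrow> real^2 \<Rightarrow> real" where
  "frequency i z = (\<Sum>j\<in>UNIV. (\<Sum>l\<in>UNIV. \<Sum>m\<in>UNIV. \<Gamma> i j l m) * trunc k (F j z))"

lemma \<Gamma>_nonneg: "0 \<le> \<Gamma> i j l m"
  using model by (auto simp: discrete_velocity_model_def)

lemma frequency_nonneg: "0 \<le> frequency i z"
  unfolding frequency_def by (intro sum_nonneg mult_nonneg_nonneg \<Gamma>_nonneg trunc_F)

lemma frequency_bounded: "frequency i z \<le> (\<Sum>j\<in>UNIV. (\<Sum>l\<in>UNIV. \<Sum>m\<in>UNIV. \<Gamma> i j l m) * real k)"
  unfolding frequency_def by (intro sum_mono mult_left_mono sum_nonneg \<Gamma>_nonneg trunc_F)

lemma frequency_meas: "frequency i \<in> borel_measurable borel"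
  unfolding frequency_def[abs_def] trunc_def by measurable

lemma loss_le_source: "- (F i z * frequency i z) \<le> source i z"
proof -
  have "source i z = (\<Sum>j\<in>UNIV. \<Sum>l\<in>UNIV. \<Sum>m\<in>UNIV. \<Gamma> i j l m * (trunc k (F l z) * trunc k (F m z)))
      - trunc k (F i z) * frequency i z"
    unfolding collision_def frequency_def
    by (simp add: right_diff_distrib sum_subtractf sum_distrib_left sum_distrib_right mult_ac)
  moreover have "0 \<le> (\<Sum>j\<in>UNIV. \<Sum>l\<in>UNIV. \<Sum>m\<in>UNIV. \<Gamma> i j l m * (trunc k (F l z) * trunc k (F m z)))"
    by (intro sum_nonneg mult_nonneg_nonneg \<Gamma>_nonneg trunc_F)
  moreover have "trunc k (F i z) * frequency i z \<le> F i z * frequency i z"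
    by (intro mult_right_mono trunc_F frequency_nonneg)
  ultimately show ?thesis by linarith
qed

lemma damping_nonneg: "0 \<le> damping v \<Gamma>"
  unfolding damping_def by (intro sum_nonneg divide_nonneg_nonneg \<Gamma>_nonneg) auto

text \<open>Colliding particles have non-parallel velocities, so the partner of \<open>v i\<close> has a
  component normal to \<open>v i\<close>.\<close>

lemma frequency_le_momentum: "frequency i z \<le> damping v \<Gamma> * transverse_momentum i z"
  unfolding frequency_def transverse_momentum_def sum_distrib_left
proof (rule sum_mono)
  fix j
  let ?s = "\<Sum>l\<in>UNIV. \<Sum>m\<in>UNIV. \<Gamma> i j l m" and ?d = "(v j \<bullet> perp (v i))\<^sup>2"
  have s0: "0 \<le> ?s" by (intro sum_nonneg \<Gamma>_nonneg)
  show "?s * trunc k (F j z) \<le> damping v \<Gamma> * (?d * F j z)"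
  proof (cases "interacting \<Gamma> i j")
    case False
    then have "\<Gamma> i j l m = 0" for l m using \<Gamma>_nonneg[of i j l m] by (auto simp: interacting_def less_le)
    then show ?thesis using damping_nonneg F_nonneg[of j z] by simp
  next
    case True
    then have "v j \<bullet> perp (v i) \<noteq> 0" using noncollinear[OF True] collinear_perp[OF v_nonzero[of i], of "v j"] by auto
    then have d: "0 < ?d" by simp
    have "?s / ?d \<le> (\<Sum>j\<in>UNIV. (\<Sum>l\<in>UNIV. \<Sum>m\<in>UNIV. \<Gamma> i j l m) / (v j \<bullet> perp (v i))\<^sup>2)"
      by (rule member_le_sum[of j UNIV "\<lambda>j. (\<Sum>l\<in>UNIV. \<Sum>m\<in>UNIV. \<Gamma> i j l m) / (v j \<bullet> perp (v i))\<^sup>2"])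
        (auto intro!: divide_nonneg_nonneg sum_nonneg \<Gamma>_nonneg)
    also have "\<dots> \<le> damping v \<Gamma>"
      unfolding damping_def
      by (rule member_le_sum[of i UNIV "\<lambda>i. \<Sum>j\<in>UNIV. (\<Sum>l\<in>UNIV. \<Sum>m\<in>UNIV. \<Gamma> i j l m) / (v j \<bullet> perp (v i))\<^sup>2"])
        (auto intro!: divide_nonneg_nonneg sum_nonneg \<Gamma>_nonneg)
    finally have "?s \<le> damping v \<Gamma> * ?d" using d by (simp add: pos_divide_le_eq)
    then have "?s * trunc k (F j z) \<le> (damping v \<Gamma> * ?d) * F j z"
      using trunc_F[of j z] damping_nonneg by (intro mult_mono) auto
    then show ?thesis by (simp add: mult.assoc)
  qed
qed

text \<open>Tails of the density inside are tails of the outflow, up to the factor of the exponential bound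
  and the length of the characteristics.\<close>

lemma uniform_tail:
  assumes c: "4 \<le> c" "c \<le> real k"
  shows "(\<integral>z. (if exp (damping v \<Gamma> * (2 * speed2 * mass + 1)) * (2 * c) < F i z then F i z else 0) \<partial>lborel)
    \<le> 2 * R * exp (damping v \<Gamma> * (2 * speed2 * mass + 1)) * (2 * (mass + 1 + 4 * R * speed2) / ln (c / 2))"
proof -
  define N where "N = damping v \<Gamma> * (2 * speed2 * mass + 1)"
  have N0: "0 \<le> N" using damping_nonneg speed2_nonneg mass_nonneg by (simp add: N_def)
  have "AE y in lborel. (\<integral>\<^sup>+t. ennreal (frequency i (char_point (v i) y t)) \<partial>lborel) \<le> ennreal N"
    using line_momentum_bound[of i]
  proof eventually_elim
    case (elim y)
    have "(\<integral>\<^sup>+t. ennreal (frequency i (char_point (v i) y t)) \<partial>lborel)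
        \<le> (\<integral>\<^sup>+t. ennreal (damping v \<Gamma>) * ennreal (transverse_momentum i (char_point (v i) y t)) \<partial>lborel)"
      by (intro nn_integral_mono)
        (simp add: ennreal_mult[symmetric] damping_nonneg transverse_momentum_nonneg frequency_le_momentum ennreal_leI)
    also have "\<dots> = ennreal (damping v \<Gamma>) * (\<integral>\<^sup>+t. ennreal (transverse_momentum i (char_point (v i) y t)) \<partial>lborel)"
      by (rule nn_integral_cmult) measurable
    also have "\<dots> \<le> ennreal (damping v \<Gamma>) * ennreal (2 * speed2 * mass + 1)"
      by (rule mult_left_mono[OF elim]) simp
    also have "\<dots> = ennreal N"
      using damping_nonneg speed2_nonneg mass_nonneg by (simp add: N_def ennreal_mult[symmetric] del: ennreal_plus)
    finally show ?case .
  qed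
  then have "AE y in lborel. \<forall>t\<le>R. \<beta> i y + characteristic.gained (v i) R (source i) y t \<le> exp N * outflow i y"
    by (rule characteristic_solution.profile_le_exit[OF CS frequency_meas frequency_nonneg frequency_bounded loss_le_source _ N0])
  then have "(\<integral>z. (if exp N * (2 * c) < F i z then F i z else 0) \<partial>lborel)
      \<le> (norm (v i))\<^sup>2 * (2 * R * exp N) * (\<integral>y. (if 2 * c < outflow i y then outflow i y else 0) \<partial>lborel)"
    by (rule characteristic_solution.tail_le_exit_tail[OF CS]) (use N0 in simp)
  also have "\<dots> = (2 * R * exp N) * ((norm (v i))\<^sup>2 * (\<integral>y. (if 2 * c < outflow i y then outflow i y else 0) \<partial>lborel))"
    by (simp add: mult_ac)
  also have "\<dots> \<le> (2 * R * exp N) * (2 * (mass + 1 + 4 * R * speed2) / ln (c / 2))"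
    using R_pos by (intro mult_left_mono outflow_tail c) auto
  finally show ?thesis unfolding N_def .
qed
end

section \<open>Weak compactness of the approximations\<close>

context convex_curve begin

text \<open>The entry values are the boundary data at the entry points. Transported to the boundary curve, the
  integral over the characteristics becomes the weighted integral that is bounded for the mollified
  data.\<close>

lemma inflow_profile_entropy:
  assumes w: "w \<noteq> 0"
    and h [measurable]: "h \<in> borel_measurable borel" and h0: "\<And>s. 0 \<le> h s" "\<And>s. h s \<le> B"
    and M: "(\<integral>\<^sup>+s\<in>{0..L}. ennreal (max (w \<bullet> normal s) 0 * (h s * (1 + ln (1 + h s)))) \<partial>lborel) \<le> ennreal M" "0 \<le> M"
    and b: "\<And>s. s \<in> {0..<L} \<Longrightarrow> b (\<gamma> s) = h s"
    and \<beta>m [measurable]: "\<beta> \<in> borel_measurable borel" and \<beta>0: "\<And>y. fibre w y = {} \<Longrightarrow> \<beta> y = 0"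
    and \<beta>: "AE y in lborel. fibre w y \<noteq> {} \<longrightarrow> \<beta> y = b (char_point w y (entry w y))"
  shows "AE y in lborel. \<beta> y \<le> B" "integrable lborel (\<lambda>y. entropy_weight (\<beta> y))"
    "(norm w)\<^sup>2 * (\<integral>y. entropy_weight (\<beta> y) \<partial>lborel) \<le> M"
proof -
  have B0: "0 \<le> B" using h0[of 0] by linarith
  have in_range: "AE y in lborel. 0 \<le> \<beta> y \<and> \<beta> y \<le> B"
    using \<beta>
  proof eventually_elim
    case (elim y)
    show ?case
    proof (cases "fibre w y = {}")
      case True then show ?thesis using \<beta>0 B0 by simp
    next
      case False
      obtain s where "s \<in> {0..<L}" "char_point w y (entry w y) = \<gamma> s" using entry_point_on_curve[OF w False] by blast
      then show ?thesis using elim False b h0 by simp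
    qed
  qed
  then show "AE y in lborel. \<beta> y \<le> B" by (auto elim: eventually_mono)
  have ew_m [measurable]: "entropy_weight \<in> borel_measurable borel"
    unfolding entropy_weight_def[abs_def] by measurable
  have ew: "0 \<le> entropy_weight x \<and> entropy_weight x \<le> B * (1 + B)" if "0 \<le> x" "x \<le> B" for x
  proof -
    have l: "0 \<le> ln (1 + x)" "ln (1 + x) \<le> B" using that ln_add_one_self_le_self[of x] ln_ge_zero[of "1 + x"] by linarith+
    then show ?thesis unfolding entropy_weight_def using that by (intro conjI mult_nonneg_nonneg mult_mono) auto
  qed
  let ?W = "\<lambda>s. w \<bullet> normal s" and ?S = "inflow_params w" and ?Y = "{y. fibre w y \<noteq> {}}"
  let ?f = "\<lambda>s. ?W s * entropy_weight (b (\<gamma> s))"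
  define f where "f s = indicator ?S s *\<^sub>R (?W s * entropy_weight (h s))" for s
  have Sm [measurable]: "?S \<in> sets borel" by (rule inflow_params_borel)
  have fm [measurable]: "f \<in> borel_measurable borel" unfolding f_def[abs_def] by measurable
  have f0: "0 \<le> f s" for s using ew[OF h0] by (auto simp: f_def inflow_params_def indicator_def)
  have f_nn: "(\<integral>\<^sup>+s. ennreal (f s) \<partial>lborel) \<le> ennreal M"
  proof (rule order_trans[OF _ M(1)], rule nn_integral_mono)
    fix s show "ennreal (f s) \<le> ennreal (max (?W s) 0 * (h s * (1 + ln (1 + h s)))) * indicator {0..L} s"
      by (auto simp: f_def inflow_params_def indicator_def entropy_weight_def)
  qed
  have fi: "integrable lborel f"
    by (rule integrableI_nonneg) (use f0 f_nn in \<open>auto simp: less_top[symmetric] top_unique\<close>)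
  have fM: "(\<integral>s. f s \<partial>lborel) \<le> M"
    using f_nn f0 M(2) by (subst (asm) nn_integral_eq_integral[OF fi]) (auto simp: ennreal_le_iff)
  have feq: "f s = indicator ?S s *\<^sub>R ?f s" for s
    using b[of s] by (auto simp: f_def inflow_params_def indicator_def)
  have ai: "?f absolutely_integrable_on ?S"
    unfolding set_integrable_def feq[symmetric] using fi by (subst integrable_completion) auto
  have "integral ?S ?f = (\<integral>s. f s \<partial>lborel)"
    using set_lebesgue_integral_eq_integral(2)[OF ai] unfolding set_lebesgue_integral_def feq[symmetric]
    by (simp add: integral_completion)
  note cov = inflow_change_of_variables[OF w, of "\<lambda>Z. entropy_weight (b Z)", OF ai]
  let ?g = "\<lambda>y. entropy_weight (b (char_point w y (entry w y)))"
  have AE_leb: "AE y in lebesgue. entropy_weight (\<beta> y) = indicator ?Y y *\<^sub>R ?g y"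
    using AE_completion[OF \<beta>] by eventually_elim (use \<beta>0 in \<open>auto simp: indicator_def entropy_weight_def\<close>)
  have gm: "(\<lambda>y. indicator ?Y y *\<^sub>R ?g y) \<in> borel_measurable lebesgue"
    using cov(1) by (auto simp: set_integrable_def)
  have \<beta>m': "(\<lambda>y. entropy_weight (\<beta> y)) \<in> borel_measurable lborel" by measurable
  then have \<beta>mleb: "(\<lambda>y. entropy_weight (\<beta> y)) \<in> borel_measurable lebesgue" by (rule measurable_completion)
  have "integrable lebesgue (\<lambda>y. entropy_weight (\<beta> y))"
    using integrable_cong_AE[OF \<beta>mleb gm AE_leb] cov(1) by (simp add: set_integrable_def)
  then show "integrable lborel (\<lambda>y. entropy_weight (\<beta> y))" using integrable_completion[OF \<beta>m'] by simp
  have "(\<integral>y. entropy_weight (\<beta> y) \<partial>lborel) = (\<integral>y. entropy_weight (\<beta> y) \<partial>lebesgue)"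
    by (rule integral_completion[OF \<beta>m', symmetric])
  also have "\<dots> = (\<integral>y. indicator ?Y y *\<^sub>R ?g y \<partial>lebesgue)" by (rule integral_cong_AE[OF \<beta>mleb gm AE_leb])
  also have "\<dots> = integral ?Y ?g"
    using set_lebesgue_integral_eq_integral(2)[OF cov(1)] by (simp add: set_lebesgue_integral_def)
  finally show "(norm w)\<^sup>2 * (\<integral>y. entropy_weight (\<beta> y) \<partial>lborel) \<le> M"
    using cov(2) \<open>integral ?S ?f = _\<close> fM by simp
qed

text \<open>The components of \<open>F\<close> are non-negative almost everywhere only. Their positive parts,
  extended by 0, satisfy the same equation almost everywhere and are Borel functions without exceptional
  points.\<close>

lemma approximate_solution_exists:
  fixes v :: "'i::finite \<Rightarrow> real^2" and F :: "'i \<Rightarrow> real^2 \<Rightarrow> real"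
  assumes model: "discrete_velocity_model v \<Gamma>"
    and noncollinear: "\<And>i j. interacting \<Gamma> i j \<Longrightarrow> \<not> collinear {0, v i, v j}"
    and k: "1 \<le> k" and R: "\<And>i y t. t \<in> fibre (v i) y \<Longrightarrow> \<bar>t\<bar> < R \<and> \<bar>y\<bar> < R" "0 < R"
    and lim: "limit_approximation \<Omega> L \<gamma> v \<Gamma> fb \<mu> k F" and M0: "0 \<le> M"
    and h: "\<And>i. convolution (inflow_datum (v i) (\<lambda>Z. min (fb i Z) (real k / 2))) \<mu> \<in> borel_measurable borel"
      "\<And>i s. 0 \<le> convolution (inflow_datum (v i) (\<lambda>Z. min (fb i Z) (real k / 2))) \<mu> s"
      "\<And>i s. convolution (inflow_datum (v i) (\<lambda>Z. min (fb i Z) (real k / 2))) \<mu> s \<le> real k / 2"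
      "\<And>i. (\<integral>\<^sup>+s\<in>{0..L}. ennreal (max (v i \<bullet> normal s) 0 *
         (convolution (inflow_datum (v i) (\<lambda>Z. min (fb i Z) (real k / 2))) \<mu> s *
          (1 + ln (1 + convolution (inflow_datum (v i) (\<lambda>Z. min (fb i Z) (real k / 2))) \<mu> s)))) \<partial>lborel) \<le> ennreal M"
  shows "\<exists>\<beta>. approximate_solution \<Omega> L \<gamma> \<gamma>' \<gamma>'' v \<Gamma> k (\<lambda>i z. indicator \<Omega> z * max 0 (F i z)) R \<beta> M"
proof -
  let ?F = "\<lambda>i z. indicator \<Omega> z * max 0 (F i z)"
  let ?src = "\<lambda>i z. collision \<Gamma> (\<lambda>j. trunc k (?F j z)) i"
  let ?b = "\<lambda>i. mollified_data \<Omega> L \<gamma> \<mu> k (v i) (fb i)"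
  have v0: "v i \<noteq> 0" for i using model by (simp add: discrete_velocity_model_def)
  have L1: "set_integrable lborel \<Omega> (F i)" "AE z in lborel. z \<in> \<Omega> \<longrightarrow> 0 \<le> F i z" for i
    using lim by (auto simp: limit_approximation_def L1_plus_def)
  have Feq: "?F i z = max 0 (indicator \<Omega> z *\<^sub>R F i z)" for i z by (simp add: indicator_def)
  have Fint: "integrable lborel (?F i)" for i
    unfolding Feq using L1(1)[of i] unfolding set_integrable_def by (intro Bochner_Integration.integrable_max) auto
  have Fm [measurable]: "?F i \<in> borel_measurable borel" for i using borel_measurable_integrable[OF Fint[of i]] by simp
  have Fnn: "0 \<le> ?F i z" for i z by simp
  have srcm: "?src i \<in> borel_measurable borel" for i unfolding collision_def trunc_def by measurable
  have srcb: "\<bar>?src i z\<bar> \<le> collision_total \<Gamma> * (real k * real k)" for i z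
    unfolding collision_total_def by (rule collision_bound[OF model]) (use trunc_bounds[OF Fnn k] in auto)
  have src0: "?src i z = 0" if "z \<notin> \<Omega>" for i z using that by (simp add: collision_def trunc_def)
  have char: "characteristic \<Omega> L \<gamma> \<gamma>' \<gamma>'' (v i) R (?F i) (?src i) (collision_total \<Gamma> * (real k * real k))" for i
    by (intro characteristic.intro characteristic_axioms.intro convex_curve_axioms)
      (use v0 R Fm Fnn Fint srcm srcb src0 in auto)
  have ex: "\<exists>\<beta>. characteristic_solution \<Omega> L \<gamma> \<gamma>' \<gamma>'' (v i) R (?F i) (?src i) (collision_total \<Gamma> * (real k * real k)) \<beta> (real k / 2)
      \<and> integrable lborel (\<lambda>y. entropy_weight (\<beta> y))
      \<and> (norm (v i))\<^sup>2 * (\<integral>y. entropy_weight (\<beta> y) \<partial>lborel) \<le> M" for i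
  proof -
    interpret characteristic \<Omega> L \<gamma> \<gamma>' \<gamma>'' "v i" R "?F i" "?src i" "collision_total \<Gamma> * (real k * real k)"
      by (rule char)
    let ?G' = "\<lambda>z. gain \<Gamma> k F i z - F i z * collision_frequency \<Gamma> k F i z"
    have "AE z in lborel. \<forall>j\<in>UNIV. z \<in> \<Omega> \<longrightarrow> 0 \<le> F j z" using L1(2) by (intro AE_finite_allI) auto
    then have eq: "AE z in lborel. z \<in> \<Omega> \<longrightarrow> F i z = ?F i z \<and> ?G' z = ?src i z"
    proof eventually_elim
      case (elim z)
      show ?case
      proof (intro impI conjI)
        assume z: "z \<in> \<Omega>"
        then have F: "?F j z = F j z" for j using elim by simp
        show "F i z = ?F i z" by (simp only: F)
        have "F i z * collision_frequency \<Gamma> k F i z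
            = (\<Sum>j\<in>UNIV. \<Sum>l\<in>UNIV. \<Sum>m\<in>UNIV. \<Gamma> i j l m * (trunc k (F i z) * trunc k (F j z)))"
          by (simp add: collision_frequency_def sum_distrib_left trunc_def mult_ac)
        then show "?G' z = ?src i z"
          unfolding F gain_def collision_def
          by (simp add: trunc_def[symmetric] sum_subtractf[symmetric] right_diff_distrib mult.assoc)
      qed
    qed
    have mild: "AE z in lborel. z \<in> \<Omega> \<longrightarrow>
        set_integrable lborel {0..entry_time \<Omega> (v i) z} (\<lambda>s. ?G' (z - s *\<^sub>R v i)) \<and>
        F i z = ?b i (z - entry_time \<Omega> (v i) z *\<^sub>R v i) + (LINT s:{0..entry_time \<Omega> (v i) z}|lborel. ?G' (z - s *\<^sub>R v i))"
      using lim by (simp add: limit_approximation_def mild_transport_solution_def)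
    obtain \<beta> where \<beta>: "\<beta> \<in> borel_measurable borel" "\<And>y. fibre (v i) y = {} \<Longrightarrow> \<beta> y = 0"
      "AE y in lborel. fibre (v i) y \<noteq> {} \<longrightarrow> \<beta> y = ?b i (char_point (v i) y (entry (v i) y))"
      "AE y in lborel. (AE t in lborel. t \<in> fibre (v i) y \<longrightarrow> ?F i (char_point (v i) y t) = \<beta> y + gained y t)
        \<and> (\<forall>t. 0 \<le> \<beta> y + gained y t)"
      using entry_profile_exists[OF mild_on_characteristics[OF mild eq]] by blast
    note ent = inflow_profile_entropy[OF v0 h(1)[of i] h(2)[of i] h(3)[of i] h(4)[of i] M0 mollified_data_curve \<beta>(1,2,3)]
    have "characteristic_solution \<Omega> L \<gamma> \<gamma>' \<gamma>'' (v i) R (?F i) (?src i) (collision_total \<Gamma> * (real k * real k)) \<beta> (real k / 2)"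
      by (intro characteristic_solution.intro characteristic_solution_axioms.intro char \<beta>(1,4) ent(1)) (rule \<beta>(2))
    then show ?thesis using ent(2,3) by blast
  qed
  have "\<exists>\<beta>. \<forall>i. characteristic_solution \<Omega> L \<gamma> \<gamma>' \<gamma>'' (v i) R (?F i) (?src i) (collision_total \<Gamma> * (real k * real k)) (\<beta> i) (real k / 2)
      \<and> integrable lborel (\<lambda>y. entropy_weight (\<beta> i y))
      \<and> (norm (v i))\<^sup>2 * (\<integral>y. entropy_weight (\<beta> i y) \<partial>lborel) \<le> M"
    by (rule choice) (rule allI, rule ex)
  then obtain \<beta> where \<beta>: "\<forall>i. characteristic_solution \<Omega> L \<gamma> \<gamma>' \<gamma>'' (v i) R (?F i) (?src i) (collision_total \<Gamma> * (real k * real k)) (\<beta> i) (real k / 2)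
      \<and> integrable lborel (\<lambda>y. entropy_weight (\<beta> i y))
      \<and> (norm (v i))\<^sup>2 * (\<integral>y. entropy_weight (\<beta> i y) \<partial>lborel) \<le> M" by (rule exE)
  have "approximate_solution \<Omega> L \<gamma> \<gamma>' \<gamma>'' v \<Gamma> k ?F R \<beta> M"
  proof (intro approximate_solution.intro approximate_solution_axioms.intro convex_curve_axioms model noncollinear k)
    fix i
    show "characteristic_solution \<Omega> L \<gamma> \<gamma>' \<gamma>'' (v i) R (?F i) (?src i) (collision_total \<Gamma> * (real k * real k)) (\<beta> i) (real k / 2)"
      using \<beta>[rule_format, of i] by (rule conjunct1)
    show "integrable lborel (\<lambda>y. entropy_weight (\<beta> i y))" "(norm (v i))\<^sup>2 * (\<integral>y. entropy_weight (\<beta> i y) \<partial>lborel) \<le> M"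
      using \<beta>[rule_format, of i, THEN conjunct2] by (rule conjunct1, rule conjunct2)
  qed
  then show ?thesis by blast
qed
end

lemma tail_integral_antimono:
  fixes f :: "'a \<Rightarrow> real"
  assumes "integrable M f" "\<And>x. 0 \<le> f x" "K \<le> K'"
  shows "(\<integral>x. (if K' < f x then f x else 0) \<partial>M) \<le> (\<integral>x. (if K < f x then f x else 0) \<partial>M)"
proof -
  have i: "integrable M (\<lambda>x. if K < f x then f x else 0)" for K
    by (rule Bochner_Integration.integrable_bound[OF assms(1)]) (use assms(1) in auto)
  show ?thesis by (rule integral_mono[OF i i]) (use assms(2,3) in auto)
qed

text \<open>For a single integrable function, by dominated convergence.\<close>

lemma tail_integral_small:
  fixes f :: "'a \<Rightarrow> real"
  assumes f: "integrable M f" "\<And>x. 0 \<le> f x" and e: "0 < e"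
  shows "\<exists>K. (\<integral>x. (if K < f x then f x else 0) \<partial>M) \<le> e"
proof -
  have [measurable]: "f \<in> borel_measurable M" using f by auto
  have "(\<lambda>n. \<integral>x. (if real n < f x then f x else 0) \<partial>M) \<longlonglongrightarrow> (\<integral>x. 0 \<partial>M)"
  proof (rule integral_dominated_convergence[OF _ _ f(1)])
    show "AE x in M. (\<lambda>n. if real n < f x then f x else 0) \<longlonglongrightarrow> 0"
    proof (rule AE_I2)
      fix x
      obtain n0 where "f x \<le> real n0" using real_arch_simple by blast
      then have "\<forall>\<^sub>F n in sequentially. (if real n < f x then f x else 0) = 0"
        unfolding eventually_sequentially by (intro exI[of _ n0]) auto
      then show "(\<lambda>n. if real n < f x then f x else 0) \<longlonglongrightarrow> 0" by (rule tendsto_eventually)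
    qed
  qed (use f(2) in auto)
  then have "\<forall>\<^sub>F n in sequentially. (\<integral>x. (if real n < f x then f x else 0) \<partial>M) < e"
    using e by (intro order_tendstoD(2)) auto
  then show ?thesis unfolding eventually_sequentially by (meson less_imp_le order_refl)
qed

theorem proposition1:
  fixes \<Omega> :: "(real^2) set" and L :: real and \<gamma> :: "real \<Rightarrow> real^2"
    and v :: "'i::finite \<Rightarrow> real^2" and \<Gamma> :: "'i \<Rightarrow> 'i \<Rightarrow> 'i \<Rightarrow> 'i \<Rightarrow> real"
    and f\<^sub>b :: "'i \<Rightarrow> real^2 \<Rightarrow> real"
    and \<mu> :: "real \<Rightarrow> real^2 \<Rightarrow> real" and \<mu>\<^sub>b :: "nat \<Rightarrow> real \<Rightarrow> real"
    and F\<^sub>\<alpha> :: "real \<Rightarrow> nat \<Rightarrow> 'i \<Rightarrow> real^2 \<Rightarrow> real"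
    and F :: "nat \<Rightarrow> 'i \<Rightarrow> real^2 \<Rightarrow> real"
  assumes domain: "open \<Omega>" "bounded \<Omega>" "strictly_convex \<Omega>" "C2_boundary_param \<Omega> L \<gamma>"
    and model: "discrete_velocity_model v \<Gamma>" "normal_model v \<Gamma>"
      "\<forall>i j. interacting \<Gamma> i j \<longrightarrow> \<not> collinear {0, v i, v j}"
      "\<forall>i. \<exists>j l m. \<Gamma> i j l m \<noteq> 0"
    and data: "\<forall>i. set_borel_measurable (arc_length L \<gamma>) (inflow_boundary \<Omega> \<gamma> (v i)) (f\<^sub>b i)"
      "\<forall>i. \<forall>Z \<in> inflow_boundary \<Omega> \<gamma> (v i). 0 \<le> f\<^sub>b i Z"
      "\<forall>i. set_integrable (arc_length L \<gamma>) (inflow_boundary \<Omega> \<gamma> (v i))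
             (\<lambda>Z. (v i \<bullet> inward_normal \<Omega> \<gamma> Z) * f\<^sub>b i Z * (1 + ln (f\<^sub>b i Z)))"
    and mollifiers: "\<forall>\<alpha>>0. mollifier \<alpha> (\<mu> \<alpha>)" "\<forall>k\<ge>1. mollifier (1 / real k) (\<mu>\<^sub>b k)"
    and approximations: "\<forall>\<alpha>>0. \<forall>k\<ge>1.
      mollified_approximation \<Omega> L \<gamma> v \<Gamma> f\<^sub>b (\<mu> \<alpha>) (\<mu>\<^sub>b k) \<alpha> k (F\<^sub>\<alpha> \<alpha> k)"
    and limits: "\<forall>k\<ge>1. \<exists>\<beta> :: nat \<Rightarrow> real. (\<forall>q. 0 < \<beta> q) \<and> \<beta> \<longlonglongrightarrow> 0
      \<and> tendsto_L1 \<Omega> (\<lambda>q. F\<^sub>\<alpha> (\<beta> q) k) (F k)"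
      "\<forall>k\<ge>1. limit_approximation \<Omega> L \<gamma> v \<Gamma> f\<^sub>b (\<mu>\<^sub>b k) k (F k)"
  shows "relatively_weakly_compact_L1 \<Omega> (F ` {1..})"
proof -
  obtain \<gamma>' \<gamma>'' where curve: "0 < L" "\<And>s. \<gamma> (s + L) = \<gamma> s" "inj_on \<gamma> {0..<L}" "range \<gamma> = frontier \<Omega>"
    "\<And>s. (\<gamma> has_vector_derivative \<gamma>' s) (at s)" "\<And>s. (\<gamma>' has_vector_derivative \<gamma>'' s) (at s)"
    "\<And>s. norm (\<gamma>' s) = 1" "continuous_on UNIV \<gamma>''"
    using domain(4) unfolding C2_boundary_param_def by blast
  interpret convex_curve \<Omega> L \<gamma> \<gamma>' \<gamma>''
    by unfold_locales (use domain curve strictly_convex_imp_convex in auto)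
  have v0: "v i \<noteq> 0" for i using model(1) by (simp add: discrete_velocity_model_def)
  let ?h = "\<lambda>k i. convolution (inflow_datum (v i) (\<lambda>Z. min (f\<^sub>b i Z) (real k / 2))) (\<mu>\<^sub>b k)"
  have "\<exists>M\<ge>0. \<forall>k\<ge>1. ?h k i \<in> borel_measurable borel \<and> (\<forall>s. 0 \<le> ?h k i s \<and> ?h k i s \<le> real k / 2) \<and>
      (\<integral>\<^sup>+s\<in>{0..L}. ennreal (max (v i \<bullet> normal s) 0 * (?h k i s * (1 + ln (1 + ?h k i s)))) \<partial>lborel) \<le> ennreal M" for i
    using mollified_inflow_entropy_bound[OF v0 data(1)[rule_format, of i] data(2)[rule_format, of _ i] data(3)[rule_format, of i]]
      mollifiers(2) unfolding Let_def by blast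
  then have "\<exists>Mi. \<forall>i. 0 \<le> Mi i \<and> (\<forall>k\<ge>1. ?h k i \<in> borel_measurable borel \<and> (\<forall>s. 0 \<le> ?h k i s \<and> ?h k i s \<le> real k / 2) \<and>
      (\<integral>\<^sup>+s\<in>{0..L}. ennreal (max (v i \<bullet> normal s) 0 * (?h k i s * (1 + ln (1 + ?h k i s)))) \<partial>lborel) \<le> ennreal (Mi i))"
    by (intro choice allI) blast
  then obtain Mi where Mi: "\<And>i. 0 \<le> Mi i"
    "\<And>i k. 1 \<le> k \<Longrightarrow> ?h k i \<in> borel_measurable borel \<and> (\<forall>s. 0 \<le> ?h k i s \<and> ?h k i s \<le> real k / 2) \<and>
      (\<integral>\<^sup>+s\<in>{0..L}. ennreal (max (v i \<bullet> normal s) 0 * (?h k i s * (1 + ln (1 + ?h k i s)))) \<partial>lborel) \<le> ennreal (Mi i)"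
    by blast
  define M where "M = (\<Sum>i\<in>UNIV. Mi i)"
  have Mle: "Mi i \<le> M" for i unfolding M_def by (rule member_le_sum) (use Mi(1) in auto)
  have M0: "0 \<le> M" unfolding M_def by (intro sum_nonneg Mi(1))
  obtain R0 where R0: "\<And>i R y t. R0 i \<le> R \<Longrightarrow> t \<in> fibre (v i) y \<Longrightarrow> \<bar>t\<bar> < R \<and> \<bar>y\<bar> < R"
    using fibre_bound[OF v0] by metis
  define R where "R = 1 + (\<Sum>i\<in>UNIV. \<bar>R0 i\<bar>)"
  have R0R: "R0 i \<le> R" for i
    using member_le_sum[of i UNIV "\<lambda>i. \<bar>R0 i\<bar>"] abs_ge_self[of "R0 i"] by (simp add: R_def)
  have "0 \<le> (\<Sum>i\<in>UNIV. \<bar>R0 i\<bar>)" by (intro sum_nonneg) auto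
  then have Rpos: "0 < R" unfolding R_def by linarith
  define F' where "F' k i z = indicator \<Omega> z * max 0 (F k i z)" for k i z
  have "\<exists>\<beta>. approximate_solution \<Omega> L \<gamma> \<gamma>' \<gamma>'' v \<Gamma> k (F' k) R \<beta> M" if k: "1 \<le> k" for k
    unfolding F'_def[abs_def]
  proof (rule approximate_solution_exists[where fb = f\<^sub>b and \<mu> = "\<mu>\<^sub>b k"])
    show "discrete_velocity_model v \<Gamma>" by (rule model(1))
    show "\<not> collinear {0, v i, v j}" if "interacting \<Gamma> i j" for i j using model(3) that by blast
    show "\<bar>t\<bar> < R \<and> \<bar>y\<bar> < R" if "t \<in> fibre (v i) y" for i y t by (rule R0[OF R0R that])
    show "limit_approximation \<Omega> L \<gamma> v \<Gamma> f\<^sub>b (\<mu>\<^sub>b k) k (F k)" using limits(2) k by blast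
    show "?h k i \<in> borel_measurable borel" for i using Mi(2)[OF k, of i] by blast
    show "0 \<le> ?h k i s" "?h k i s \<le> real k / 2" for i s using Mi(2)[OF k, of i] by blast+
    show "(\<integral>\<^sup>+s\<in>{0..L}. ennreal (max (v i \<bullet> normal s) 0 * (?h k i s * (1 + ln (1 + ?h k i s)))) \<partial>lborel) \<le> ennreal M" for i
      using Mi(2)[OF k, of i] ennreal_leI[OF Mle[of i]] order_trans by blast
  qed (rule k Rpos M0)+
  then have "\<exists>\<beta>. \<forall>k. 1 \<le> k \<longrightarrow> approximate_solution \<Omega> L \<gamma> \<gamma>' \<gamma>'' v \<Gamma> k (F' k) R (\<beta> k) M"
    by (intro choice allI) blast
  then obtain \<beta> where AS: "\<And>k. 1 \<le> k \<Longrightarrow> approximate_solution \<Omega> L \<gamma> \<gamma>' \<gamma>'' v \<Gamma> k (F' k) R (\<beta> k) M" by blast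
  have F'int: "integrable lborel (F' k i)" if "1 \<le> k" for k i by (rule approximate_solution.F_int[OF AS[OF that]])
  have F'nn: "0 \<le> F' k i z" for k i z by (simp add: F'_def)
  have L1: "set_integrable lborel \<Omega> (F k i)" "AE z in lborel. z \<in> \<Omega> \<longrightarrow> 0 \<le> F k i z" if "1 \<le> k" for k i
    using limits(2) that by (auto simp: limit_approximation_def L1_plus_def)
  define C1 where "C1 = (\<Sum>i\<in>UNIV. (norm (v i))\<^sup>2)"
  define C2 where "C2 = real CARD('i) * M"
  define C3 where "C3 = exp (damping v \<Gamma> * (2 * C1 * C2 + 1))"
  have tail: "(\<integral>z. (if C3 * (2 * c) < F' k i z then F' k i z else 0) \<partial>lborel)
      \<le> 2 * R * C3 * (2 * (C2 + 1 + 4 * R * C1) / ln (c / 2))" if "1 \<le> k" "4 \<le> c" "c \<le> real k" for k c i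
    using approximate_solution.uniform_tail[OF AS[OF that(1)] that(2,3), of i]
    unfolding approximate_solution.speed2_def[OF AS[OF that(1)]] approximate_solution.mass_def[OF AS[OF that(1)]]
      C1_def[symmetric] C2_def[symmetric] C3_def[symmetric] .
  have UI: "\<exists>K. \<forall>G\<in>F ` {1..}. \<forall>i. (LINT z:\<Omega>|lborel. (if K < G i z then G i z else 0)) \<le> e" if e: "0 < e" for e
  proof -
    define B where "B = 2 * R * C3 * (2 * (C2 + 1 + 4 * R * C1))"
    have B0: "0 \<le> B" using Rpos M0 by (auto simp: B_def C1_def C2_def C3_def intro!: mult_nonneg_nonneg add_nonneg_nonneg sum_nonneg)
    (* This level makes the bound B / ln (c / 2) at most e. The finitely many indices below it are
       treated one by one. *)
    define c where "c = 2 * exp (B / e + 1)"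
    have c4: "4 \<le> c" using exp_ge_add_one_self[of "B / e + 1"] B0 e by (simp add: c_def) (smt (verit) divide_nonneg_pos)
    have "B / ln (c / 2) = B / (B / e + 1)" by (simp add: c_def)
    also have "\<dots> \<le> e"
    proof -
      have "0 < B / e + 1" using B0 e by (simp add: add_nonneg_pos)
      moreover have "B \<le> e * (B / e + 1)" using e by (simp add: distrib_left)
      ultimately show ?thesis by (simp add: pos_divide_le_eq)
    qed
    finally have Be: "B / ln (c / 2) \<le> e" .
    have "\<forall>k i. \<exists>K. 1 \<le> k \<longrightarrow> (\<integral>z. (if K < F' k i z then F' k i z else 0) \<partial>lborel) \<le> e"
      using tail_integral_small[OF F'int F'nn e] by blast
    then obtain K0 where K0: "\<And>k i. 1 \<le> k \<Longrightarrow> (\<integral>z. (if K0 k i < F' k i z then F' k i z else 0) \<partial>lborel) \<le> e" by metis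
    define N where "N = nat \<lceil>c\<rceil>"
    define K where "K = C3 * (2 * c) + (\<Sum>k\<in>{..N}. \<Sum>i\<in>UNIV. \<bar>K0 k i\<bar>)"
    have c30: "0 \<le> C3 * (2 * c)" using c4 by (simp add: C3_def)
    have s0: "0 \<le> (\<Sum>k\<in>{..N}. \<Sum>i\<in>UNIV. \<bar>K0 k i\<bar>)" by (intro sum_nonneg) auto
    have K_pos: "0 \<le> K" using c30 s0 by (simp add: K_def)
    have main: "(\<integral>z. (if K < F' k i z then F' k i z else 0) \<partial>lborel) \<le> e" if k: "1 \<le> k" for k i
    proof (cases "c \<le> real k")
      case True
      have "(\<integral>z. (if K < F' k i z then F' k i z else 0) \<partial>lborel)
          \<le> (\<integral>z. (if C3 * (2 * c) < F' k i z then F' k i z else 0) \<partial>lborel)"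
        by (rule tail_integral_antimono[OF F'int[OF k] F'nn]) (use s0 in \<open>simp add: K_def\<close>)
      also have "\<dots> \<le> B / ln (c / 2)" using tail[OF k c4 True, of i] by (simp add: B_def)
      finally show ?thesis using Be by simp
    next
      case False
      then have "k \<in> {..N}" by (simp add: N_def) linarith
      then have "(\<Sum>i\<in>UNIV. \<bar>K0 k i\<bar>) \<le> (\<Sum>k\<in>{..N}. \<Sum>i\<in>UNIV. \<bar>K0 k i\<bar>)"
        by (intro member_le_sum[of k "{..N}" "\<lambda>k. \<Sum>i\<in>UNIV. \<bar>K0 k i\<bar>"] sum_nonneg) auto
      moreover have "\<bar>K0 k i\<bar> \<le> (\<Sum>i\<in>UNIV. \<bar>K0 k i\<bar>)" by (rule member_le_sum) auto
      ultimately have "K0 k i \<le> K" using c30 by (simp add: K_def) 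
      then have "(\<integral>z. (if K < F' k i z then F' k i z else 0) \<partial>lborel)
          \<le> (\<integral>z. (if K0 k i < F' k i z then F' k i z else 0) \<partial>lborel)"
        by (rule tail_integral_antimono[OF F'int[OF k] F'nn])
      then show ?thesis using K0[OF k, of i] by simp
    qed
    have "(LINT z:\<Omega>|lborel. (if K < F k i z then F k i z else 0)) \<le> e" if k: "1 \<le> k" for k i
    proof -
      have [measurable]: "(\<lambda>z. indicator \<Omega> z *\<^sub>R F k i z) \<in> borel_measurable lborel"
        using L1(1)[OF k, of i] by (auto simp: set_integrable_def)
      have [measurable]: "F' k i \<in> borel_measurable lborel" using F'int[OF k, of i] by auto
      have eq: "(\<lambda>z. indicator \<Omega> z *\<^sub>R (if K < F k i z then F k i z else 0))
          = (\<lambda>z. if K < indicator \<Omega> z *\<^sub>R F k i z then indicator \<Omega> z *\<^sub>R F k i z else 0)"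
        by (rule ext) (use K_pos in \<open>auto simp: indicator_def\<close>)
      have meas: "(\<lambda>z. if K < indicator \<Omega> z *\<^sub>R F k i z then indicator \<Omega> z *\<^sub>R F k i z else 0)
          \<in> borel_measurable lborel" by measurable
      have m: "(\<lambda>z. indicator \<Omega> z *\<^sub>R (if K < F k i z then F k i z else 0)) \<in> borel_measurable lborel"
        by (subst eq) (rule meas)
      have "(LINT z:\<Omega>|lborel. (if K < F k i z then F k i z else 0)) = (\<integral>z. (if K < F' k i z then F' k i z else 0) \<partial>lborel)"
        unfolding set_lebesgue_integral_def
      proof (rule integral_cong_AE[OF m])
        show "AE z in lborel. indicator \<Omega> z *\<^sub>R (if K < F k i z then F k i z else 0) = (if K < F' k i z then F' k i z else 0)"
          using L1(2)[OF k, of i] by eventually_elim (use K_pos in \<open>auto simp: F'_def indicator_def\<close>)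
      qed measurable
      then show ?thesis using main[OF k, of i] by simp
    qed
    then show ?thesis by auto
  qed
  show ?thesis
    by (rule relatively_weakly_compact_L1_if_equiintegrable[OF _ emeasure_bounded_finite[OF domain(2)] _ _ UI])
      (use L1 domain(1) in auto)
qed

end
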